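(* Let $(V,s)$ be a symplectic space over a field $\mathbb{F}$ with $\dim V=2n$, $|\mathbb{F}|>2n-2$ and $n\geq 2$. Let $S$ be an irreducible optimal trivial spectrum subspace of $\mathcal{A}_s$. Then there exists a quadratic field extension $\mathbb{L}=\mathbb{F}[a]$ of $\mathbb{F}$ in $\mathrm{End}(V)$ such that $$S=\mathcal{A}_s\cap\mathcal{A}_{s_a}=\bigcap_{\lambda\in\mathbb{L}}\mathcal{A}_{s_\lambda}$$ and $s_a$ is nonisotropic. Moreover, $\mathbb{L}$ is uniquely determined by $S$. Finally, two such spaces $S$ and $S'$ are conjugated through an element of $\mathrm{Sp}(s)$ if and only if the corresponding extensions $\mathbb{L}$ and $\mathbb{L}'$ are conjugated through an element of the symplectic group $\mathrm{Sp}(s)$.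
   Context: A symplectic space $(V,s)$ is a finite-dimensional $\mathbb{F}$-vector space with a non-degenerate alternating bilinear form $s$; $\mathrm{Sp}(s)=\{\varphi\in\mathrm{GL}(V): s(\varphi(x),\varphi(y))=s(x,y)\ \forall x,y\}$. Subsets $X,X'$ of $\mathrm{End}(V)$ are conjugated through $\varphi$ when $X'=\varphi X\varphi^{-1}$. The characteristic of $\mathbb{F}$ is arbitrary. For a bilinear form $b$ on $V$, $\mathcal{A}_b:=\{u\in\mathrm{End}(V):b(x,u(x))=0\ \forall x\in V\}$; $b$ is nonisotropic when $b(x,x)\neq0$ for all $x\neq0$. For $\lambda\in\mathrm{End}(V)$, $s_\lambda:(x,y)\mapsto s(x,\lambda(y))$. A linear subspace $S$ of $\mathrm{End}(V)$ has trivial spectrum when $\mathrm{id}_V-u$ is invertible for all $u\in S$. A trivial spectrum linear subspace of $\mathcal{A}_s$ is optimal when it has the greatest possible dimension among trivial spectrum linear subspaces of $\mathcal{A}_s$. It is irreducible when no linear subspace of $V$ other than $\{0\}$ and $V$ is invariant under all its elements. A quadratic extension $\mathbb{L}$ of $\mathbb{F}$ in $\mathrm{End}(V)$ is a subalgebra of $\mathrm{End}(V)$ containing $\mathbb{F}\,\mathrm{id}_V$ (identified with $\mathbb{F}$) that is a field of degree $2$ over $\mathbb{F}$; so $\mathbb{L}=\mathbb{F}[a]$ where $a$ has irreducible minimal polynomial of degree $2$. *)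

theory Defs
  imports Complex_Main "HOL-Library.Function_Algebras"
begin

text \<open>
  The vector space V is the whole type \<^typ>\<open>'v\<close>, with scalar multiplication \<open>scale\<close> over the
  field type \<^typ>\<open>'f\<close>. Endomorphisms of V are the linear functions \<^typ>\<open>'v \<Rightarrow> 'v\<close>; addition,
  subtraction and zero of functions are the pointwise ones, multiplication of endomorphisms is
  composition.
\<close>

definition bilinear_form :: "('f::field \<Rightarrow> 'v::ab_group_add \<Rightarrow> 'v) \<Rightarrow> ('v \<Rightarrow> 'v \<Rightarrow> 'f) \<Rightarrow> bool"
  where "bilinear_form scale b \<longleftrightarrow>
    (\<forall>x. Vector_Spaces.linear scale (*) (\<lambda>y. b x y)) \<and>
    (\<forall>y. Vector_Spaces.linear scale (*) (\<lambda>x. b x y))"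

definition symplectic_space :: "('f::field \<Rightarrow> 'v::ab_group_add \<Rightarrow> 'v) \<Rightarrow> ('v \<Rightarrow> 'v \<Rightarrow> 'f) \<Rightarrow> bool"
  where "symplectic_space scale s \<longleftrightarrow>
    (\<exists>B. finite_dimensional_vector_space scale B) \<and>
    bilinear_form scale s \<and>
    (\<forall>x. s x x = 0) \<and>
    (\<forall>x. (\<forall>y. s x y = 0) \<longrightarrow> x = 0)"

definition Endo :: "('f::field \<Rightarrow> 'v::ab_group_add \<Rightarrow> 'v) \<Rightarrow> ('v \<Rightarrow> 'v) set"
  where "Endo scale = {u. Vector_Spaces.linear scale scale u}"

definition Sp :: "('f::field \<Rightarrow> 'v::ab_group_add \<Rightarrow> 'v) \<Rightarrow> ('v \<Rightarrow> 'v \<Rightarrow> 'f) \<Rightarrow> ('v \<Rightarrow> 'v) set"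
  where "Sp scale s = {\<phi> \<in> Endo scale. bij \<phi> \<and> (\<forall>x y. s (\<phi> x) (\<phi> y) = s x y)}"

definition conj_set :: "('v \<Rightarrow> 'v) \<Rightarrow> ('v \<Rightarrow> 'v) set \<Rightarrow> ('v \<Rightarrow> 'v) set"
  where "conj_set \<phi> X = (\<lambda>u. \<phi> \<circ> u \<circ> inv \<phi>) ` X"

definition alt_endo :: "('f::field \<Rightarrow> 'v::ab_group_add \<Rightarrow> 'v) \<Rightarrow> ('v \<Rightarrow> 'v \<Rightarrow> 'f) \<Rightarrow> ('v \<Rightarrow> 'v) set"
  where "alt_endo scale b = {u \<in> Endo scale. \<forall>x. b x (u x) = 0}"

definition nonisotropic :: "('v::ab_group_add \<Rightarrow> 'v \<Rightarrow> 'f::field) \<Rightarrow> bool"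
  where "nonisotropic b \<longleftrightarrow> (\<forall>x. x \<noteq> 0 \<longrightarrow> b x x \<noteq> 0)"

definition twist :: "('v \<Rightarrow> 'v \<Rightarrow> 'f) \<Rightarrow> ('v \<Rightarrow> 'v) \<Rightarrow> 'v \<Rightarrow> 'v \<Rightarrow> 'f"
  where "twist s l = (\<lambda>x y. s x (l y))"

definition fscale :: "('f \<Rightarrow> 'v \<Rightarrow> 'v) \<Rightarrow> 'f \<Rightarrow> ('v \<Rightarrow> 'v) \<Rightarrow> ('v \<Rightarrow> 'v)"
  where "fscale scale c u = (\<lambda>x. scale c (u x))"

lemma vector_space_fscale: "vector_space scale \<Longrightarrow> vector_space (fscale scale)"
  by (simp add: vector_space_def fscale_def fun_eq_iff)

definition endo_subspace :: "('f::field \<Rightarrow> 'v::ab_group_add \<Rightarrow> 'v) \<Rightarrow> ('v \<Rightarrow> 'v) set \<Rightarrow> bool"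
  where "endo_subspace scale S \<longleftrightarrow> S \<subseteq> Endo scale \<and> module.subspace (fscale scale) S"

definition trivial_spectrum :: "('v::ab_group_add \<Rightarrow> 'v) set \<Rightarrow> bool"
  where "trivial_spectrum S \<longleftrightarrow> (\<forall>u\<in>S. bij (id - u))"

definition trivial_spectrum_subspace ::
    "('f::field \<Rightarrow> 'v::ab_group_add \<Rightarrow> 'v) \<Rightarrow> ('v \<Rightarrow> 'v \<Rightarrow> 'f) \<Rightarrow> ('v \<Rightarrow> 'v) set \<Rightarrow> bool"
  where "trivial_spectrum_subspace scale s S \<longleftrightarrow>
    endo_subspace scale S \<and> S \<subseteq> alt_endo scale s \<and> trivial_spectrum S"

definition optimal :: "('f::field \<Rightarrow> 'v::ab_group_add \<Rightarrow> 'v) \<Rightarrow> ('v \<Rightarrow> 'v \<Rightarrow> 'f) \<Rightarrow> ('v \<Rightarrow> 'v) set \<Rightarrow> bool"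
  where "optimal scale s S \<longleftrightarrow>
    trivial_spectrum_subspace scale s S \<and>
    (\<forall>T. trivial_spectrum_subspace scale s T \<longrightarrow>
      vector_space.dim (fscale scale) T \<le> vector_space.dim (fscale scale) S)"

definition irreducible_space :: "('f::field \<Rightarrow> 'v::ab_group_add \<Rightarrow> 'v) \<Rightarrow> ('v \<Rightarrow> 'v) set \<Rightarrow> bool"
  where "irreducible_space scale S \<longleftrightarrow>
    (\<forall>W. module.subspace scale W \<and> (\<forall>u\<in>S. u ` W \<subseteq> W) \<longrightarrow> W = {0} \<or> W = UNIV)"

text \<open>Unital subalgebras of End(V); containing the identity amounts to containing all scalars.\<close>

definition unital_subalgebra :: "('f::field \<Rightarrow> 'v::ab_group_add \<Rightarrow> 'v) \<Rightarrow> ('v \<Rightarrow> 'v) set \<Rightarrow> bool"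
  where "unital_subalgebra scale L \<longleftrightarrow>
    endo_subspace scale L \<and> id \<in> L \<and> (\<forall>u\<in>L. \<forall>v\<in>L. u \<circ> v \<in> L)"

definition gen_subalgebra :: "('f::field \<Rightarrow> 'v::ab_group_add \<Rightarrow> 'v) \<Rightarrow> ('v \<Rightarrow> 'v) \<Rightarrow> ('v \<Rightarrow> 'v) set"
  where "gen_subalgebra scale a = unital_subalgebra scale hull {a}"

definition quadratic_extension :: "('f::field \<Rightarrow> 'v::ab_group_add \<Rightarrow> 'v) \<Rightarrow> ('v \<Rightarrow> 'v) set \<Rightarrow> bool"
  where "quadratic_extension scale L \<longleftrightarrow>
    unital_subalgebra scale L \<and>
    (\<forall>u\<in>L. \<forall>v\<in>L. u \<circ> v = v \<circ> u) \<and>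
    (id :: 'v \<Rightarrow> 'v) \<noteq> 0 \<and>
    (\<forall>u\<in>L. u \<noteq> 0 \<longrightarrow> (\<exists>v\<in>L. u \<circ> v = id)) \<and>
    vector_space.dim (fscale scale) L = 2"

definition corresponding_extension ::
    "('f::field \<Rightarrow> 'v::ab_group_add \<Rightarrow> 'v) \<Rightarrow> ('v \<Rightarrow> 'v \<Rightarrow> 'f) \<Rightarrow> ('v \<Rightarrow> 'v) set \<Rightarrow> ('v \<Rightarrow> 'v) set \<Rightarrow> bool"
  where "corresponding_extension scale s S L \<longleftrightarrow>
    quadratic_extension scale L \<and>
    (\<exists>a\<in>L. L = gen_subalgebra scale a \<and>
      S = alt_endo scale s \<inter> alt_endo scale (twist s a) \<and>
      S = (\<Inter>l\<in>L. alt_endo scale (twist s l)) \<and>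
      nonisotropic (twist s a))"

end

theory Submission
  imports Defs
begin

text \<open>
  Write \<open>x \<and> y\<close> for the alternating endomorphism \<open>z \<mapsto> s(y,z) x - s(x,z) y\<close>. If \<open>x \<and> y\<close> lies in a
  trivial spectrum space \<open>S\<close>, then \<open>y\<close> is orthogonal to \<open>x\<close> and to \<open>S x\<close>. Hence, splitting \<open>S\<close> into
  \<open>S x\<close>, the elements \<open>x \<and> y\<close> and the space induced on \<open>x\<^sup>\<bottom> / \<F> x\<close> by the annihilator of \<open>x\<close>, induction
  yields \<open>dim S \<le> n (n - 1)\<close>, a bound that is attained. For an optimal \<open>S\<close> all these estimates are
  equalities: \<open>x \<and> y \<in> S\<close> if and only if \<open>y\<close> is orthogonal to \<open>S x + \<F> x\<close>, and the induced spaces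
  are optimal.

  If an optimal \<open>S\<close> contains some \<open>x \<and> y \<noteq> 0\<close>, choose \<open>x\<close> with \<open>S x\<close> as small as possible; then
  \<open>S x + \<F> x\<close> is invariant, so \<open>S\<close> is reducible. Otherwise \<open>(S x)\<^sup>\<bottom>\<close> is a plane \<open>P x\<close> containing \<open>x\<close>
  for all \<open>x \<noteq> 0\<close>. The cardinality of the field enters to show that elements of \<open>S\<close> which
  vanish at \<open>x\<close> vanish on \<open>P x\<close>. Therefore the planes \<open>P x\<close> form a spread, and an argument in the
  style of Desargues produces a non-scalar linear map \<open>a\<close> with \<open>a x \<in> P x\<close> for all \<open>x\<close>. The adjoints
  of the maps with this property form the field \<open>L\<close>, which is thus determined by \<open>S\<close>.
\<close>

text \<open>The characteristic is arbitrary, so s(x, u x) = 0 says more than selfadjointness, and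
  identities are obtained by polarising such vanishing expressions. Equality in the dimension count
  has one essential effect: orthogonality of y to S x and x, necessary for x \<and> y to lie in S,
  becomes sufficient. Later arguments produce elements of S in this way.

  The planes come under control because the annihilator of x, which also kills P x, is again
  optimal, now for n - 1, and has no element of rank two; so P x can be divided out and P (x + y)
  compared with P y. For n = 2 this annihilator is 0 and P x + P y leaves no room for a third plane;
  there S is spanned by two invertible maps, and a is a quotient of them.

  Adjoints enter because s(a x, u x) = 0 reads s(x, b (u x)) = 0 for the adjoint b of a. The
  dimension count uses more than n scalars. The bound 2 n - 2 is the dimension of S x when there are
  no elements of rank two: one more eigenvalue than that gives a contradiction.\<close>

definition finitely_spanned :: "('f::field \<Rightarrow> 'v::ab_group_add \<Rightarrow> 'v) \<Rightarrow> 'v set \<Rightarrow> bool"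
  where "finitely_spanned scale A \<longleftrightarrow> (\<exists>B. finite B \<and> A \<subseteq> module.span scale B)"

section \<open>Dimension theory relative to finitely spanned sets, since the space of all maps V ->
  V can be infinite-dimensional\<close>

context vector_space
begin

lemma finitely_spanned_mono: "finitely_spanned scale B \<Longrightarrow> A \<subseteq> B \<Longrightarrow> finitely_spanned scale A"
  unfolding finitely_spanned_def by blast

lemma finitely_spanned_independent:
  assumes "finitely_spanned scale A" "independent B" "B \<subseteq> A"
  shows "finite B" "card B \<le> dim A"
proof -
  obtain D where D: "finite D" "A \<subseteq> span D" using assms(1) unfolding finitely_spanned_def by blast
  show fin: "finite B" using independent_span_bound[OF D(1) assms(2)] D(2) assms(3) by auto
  obtain E where E: "B \<subseteq> E" "E \<subseteq> A" "independent E" "A \<subseteq> span E"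
    using maximal_independent_subset_extend[OF assms(3,2)] by blast
  have "finite E" using independent_span_bound[OF D(1) E(3)] D(2) E(2) by auto
  then have "card B \<le> card E" using E(1) by (rule card_mono)
  also have "\<dots> = dim A" using basis_card_eq_dim[OF E(2,4,3)] by simp
  finally show "card B \<le> dim A" .
qed

lemma finitely_spanned_dim_mono:
  assumes "finitely_spanned scale B" "A \<subseteq> B"
  shows "dim A \<le> dim B"
proof -
  obtain E where E: "E \<subseteq> A" "independent E" "A \<subseteq> span E" "card E = dim A"
    using basis_exists by blast
  show ?thesis using finitely_spanned_independent(2)[OF assms(1) E(2)] E assms(2) by auto
qed

lemma finitely_spanned_dim_eq:
  assumes "finitely_spanned scale B" "A \<subseteq> B" "dim B \<le> dim A" "subspace A"
  shows "A = B"
proof -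
  obtain E where E: "E \<subseteq> A" "independent E" "A \<subseteq> span E" "card E = dim A"
    using basis_exists by blast
  obtain G where G: "E \<subseteq> G" "G \<subseteq> B" "independent G" "B \<subseteq> span G"
    using maximal_independent_subset_extend[of E B] E assms(2) by blast
  have "finite G" using finitely_spanned_independent(1)[OF assms(1) G(3,2)] .
  moreover have "card G \<le> card E" using basis_card_eq_dim[OF G(2,4,3)] assms(3) E(4) by simp
  ultimately have "G = E" using G(1) by (metis card_seteq)
  then have "B \<subseteq> span E" using G(4) by simp
  also have "\<dots> \<subseteq> A" using E(1) assms(4) by (rule span_minimal)
  finally show ?thesis using assms(2) by blast
qed

lemma finitely_spanned_dim_0:
  assumes "finitely_spanned scale A" "subspace A" "dim A = 0"
  shows "A = {0}"
proof -
  have "{0} = A"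
    by (rule finitely_spanned_dim_eq) (use assms subspace_0 in auto)
  then show ?thesis ..
qed

end

context vector_space_pair
begin

text \<open>Complete a basis of the kernel to one of A; the added vectors span the complement. It is
  returned explicitly because \<open>annihilator_polar\<close> needs a subspace on which an
  evaluation is injective.\<close>

lemma rank_nullity_complement:
  assumes f: "Vector_Spaces.linear s1 s2 f" and A: "vs1.subspace A" "finitely_spanned s1 A"
  obtains C where "vs1.subspace C" "C \<subseteq> A" "\<And>c. c \<in> C \<Longrightarrow> f c = 0 \<Longrightarrow> c = 0" "f ` C = f ` A"
    "vs1.dim A = vs1.dim C + vs1.dim {a\<in>A. f a = 0}" "vs1.dim C = vs2.dim (f ` A)"
proof -
  interpret f: Vector_Spaces.linear s1 s2 f by fact
  let ?K = "{a\<in>A. f a = 0}"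
  obtain BK where BK: "BK \<subseteq> ?K" "vs1.independent BK" "?K \<subseteq> vs1.span BK" "card BK = vs1.dim ?K"
    using vs1.basis_exists by blast
  obtain BA where BA: "BK \<subseteq> BA" "BA \<subseteq> A" "vs1.independent BA" "A \<subseteq> vs1.span BA"
    using vs1.maximal_independent_subset_extend[of BK A] BK by blast
  have finA: "finite BA" using vs1.finitely_spanned_independent(1)[OF A(2) BA(3,2)] .
  define D where "D = BA - BK"
  define C where "C = vs1.span D"
  have spA: "vs1.span BA = A" using BA A(1) by (metis vs1.span_subspace)
  have inj: "c = 0" if "c \<in> C" "f c = 0" for c
  proof -
    have "C \<subseteq> A" unfolding C_def D_def using BA A(1) by (intro vs1.span_minimal) auto
    then have "c \<in> vs1.span BK" using that BK by blast
    then have "vs1.representation BA c = vs1.representation BK c"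
      using vs1.representation_extend[OF BA(3) _ BA(1)] by blast
    moreover have "vs1.representation BA c = vs1.representation D c"
      using vs1.representation_extend[OF BA(3), of c D] that unfolding C_def D_def by blast
    ultimately have "vs1.representation BA c b = 0" for b
      using vs1.representation_ne_zero[of BK c b] vs1.representation_ne_zero[of D c b]
      unfolding D_def by auto
    moreover have "c \<in> vs1.span BA" using \<open>c \<in> C\<close> \<open>C \<subseteq> A\<close> spA by blast
    ultimately show "c = 0"
      using vs1.sum_nonzero_representation_eq[OF BA(3), of c] by simp
  qed
  have CA: "C \<subseteq> A" unfolding C_def D_def using BA A(1) by (intro vs1.span_minimal) auto
  have im: "f ` C = f ` A"
  proof
    show "f ` C \<subseteq> f ` A" using CA by blast
    show "f ` A \<subseteq> f ` C"
    proof
      fix y assume "y \<in> f ` A"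
      then obtain a where a: "a \<in> A" "y = f a" by blast
      have "BA = BK \<union> D" using BA unfolding D_def by blast
      then have "a \<in> vs1.span (BK \<union> D)" using a spA by simp
      then obtain k c where kc: "a = k + c" "k \<in> vs1.span BK" "c \<in> C"
        unfolding vs1.span_Un C_def by blast
      have "f k = 0" using kc(2) BK(1) f.eq_0_on_span[of BK k] by auto
      then show "y \<in> f ` C" using kc a f.add by auto
    qed
  qed
  have indD: "vs1.independent D" using BA(3) unfolding D_def by (meson Diff_subset vs1.independent_mono)
  have injC: "inj_on f C"
    unfolding inj_on_def
  proof (intro ballI impI)
    fix a b assume ab: "a \<in> C" "b \<in> C" "f a = f b"
    then have "a - b \<in> C" "f (a - b) = 0" unfolding C_def by (auto simp: vs1.span_diff f.diff)
    then show "a = b" using inj[of "a - b"] by simp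
  qed
  have indf: "vs2.independent (f ` D)"
    using f.independent_injective_image[OF indD] injC unfolding C_def by blast
  have "vs1.dim A = card BA" using vs1.basis_card_eq_dim[OF BA(2,4,3)] by simp
  also have "\<dots> = card D + card BK" unfolding D_def using finA BA(1)
    by (simp add: card_Diff_subset finite_subset card_mono)
  finally have d1: "vs1.dim A = vs1.dim C + vs1.dim ?K"
    unfolding C_def using BK(4) vs1.dim_span_eq_card_independent[OF indD] by simp
  have "f ` C = vs2.span (f ` D)" unfolding C_def by (simp add: f.span_image)
  then have "vs2.dim (f ` A) = card (f ` D)"
    using im vs2.dim_span_eq_card_independent[OF indf] by metis
  also have "\<dots> = card D" using injC vs1.span_superset unfolding C_def by (metis card_image inj_on_subset)
  finally have d2: "vs1.dim C = vs2.dim (f ` A)"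
    unfolding C_def using vs1.dim_span_eq_card_independent[OF indD] by simp
  show ?thesis using that[OF _ CA inj im d1 d2] unfolding C_def by blast
qed

lemma rank_nullity:
  assumes f: "Vector_Spaces.linear s1 s2 f" and A: "vs1.subspace A" "finitely_spanned s1 A"
  shows "vs1.dim A = vs2.dim (f ` A) + vs1.dim {a\<in>A. f a = 0}"
  by (rule rank_nullity_complement[OF assms]) simp

lemma finitely_spanned_extension:
  assumes f: "Vector_Spaces.linear s1 s2 f" and A: "vs1.subspace A"
    and im: "finitely_spanned s2 (f ` A)" and ker: "finitely_spanned s1 {a\<in>A. f a = 0}"
  shows "finitely_spanned s1 A"
proof -
  interpret f: Vector_Spaces.linear s1 s2 f by fact
  obtain BK where BK: "finite BK" "{a\<in>A. f a = 0} \<subseteq> vs1.span BK"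
    using ker unfolding finitely_spanned_def by blast
  obtain E where E: "E \<subseteq> f ` A" "vs2.independent E" "f ` A \<subseteq> vs2.span E"
    by (rule vs2.basis_exists)
  have finE: "finite E" using vs2.finitely_spanned_independent(1)[OF im E(2,1)] .
  obtain D where D: "D \<subseteq> A" "finite D" "E = f ` D" using finite_subset_image[OF finE E(1)] by metis
  have "A \<subseteq> vs1.span (BK \<union> D)"
  proof
    fix a assume a: "a \<in> A"
    then have "f a \<in> vs2.span E" using E(3) by blast
    then have "f a \<in> f ` vs1.span D" unfolding D(3) f.span_image .
    then obtain d where d: "d \<in> vs1.span D" "f a = f d" by blast
    have "d \<in> A" using d(1) vs1.span_minimal[OF D(1) A] by blast
    then have "a - d \<in> A" using a A by (simp add: vs1.subspace_diff)
    moreover have "f (a - d) = 0" using d(2) by (simp add: f.diff)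
    ultimately have "a - d \<in> vs1.span BK" using BK(2) by blast
    then have "a - d \<in> vs1.span (BK \<union> D)" using vs1.span_mono[of BK "BK \<union> D"] by blast
    moreover have "d \<in> vs1.span (BK \<union> D)" using d(1) vs1.span_mono[of D "BK \<union> D"] by blast
    ultimately have "(a - d) + d \<in> vs1.span (BK \<union> D)" by (rule vs1.span_add)
    then show "a \<in> vs1.span (BK \<union> D)" by simp
  qed
  moreover have "finite (BK \<union> D)" using BK(1) D(2) by simp
  ultimately show ?thesis unfolding finitely_spanned_def by blast
qed

text \<open>These are eigenvectors of the pencil B - l J. Applying B to a vanishing combination
  multiplies its coefficients by l, up to J, which cancels because it is injective on T. Subtracting
  m times the original combination removes the index m, as for ordinary eigenvectors.\<close>

lemma pencil_eigenvectors_independent: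
  assumes J: "Vector_Spaces.linear s1 s2 J" and B: "Vector_Spaces.linear s1 s2 B"
    and T: "vs1.subspace T" and inj: "\<And>v. v \<in> T \<Longrightarrow> J v = 0 \<Longrightarrow> v = 0"
    and v: "\<And>l. l \<in> I \<Longrightarrow> v l \<in> T \<and> v l \<noteq> 0 \<and> B (v l) = s2 l (J (v l))"
    and fin: "finite I"
  shows "vs1.independent (v ` I) \<and> inj_on v I"
proof -
  interpret J: Vector_Spaces.linear s1 s2 J by fact
  interpret B: Vector_Spaces.linear s1 s2 B by fact
  have z: "\<forall>c. (\<Sum>l\<in>I. s1 (c l) (v l)) = 0 \<longrightarrow> (\<forall>l\<in>I. c l = 0)"
    using fin v
  proof (induction I rule: finite_induct)
    case (insert m I)
    show ?case
    proof (intro allI impI)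
      fix c assume s: "(\<Sum>l\<in>insert m I. s1 (c l) (v l)) = 0"
      have "B (\<Sum>l\<in>insert m I. s1 (c l) (v l)) = (\<Sum>l\<in>insert m I. s2 (c l) (B (v l)))"
        by (simp add: B.sum B.scale)
      also have "\<dots> = (\<Sum>l\<in>insert m I. J (s1 (c l * l) (v l)))"
        using insert.prems by (intro sum.cong) (auto simp: J.scale)
      also have "\<dots> = J (\<Sum>l\<in>insert m I. s1 (c l * l) (v l))" by (simp add: J.sum)
      finally have "J (\<Sum>l\<in>insert m I. s1 (c l * l) (v l)) = 0" using s by simp
      moreover have "(\<Sum>l\<in>insert m I. s1 (c l * l) (v l)) \<in> T"
        using insert.prems T by (intro vs1.subspace_sum vs1.subspace_scale) auto
      ultimately have s2: "(\<Sum>l\<in>insert m I. s1 (c l * l) (v l)) = 0" using inj by blast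
      have "(\<Sum>l\<in>insert m I. s1 (c l * (l - m)) (v l)) =
          (\<Sum>l\<in>insert m I. s1 (c l * l) (v l)) - s1 m (\<Sum>l\<in>insert m I. s1 (c l) (v l))"
        by (simp add: vs1.scale_sum_right sum_subtractf[symmetric] algebra_simps vs1.scale_left_diff_distrib
            vs1.scale_right_distrib del: sum.insert)
      then have "(\<Sum>l\<in>insert m I. s1 (c l * (l - m)) (v l)) = 0" using s s2 by simp
      then have s3: "(\<Sum>l\<in>I. s1 (c l * (l - m)) (v l)) = 0" using insert.hyps by simp
      have "\<forall>c. (\<Sum>l\<in>I. s1 (c l) (v l)) = 0 \<longrightarrow> (\<forall>l\<in>I. c l = 0)"
        using insert.prems by (intro insert.IH) auto
      from spec[OF this, of "\<lambda>l. c l * (l - m)"] s3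
      have "\<forall>l\<in>I. c l * (l - m) = 0" by (rule mp)
      then have c0: "\<forall>l\<in>I. c l = 0" using insert.hyps by auto
      then have "(\<Sum>l\<in>I. s1 (c l) (v l)) = 0" by simp
      then have "s1 (c m) (v m) = 0" using s insert.hyps by simp
      then have "c m = 0" using insert.prems by auto
      then show "\<forall>l\<in>insert m I. c l = 0" using c0 by auto
    qed
  qed simp
  have zD: "c l = 0" if "(\<Sum>l\<in>I. s1 (c l) (v l)) = 0" "l \<in> I" for c l
    using z[THEN spec, THEN mp, OF that(1)] that(2) by (rule bspec)
  have injv: "inj_on v I"
  proof (rule inj_onI, rule ccontr)
    fix a b assume ab: "a \<in> I" "b \<in> I" "v a = v b" "a \<noteq> b"
    let ?c = "\<lambda>l. if l = a then 1 else if l = b then - 1 else 0"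
    have "(\<Sum>l\<in>I. s1 (?c l) (v l)) = (\<Sum>l\<in>{a,b}. s1 (?c l) (v l))"
      using ab fin by (intro sum.mono_neutral_right) auto
    also have "\<dots> = 0" using ab by simp
    finally have "(\<Sum>l\<in>I. s1 (?c l) (v l)) = 0" .
    from zD[OF this ab(1)] show False by simp
  qed
  have "vs1.independent (v ` I)"
  proof (rule vs1.independent_if_scalars_zero)
    show "finite (v ` I)" using fin by simp
    fix c x assume s: "(\<Sum>x\<in>v ` I. s1 (c x) x) = 0" and x: "x \<in> v ` I"
    have "(\<Sum>l\<in>I. s1 (c (v l)) (v l)) = 0" using s by (simp add: sum.reindex[OF injv])
    from zD[where c = "\<lambda>l. c (v l)", OF this] show "c x = 0" using x by blast
  qed
  then show ?thesis using injv by blast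
qed

end

section \<open>Symplectic forms and alternating endomorphisms\<close>

locale symplectic_form = finite_dimensional_vector_space scale Basis
  for scale :: "'f::field \<Rightarrow> 'v::ab_group_add \<Rightarrow> 'v" (infixr "*s" 75) and Basis +
  fixes s :: "'v \<Rightarrow> 'v \<Rightarrow> 'f"
  assumes bilinear: "bilinear_form scale s"
    and s_self [simp]: "s x x = 0"
    and nondegenerate: "(\<And>y. s x y = 0) \<Longrightarrow> x = 0"
begin

sublocale fs: vector_space "fscale scale"
  by (rule vector_space_fscale) (rule vector_space_axioms)

sublocale fsv: vector_space_pair "fscale scale" scale ..
sublocale fsfs: vector_space_pair "fscale scale" "fscale scale" ..
sublocale vfs: vector_space_pair scale "fscale scale" ..
sublocale vv: vector_space_pair scale scale ..

abbreviation lin :: "('v \<Rightarrow> 'v) \<Rightarrow> bool"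
  where "lin u \<equiv> Vector_Spaces.linear scale scale u"

lemma lin_iff: "lin u \<longleftrightarrow> (\<forall>x y. u (x + y) = u x + u y) \<and> (\<forall>c x. u (c *s x) = c *s u x)"
  using vector_space_axioms by (auto simp: Vector_Spaces.linear_iff)

lemma
  assumes "lin u"
  shows lin_add: "u (x + y) = u x + u y" and lin_scale: "u (c *s x) = c *s u x"
    and lin_0: "u 0 = 0" and lin_diff: "u (x - y) = u x - u y" and lin_neg: "u (- x) = - u x"
proof -
  interpret Vector_Spaces.linear scale scale u by fact
  show "u (x + y) = u x + u y" "u (c *s x) = c *s u x" "u 0 = 0" "u (x - y) = u x - u y" "u (- x) = - u x"
    by (simp_all add: add scale diff neg)
qed

lemmas lin_simps = lin_add lin_scale lin_0 lin_diff lin_neg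

lemma s_lin_right: "Vector_Spaces.linear scale (*) (s x)"
  and s_lin_left: "Vector_Spaces.linear scale (*) (\<lambda>x. s x y)"
  using bilinear unfolding bilinear_form_def by auto

lemma s_simps [simp]:
  "s (x + x') y = s x y + s x' y" "s x (y + y') = s x y + s x y'"
  "s (c *s x) y = c * s x y" "s x (c *s y) = c * s x y"
  "s (x - x') y = s x y - s x' y" "s x (y - y') = s x y - s x y'"
  "s 0 y = 0" "s x 0 = 0" "s (- x) y = - s x y" "s x (- y) = - s x y"
proof -
  interpret r: Vector_Spaces.linear scale "(*)" "s x" for x by (rule s_lin_right)
  interpret l: Vector_Spaces.linear scale "(*)" "\<lambda>x. s x y" for y by (rule s_lin_left)
  show "s (x + x') y = s x y + s x' y" "s x (y + y') = s x y + s x y'"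
    "s (c *s x) y = c * s x y" "s x (c *s y) = c * s x y"
    "s (x - x') y = s x y - s x' y" "s x (y - y') = s x y - s x y'"
    "s 0 y = 0" "s x 0 = 0" "s (- x) y = - s x y" "s x (- y) = - s x y"
    by (simp_all add: r.add l.add r.scale l.scale r.diff l.diff r.neg l.neg)
qed

lemma s_skew: "s y x = - s x y"
proof -
  have "s (x + y) (x + y) = s x x + s x y + (s y x + s y y)"
    by (simp only: s_simps add.assoc add.left_commute)
  then show ?thesis by (simp add: add_eq_0_iff)
qed

lemma s_skew0: "s y x = 0 \<longleftrightarrow> s x y = 0"
  using s_skew[of y x] by simp

lemma nondegenerate_right: "(\<And>y. s y x = 0) \<Longrightarrow> x = 0"
  using nondegenerate[of x] s_skew0 by blast

lemma s_right_eqI: "(\<And>x. s x v = s x w) \<Longrightarrow> v = w"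
  using nondegenerate_right[of "v - w"] by simp

lemma alt_endo_iff: "u \<in> alt_endo scale s \<longleftrightarrow> lin u \<and> (\<forall>x. s x (u x) = 0)"
  unfolding alt_endo_def Endo_def by simp

text \<open>Polarise s(x, u x) = 0; the two signs from skew-symmetry cancel. In characteristic 2 the
  converse fails, which is why alternation itself is carried through the proof.\<close>

lemma selfadjoint:
  assumes "u \<in> alt_endo scale s"
  shows "s (u x) y = s x (u y)"
proof -
  have u: "lin u" "\<And>x. s x (u x) = 0" using assms unfolding alt_endo_iff by auto
  have "s (x + y) (u (x + y)) = 0" by (rule u)
  then have "s x (u y) + s y (u x) = 0" by (simp add: u lin_add[OF u(1)] add.commute)
  then have "s y (u x) = - s x (u y)" by (simp add: add_eq_0_iff)
  then show ?thesis using s_skew[of "u x" y] by simp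
qed

subsection \<open>Orthogonal complements\<close>

definition perp :: "'v set \<Rightarrow> 'v set"
  where "perp X = {v. \<forall>x\<in>X. s x v = 0}"

lemma perp_iff: "v \<in> perp X \<longleftrightarrow> (\<forall>x\<in>X. s x v = 0)"
  unfolding perp_def by simp

lemma subspace_perp [simp]: "subspace (perp X)"
  by (rule subspaceI) (auto simp: perp_iff)

lemma perp_span [simp]: "perp (span X) = perp X"
proof
  show "perp (span X) \<subseteq> perp X" by (auto simp: perp_iff span_base)
  show "perp X \<subseteq> perp (span X)"
  proof
    fix v assume v: "v \<in> perp X"
    have "X \<subseteq> {x. s x v = 0}" using v by (auto simp: perp_iff)
    moreover have "subspace {x. s x v = 0}" by (rule subspaceI) auto
    ultimately have "span X \<subseteq> {x. s x v = 0}" by (rule span_minimal)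
    then show "v \<in> perp (span X)" by (auto simp: perp_iff)
  qed
qed

lemma dim_insert_le: "dim (insert a X) \<le> Suc (dim X)"
  by (simp add: dim_insert)

lemma dim_cut:
  assumes "subspace Y"
  shows "dim Y \<le> dim (Y \<inter> perp {b}) + 1"
proof (cases "Y \<subseteq> perp {b}")
  case True
  then show ?thesis by (simp add: Int_absorb2)
next
  case False
  then obtain y where y: "y \<in> Y" "s b y \<noteq> 0" unfolding perp_def by blast
  have "Y \<subseteq> span (insert y (Y \<inter> perp {b}))"
  proof
    fix v assume v: "v \<in> Y"
    let ?c = "s b v / s b y"
    have "v - ?c *s y \<in> Y \<inter> perp {b}"
      using v y assms by (auto simp: perp_iff subspace_diff subspace_scale)
    then show "v \<in> span (insert y (Y \<inter> perp {b}))"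
      unfolding span_insert using span_base by blast
  qed
  then have "dim Y \<le> dim (insert y (Y \<inter> perp {b}))" by (rule dim_mono)
  then show ?thesis using dim_insert_le[of y "Y \<inter> perp {b}"] by simp
qed

lemma dim_cut_finite:
  assumes "subspace Y" "finite A"
  shows "dim Y \<le> dim (Y \<inter> perp A) + card A"
  using assms(2)
proof (induction A rule: finite_induct)
  case empty
  then show ?case by (simp add: perp_def)
next
  case (insert a A)
  have "dim (Y \<inter> perp A) \<le> dim (Y \<inter> perp A \<inter> perp {a}) + 1"
    by (rule dim_cut) (simp add: assms(1) subspace_inter)
  moreover have "Y \<inter> perp A \<inter> perp {a} = Y \<inter> perp (insert a A)" by (auto simp: perp_iff)
  ultimately show ?case using insert by simp
qed

text \<open>Nondegeneracy of s on U. Inductions on the dimension run over such subspaces of the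
  fixed space, which replaces passing to quotient spaces.\<close>

definition regular :: "'v set \<Rightarrow> bool"
  where "regular U \<longleftrightarrow> subspace U \<and> U \<inter> perp U = {0}"

lemma regular_UNIV: "regular UNIV"
  unfolding regular_def using nondegenerate_right by (auto simp: perp_iff)

lemma regularD: "regular U \<Longrightarrow> x \<in> U \<Longrightarrow> x \<noteq> 0 \<Longrightarrow> \<exists>y\<in>U. s x y = 1"
proof -
  assume U: "regular U" "x \<in> U" "x \<noteq> 0"
  then have "x \<notin> perp U" unfolding regular_def by blast
  then obtain y where y: "y \<in> U" "s y x \<noteq> 0" by (auto simp: perp_iff)
  then have "s x ((1 / s x y) *s y) = 1" using s_skew0 by simp
  then show ?thesis using y U(1) subspace_scale unfolding regular_def by blast
qed

text \<open>One orthogonality condition costs at most one dimension, which gives one inequality from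
  a basis of X. Conversely, the conditions from a basis of U containing it leave only 0, so those
  outside X bound the dimension of the complement of X by dim U - dim X.\<close>

lemma dim_perp:
  assumes U: "regular U" and X: "subspace X" "X \<subseteq> U"
  shows "dim (U \<inter> perp X) + dim X = dim U"
proof -
  have sU: "subspace U" using U unfolding regular_def by blast
  obtain B where B: "B \<subseteq> X" "independent B" "X \<subseteq> span B" "card B = dim X"
    by (rule basis_exists[of X])
  obtain C where C: "B \<subseteq> C" "C \<subseteq> U" "independent C" "U \<subseteq> span C"
    using maximal_independent_subset_extend[OF subset_trans[OF B(1) X(2)] B(2)] by blast
  have fin: "finite C" using C(3) by (rule finiteI_independent)
  have spB: "span B = X" using B X by (simp add: span_subspace)
  have spC: "span C = U" using C sU by (simp add: span_subspace)
  have pX: "perp X = perp B" using spB perp_span by metis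
  have pU: "perp U = perp C" using spC perp_span by metis
  have cardC: "card C = dim U" using C by (simp add: basis_card_eq_dim)
  have 1: "dim U \<le> dim (U \<inter> perp X) + dim X"
    using dim_cut_finite[OF sU, of B] fin C(1) B(4) pX by (simp add: finite_subset)
  have "dim (U \<inter> perp B) \<le> dim (U \<inter> perp B \<inter> perp (C - B)) + card (C - B)"
    using fin sU by (intro dim_cut_finite) (auto simp: subspace_inter)
  moreover have "U \<inter> perp B \<inter> perp (C - B) = {0}"
  proof -
    have "U \<inter> perp B \<inter> perp (C - B) = U \<inter> perp U" using C(1) unfolding pU unfolding perp_def by blast
    then show ?thesis using U unfolding regular_def by simp
  qed
  moreover have "card (C - B) = card C - card B" using fin C(1) by (simp add: card_Diff_subset finite_subset)
  moreover have "card B \<le> card C" using fin C(1) by (rule card_mono)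
  ultimately show ?thesis using 1 B(4) cardC pX by simp
qed

lemma perp_perp_eq:
  assumes U: "regular U" and X: "subspace X" "X \<subseteq> U"
  shows "U \<inter> perp (U \<inter> perp X) = X"
proof -
  have sU: "subspace U" using U unfolding regular_def by blast
  have "dim (U \<inter> perp (U \<inter> perp X)) + dim (U \<inter> perp X) = dim U"
    by (rule dim_perp[OF U]) (auto simp: subspace_inter sU)
  then have "dim (U \<inter> perp (U \<inter> perp X)) = dim X" using dim_perp[OF assms] by simp
  moreover have "X \<subseteq> U \<inter> perp (U \<inter> perp X)" using X(2) by (auto simp: perp_iff s_skew0)
  ultimately have "X = U \<inter> perp (U \<inter> perp X)"
    by (intro subspace_dim_equal) (auto simp: X subspace_inter sU)
  then show ?thesis ..
qed

lemma isotropic_dim: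
  assumes "regular U" "dim U = 2 * k" "subspace X" "X \<subseteq> U" "X \<subseteq> perp X"
  shows "dim X \<le> k"
proof -
  have "dim X \<le> dim (U \<inter> perp X)" using assms by (intro dim_subset) auto
  then show ?thesis using dim_perp[OF assms(1,3,4)] assms(2) by simp
qed

lemma riesz:
  assumes "Vector_Spaces.linear scale (*) f"
  obtains w where "\<And>x. f x = s x w"
proof (cases "\<forall>x. f x = 0")
  case True
  then show ?thesis using that[of 0] by simp
next
  case False
  then obtain v where v: "f v \<noteq> 0" by blast
  interpret f: Vector_Spaces.linear scale "(*)" f by fact
  let ?H = "{x. f x = 0}"
  have H: "subspace ?H" by (rule f.subspace_kernel)
  have "perp ?H \<noteq> {0}"
  proof
    assume "perp ?H = {0}"
    then have "dim ?H = dim (UNIV :: 'v set)"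
      using dim_perp[OF regular_UNIV H] by simp
    then have "?H = UNIV" using H by (intro subspace_dim_equal) auto
    then show False using v by auto
  qed
  then obtain w where w: "w \<in> perp ?H" "w \<noteq> 0" using subspace_0[OF subspace_perp] by blast
  have eq: "s x w * f v = f x * s v w" for x
  proof -
    have "f (f v *s x - f x *s v) = 0" by (simp add: f.diff f.scale)
    then have "s (f v *s x - f x *s v) w = 0" using w by (auto simp: perp_iff)
    then show ?thesis by (simp add: mult.commute)
  qed
  have "s v w \<noteq> 0"
  proof
    assume "s v w = 0"
    then have "s x w = 0" for x using eq[of x] v by simp
    then show False using nondegenerate_right w(2) by blast
  qed
  then have "f x = s x ((f v / s v w) *s w)" for x using eq[of x] v by (simp add: field_simps)
  then show ?thesis by (rule that)
qed

end

lemma exists_finite_subset_avoiding: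
  assumes "infinite (UNIV :: 'a set) \<or> card (UNIV :: 'a set) > k"
  obtains I :: "'a set" where "finite I" "card I = k" "a \<notin> I"
proof (cases "infinite (UNIV :: 'a set)")
  case True
  then have "infinite (UNIV - {a})" by simp
  then obtain I where "finite I" "card I = k" "I \<subseteq> UNIV - {a}" using infinite_arbitrarily_large by metis
  then show ?thesis using that by blast
next
  case False
  then have "k \<le> card (UNIV - {a})" using assms by simp
  then obtain I where "I \<subseteq> UNIV - {a}" "card I = k" by (meson obtain_subset_with_card_n)
  then show ?thesis using that False finite_subset by blast
qed

context symplectic_form
begin

subsection \<open>Spaces of endomorphisms\<close>

lemma fscale_apply: "fscale scale c u x = c *s u x"
  by (simp add: fscale_def)

lemma linear_eval: "Vector_Spaces.linear (fscale scale) scale (\<lambda>u. u x)"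
  using fs.vector_space_axioms vector_space_axioms by (auto simp: Vector_Spaces.linear_iff fscale_apply)

lemma subspace_eval: "fs.subspace S \<Longrightarrow> subspace ((\<lambda>u. u x) ` S)"
proof -
  interpret Vector_Spaces.linear "fscale scale" scale "\<lambda>u. u x" by (rule linear_eval)
  show "fs.subspace S \<Longrightarrow> subspace ((\<lambda>u. u x) ` S)" by (rule subspace_image)
qed

lemma finitely_spanned_UNIV: "finitely_spanned scale A"
  unfolding finitely_spanned_def using finite_Basis span_Basis by (intro exI[of _ Basis]) auto

text \<open>Evaluate at one point of X: the image lies in V, and the kernel is determined by the
  remaining points. With X a basis, End(V) becomes finitely spanned.\<close>

lemma finitely_spanned_if_determined:
  assumes "finite X" "fs.subspace A" "\<And>u. u \<in> A \<Longrightarrow> (\<And>x. x \<in> X \<Longrightarrow> u x = 0) \<Longrightarrow> u = 0"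
  shows "finitely_spanned (fscale scale) A"
  using assms
proof (induction X arbitrary: A rule: finite_induct)
  case empty
  then have "A \<subseteq> fs.span {}" unfolding fs.span_empty by blast
  then show ?case unfolding finitely_spanned_def by blast
next
  case (insert x X)
  have "fs.subspace {u \<in> A. u x = 0}"
    by (rule fs.subspaceI) (auto simp: fscale_apply intro: fs.subspace_0[OF insert.prems(1)]
      fs.subspace_add[OF insert.prems(1)] fs.subspace_scale[OF insert.prems(1)])
  then have "finitely_spanned (fscale scale) {u \<in> A. u x = 0}"
    by (rule insert.IH) (use insert.prems(2) in auto)
  then show ?case
    using fsv.finitely_spanned_extension[OF linear_eval[of x] insert.prems(1)] finitely_spanned_UNIV by blast
qed

lemma subspace_Endo: "fs.subspace (Endo scale)"
  by (rule fs.subspaceI) (auto simp: fscale_apply Endo_def lin_iff algebra_simps scale_right_distrib)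

lemma lin_eq_0_on_Basis:
  assumes "lin u" "\<And>x. x \<in> Basis \<Longrightarrow> u x = 0"
  shows "u = 0"
proof -
  interpret Vector_Spaces.linear scale scale u by fact
  have "u x = 0" for x using eq_0_on_span[of Basis x] assms(2) span_Basis by auto
  then show ?thesis by (simp add: fun_eq_iff)
qed

lemma finitely_spanned_Endo: "A \<subseteq> Endo scale \<Longrightarrow> finitely_spanned (fscale scale) A"
  using fs.finitely_spanned_mono[OF finitely_spanned_if_determined[OF finite_Basis subspace_Endo]]
    lin_eq_0_on_Basis by (simp add: Endo_def)

lemma alt_endo_Endo: "alt_endo scale b \<subseteq> Endo scale"
  unfolding alt_endo_def by blast

lemma subspace_alt_endo: "fs.subspace (alt_endo scale s)"
  by (rule fs.subspaceI) (auto simp: fscale_apply alt_endo_iff lin_iff algebra_simps scale_right_distrib)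

definition wedge :: "'v \<Rightarrow> 'v \<Rightarrow> 'v \<Rightarrow> 'v"
  where "wedge x y = (\<lambda>z. s y z *s x - s x z *s y)"

lemma wedge_alt_endo: "wedge x y \<in> alt_endo scale s"
proof -
  have "s z x * s y z = s z y * s x z" for z using s_skew[of x z] s_skew[of y z] by simp
  then show ?thesis
    by (auto simp: alt_endo_iff lin_iff wedge_def algebra_simps scale_right_diff_distrib)
qed

lemma linear_wedge: "Vector_Spaces.linear scale (fscale scale) (wedge x)"
  using fs.vector_space_axioms vector_space_axioms
  by (auto simp: fscale_apply Vector_Spaces.linear_iff wedge_def fun_eq_iff algebra_simps scale_right_diff_distrib)

lemma wedge_skew: "wedge y x = - wedge x y"
  by (auto simp: wedge_def fun_eq_iff)

lemma wedge_add: "wedge x (y + z) = wedge x y + wedge x z"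
  and wedge_scale: "wedge x (c *s y) = fscale scale c (wedge x y)"
  and wedge_self [simp]: "wedge x x = 0"
  and wedge_0 [simp]: "wedge x 0 = 0"
  by (auto simp: fscale_apply wedge_def fun_eq_iff algebra_simps scale_right_diff_distrib)

text \<open>Trivial spectrum subspaces of alternating endomorphisms of the regular subspace \<open>U\<close>, where an
  endomorphism of \<open>U\<close> is identified with its extension by \<open>0\<close> on the orthogonal complement of \<open>U\<close>.\<close>

definition trivial_space :: "'v set \<Rightarrow> ('v \<Rightarrow> 'v) set \<Rightarrow> bool"
  where "trivial_space U S \<longleftrightarrow> regular U \<and> fs.subspace S \<and> S \<subseteq> alt_endo scale s \<and>
    (\<forall>u\<in>S. range u \<subseteq> U) \<and> (\<forall>u\<in>S. \<forall>x. u x = x \<longrightarrow> x = 0)"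

lemma
  assumes "trivial_space U S"
  shows ts_regular: "regular U" and ts_subspace: "subspace U" and ts_fs: "fs.subspace S"
    and ts_alt: "u \<in> S \<Longrightarrow> u \<in> alt_endo scale s"
    and ts_lin: "u \<in> S \<Longrightarrow> lin u" and ts_range: "u \<in> S \<Longrightarrow> u x \<in> U"
    and ts_self: "u \<in> S \<Longrightarrow> s x (u x) = 0"
    and ts_adj: "u \<in> S \<Longrightarrow> s (u x) y = s x (u y)"
    and ts_fix: "u \<in> S \<Longrightarrow> u x = x \<Longrightarrow> x = 0"
    and ts_eigen: "u \<in> S \<Longrightarrow> u x = c *s x \<Longrightarrow> c \<noteq> 0 \<Longrightarrow> x = 0"
    and ts_finite: "finitely_spanned (fscale scale) S"
    and ts_add: "u \<in> S \<Longrightarrow> v \<in> S \<Longrightarrow> u + v \<in> S"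
    and ts_scale: "u \<in> S \<Longrightarrow> fscale scale c u \<in> S"
    and ts_diff: "u \<in> S \<Longrightarrow> v \<in> S \<Longrightarrow> u - v \<in> S"
proof -
  show 1: "regular U" and "subspace U" and sub: "fs.subspace S" and 2: "u \<in> S \<Longrightarrow> u \<in> alt_endo scale s" for u
    using assms unfolding trivial_space_def regular_def by auto
  show 3: "u \<in> S \<Longrightarrow> lin u" "u \<in> S \<Longrightarrow> s x (u x) = 0" for u x using 2 unfolding alt_endo_iff by auto
  show "u \<in> S \<Longrightarrow> u x \<in> U" for u x using assms unfolding trivial_space_def by (auto simp: image_subset_iff)
  show "u \<in> S \<Longrightarrow> s (u x) y = s x (u y)" using 2 selfadjoint by blast
  show fx: "u \<in> S \<Longrightarrow> u x = x \<Longrightarrow> x = 0" for u x using assms unfolding trivial_space_def by auto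
  show "u \<in> S \<Longrightarrow> v \<in> S \<Longrightarrow> u + v \<in> S" "u \<in> S \<Longrightarrow> v \<in> S \<Longrightarrow> u - v \<in> S"
    and sc: "u \<in> S \<Longrightarrow> fscale scale c u \<in> S" for c u
    using sub fs.subspace_add fs.subspace_diff fs.subspace_scale by blast+
  show "u \<in> S \<Longrightarrow> u x = c *s x \<Longrightarrow> c \<noteq> 0 \<Longrightarrow> x = 0"
    using fx[OF sc[of u "1 / c"], of x] by (simp add: fscale_apply)
  have "S \<subseteq> Endo scale" using 2 alt_endo_Endo by blast
  then show "finitely_spanned (fscale scale) S" by (rule finitely_spanned_Endo)
qed

lemma s_pow:
  assumes "u \<in> alt_endo scale s"
  shows "s ((u ^^ i) x) y = s x ((u ^^ i) y)"
proof (induction i arbitrary: y)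
  case (Suc i)
  have "s ((u ^^ Suc i) x) y = s ((u ^^ i) x) (u y)" by (simp add: selfadjoint[OF assms])
  also have "\<dots> = s x ((u ^^ Suc i) y)" by (simp add: Suc funpow_swap1)
  finally show ?case .
qed simp

text \<open>Moving half of the factors across the form leaves s(y, y) or s(y, u y) with y = u^m x,
  both zero even in characteristic 2.\<close>

lemma s_pow_self:
  assumes "u \<in> alt_endo scale s"
  shows "s x ((u ^^ i) x) = 0"
proof (cases "even i")
  case True
  then obtain m where "i = m + m" by (metis evenE mult_2)
  then show ?thesis using s_pow[OF assms, of m x "(u ^^ m) x"] by (simp add: funpow_add)
next
  case False
  then obtain m where "i = Suc (m + m)" by (metis oddE mult_2 Suc_eq_plus1)
  then have "(u ^^ i) x = (u ^^ m) (u ((u ^^ m) x))" by (simp add: funpow_add funpow_swap1)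
  then have "s x ((u ^^ i) x) = s ((u ^^ m) x) (u ((u ^^ m) x))" using s_pow[OF assms, of m x] by simp
  then show ?thesis using assms by (simp add: alt_endo_iff)
qed

lemma lin_pow: "lin u \<Longrightarrow> lin (u ^^ i)"
  by (induction i) (auto simp: lin_iff)

text \<open>If the conclusion fails for \<open>j\<close> minimal, the vectors \<open>\<xi> t\<close> with \<open>(id - t u) (\<xi> t) = x\<close> for
  \<open>t \<noteq> 0\<close> are eigenvectors, with eigenvalues \<open>1 / t\<close>, of a rank one perturbation of \<open>u\<close>; they span
  a totally isotropic space to which \<open>y\<close> may be added.\<close>

lemma wedge_pow_perp:
  assumes S: "trivial_space U S" and dimU: "dim U = 2 * k"
    and big: "infinite (UNIV :: 'f set) \<or> card (UNIV :: 'f set) > k"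
    and x: "x \<in> U" and y: "y \<in> U" and xy: "wedge x y \<in> S" and u: "u \<in> S"
  shows "s y ((u ^^ j) x) = 0"
proof (rule ccontr)
  let ?P = "\<lambda>j. s y ((u ^^ j) x) \<noteq> 0"
  assume "\<not> s y ((u ^^ j) x) = 0"
  then have P: "?P j" by simp
  define m where "m = (LEAST j. ?P j)"
  have Pm: "?P m" unfolding m_def using P by (rule LeastI)
  have Pl: "s y ((u ^^ i) x) = 0" if "i < m" for i
    using that not_less_Least[of i ?P] unfolding m_def by blast
  have ua: "u \<in> alt_endo scale s" and ul: "lin u" using ts_alt[OF S u] ts_lin[OF S u] by auto
  note us = lin_simps[OF ul]
  have ulp: "lin (u ^^ i)" for i using lin_pow[OF ul] .
  have x0: "x \<noteq> 0" using Pm lin_0[OF ulp] by auto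
  have sU: "subspace U" using ts_subspace[OF S] .
  have yx: "s y x = 0"
  proof (rule ccontr)
    assume "s y x \<noteq> 0"
    moreover have "wedge x y x = s y x *s x" by (simp add: wedge_def)
    ultimately show False using ts_eigen[OF S xy] x0 by blast
  qed
  have "\<exists>\<xi>. \<xi> - t *s u \<xi> = x" for t
  proof -
    have tu: "fscale scale t u \<in> S" using ts_scale[OF S u] .
    have l: "lin (\<lambda>\<xi>. \<xi> - t *s u \<xi>)"
      by (auto simp: lin_iff us algebra_simps scale_right_distrib scale_right_diff_distrib)
    have "inj (\<lambda>\<xi>. \<xi> - t *s u \<xi>)"
    proof (rule injI)
      fix a b assume "a - t *s u a = b - t *s u b"
      then have "t *s u (a - b) = a - b" by (simp add: us scale_right_diff_distrib algebra_simps)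
      then show "a = b" using ts_fix[OF S tu, of "a - b"] by (simp add: fscale_apply)
    qed
    then have "surj (\<lambda>\<xi>. \<xi> - t *s u \<xi>)" using l linear_inj_imp_surj by blast
    then obtain \<xi> where "x = \<xi> - t *s u \<xi>" unfolding surj_def by blast
    then have "\<xi> - t *s u \<xi> = x" by simp
    then show ?thesis by (rule exI)
  qed
  then obtain \<xi> where \<xi>: "\<And>t. \<xi> t - t *s u (\<xi> t) = x" by metis
  have \<xi>U: "\<xi> t \<in> U" for t
  proof -
    have "\<xi> t = x + t *s u (\<xi> t)" using \<xi>[of t] by (simp add: algebra_simps)
    then show ?thesis using x ts_range[OF S u] sU by (metis subspace_add subspace_scale)
  qed
  have \<xi>0: "\<xi> t \<noteq> 0" for t using \<xi>[of t] x0 us by auto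
  have x\<xi>: "s x (\<xi> t) = 0" for t
    unfolding \<xi>[of t, symmetric] using ts_self[OF S u] s_skew0 by simp
  \<comment> \<open>Pair the equation of \<xi> r with \<xi> t and that of \<xi> t with \<xi> r: the
    value is both r times and t times s(\<xi> t, u (\<xi> r)).\<close>
  have \<xi>\<xi>: "s (\<xi> t) (\<xi> r) = 0" for t r
  proof (cases "t = r")
    case False
    have "s (\<xi> t) (\<xi> r - r *s u (\<xi> r)) = 0" unfolding \<xi> using x\<xi> s_skew0 by blast
    then have 1: "s (\<xi> t) (\<xi> r) = r * s (\<xi> t) (u (\<xi> r))" by simp
    have "s (\<xi> t - t *s u (\<xi> t)) (\<xi> r) = 0" unfolding \<xi> by (rule x\<xi>)
    then have 2: "s (\<xi> t) (\<xi> r) = t * s (\<xi> t) (u (\<xi> r))" by (simp add: ts_adj[OF S u])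
    have "(t - r) * s (\<xi> t) (u (\<xi> r)) = 0" using 1 2 by (simp add: algebra_simps)
    then show ?thesis using False 1 by simp
  qed simp
  \<comment> \<open>Otherwise t u plus a multiple of \<open>wedge x y\<close> fixes \<xi> t: the
    image of \<xi> t under t u falls short of \<xi> t by x, and the wedge supplies a nonzero
    multiple of x because s x (\<xi> t) = 0.\<close>
  have y\<xi>: "s y (\<xi> t) = 0" for t
  proof (rule ccontr)
    assume n: "s y (\<xi> t) \<noteq> 0"
    let ?w = "fscale scale t u + fscale scale (1 / s y (\<xi> t)) (wedge x y)"
    have "?w \<in> S" using ts_add[OF S] ts_scale[OF S] u xy by blast
    moreover have "?w (\<xi> t) = \<xi> t"
      using n x\<xi>[of t] \<xi>[of t] by (simp add: fscale_apply wedge_def algebra_simps)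
    ultimately show False using ts_fix[OF S] \<xi>0 by blast
  qed
  have \<xi>x: "s (\<xi> t) ((u ^^ i) x) = 0" for t i
  proof -
    have "(u ^^ i) x = (u ^^ i) (\<xi> t) - t *s (u ^^ Suc i) (\<xi> t)"
      unfolding \<xi>[of t, symmetric] by (simp add: lin_simps[OF ulp] funpow_swap1)
    then show ?thesis using s_pow_self[OF ua] by (simp del: funpow.simps)
  qed
  have step: "t * s y ((u ^^ Suc i) (\<xi> t)) = s y ((u ^^ i) (\<xi> t)) - s y ((u ^^ i) x)" for t i
  proof -
    have "(u ^^ i) x = (u ^^ i) (\<xi> t) - t *s (u ^^ Suc i) (\<xi> t)"
      unfolding \<xi>[of t, symmetric] by (simp add: lin_simps[OF ulp] funpow_swap1)
    then show ?thesis by (simp del: funpow.simps)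
  qed
  have low: "s y ((u ^^ i) (\<xi> t)) = 0" if "i \<le> m" "t \<noteq> 0" for i t
    using that(1)
  proof (induction i)
    case 0
    then show ?case using y\<xi> by simp
  next
    case (Suc i)
    then have "t * s y ((u ^^ Suc i) (\<xi> t)) = 0" unfolding step using Pl by simp
    then show ?case using that(2) by (simp del: funpow.simps)
  qed
  \<comment> \<open>By \<open>step\<close>, t s(y, u^(m+1) (\<xi> t)) = - s(y, u^m x) is the first
    nonzero value. So \<psi> is scaled to be 1 / t at \<xi> t, and as u (\<xi> t) = (\<xi> t - x) /
    t, adding the multiple \<psi> v of x makes \<xi> t an eigenvector.\<close>
  define \<psi> where "\<psi> v = - s y ((u ^^ Suc m) v) / s y ((u ^^ m) x)" for v
  have \<psi>: "\<psi> (\<xi> t) = 1 / t" if "t \<noteq> 0" for t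
    using step[of t m] low[of m t] that Pm unfolding \<psi>_def by (simp add: field_simps del: funpow.simps)
  have \<psi>lin: "\<psi> (a + b) = \<psi> a + \<psi> b" "\<psi> (c *s a) = c * \<psi> a" for a b c
    unfolding \<psi>_def by (simp_all add: lin_simps[OF ulp] add_divide_distrib diff_divide_distrib del: funpow.simps)
  define B where "B v = u v + \<psi> v *s x" for v
  have B: "lin B" unfolding B_def lin_iff by (auto simp: us \<psi>lin scale_left_distrib scale_right_distrib)
  obtain I :: "'f set" where I: "finite I" "card I = k" "0 \<notin> I"
    using exists_finite_subset_avoiding[OF big] by blast
  define v where "v l = \<xi> (1 / l)" for l
  have Bv: "B (v l) = l *s v l" if "l \<in> I" for l
  proof -
    have l: "l \<noteq> 0" using I that by auto
    have "v l - (1 / l) *s u (v l) = x" unfolding v_def by (rule \<xi>)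
    then have "l *s (v l - (1 / l) *s u (v l)) = l *s x" by simp
    then have "l *s v l - u (v l) = l *s x" using l by (simp add: scale_right_diff_distrib)
    then show ?thesis unfolding B_def using \<psi>[of "1 / l"] l unfolding v_def by (simp add: algebra_simps)
  qed
  have ind: "independent (v ` I) \<and> inj_on v I"
    by (rule vv.pencil_eigenvectors_independent[where T = UNIV and J = "\<lambda>x. x" and B = B])
      (use Bv I B \<xi>0 v_def in \<open>auto simp: lin_iff\<close>)
  \<comment> \<open>Every \<xi> t is orthogonal to u^m x, while y is not, by the choice of m. So the
    k eigenvectors and y span an isotropic space of dimension k + 1.\<close>
  have "y \<notin> span (v ` I)"
  proof
    assume ys: "y \<in> span (v ` I)"
    have "subspace {z. s z ((u ^^ m) x) = 0}" by (rule subspaceI) auto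
    then have "span (v ` I) \<subseteq> {z. s z ((u ^^ m) x) = 0}"
      by (rule span_minimal[rotated]) (auto simp: v_def \<xi>x)
    then show False using ys Pm by blast
  qed
  then have ind2: "independent (insert y (v ` I))" and ynot: "y \<notin> v ` I"
    using ind independent_insertI span_base by blast+
  let ?G = "insert y (v ` I)"
  have "card ?G = Suc k" using ynot I ind by (simp add: card_image)
  then have dimG: "dim (span ?G) = Suc k" using dim_span_eq_card_independent[OF ind2] by simp
  have "?G \<subseteq> perp ?G" using \<xi>\<xi> y\<xi> unfolding v_def by (auto simp: perp_iff s_skew0)
  then have "span ?G \<subseteq> perp (span ?G)" unfolding perp_span by (rule span_minimal) simp
  moreover have "span ?G \<subseteq> U" using y \<xi>U sU unfolding v_def by (intro span_minimal) auto
  ultimately have "dim (span ?G) \<le> k"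
    using isotropic_dim[OF ts_regular[OF S] dimU subspace_span] by blast
  then show False using dimG by simp
qed

subsection \<open>Reduction modulo a vector\<close>

text \<open>For s x x' = 1 this is the orthogonal projection onto {x, x'}^perp, a model of x^perp /
  F x. An alternating u with u x = 0 maps into x^perp, and compressing it by this projection
  realises the induced map on the quotient.\<close>

definition hproj :: "'v \<Rightarrow> 'v \<Rightarrow> 'v \<Rightarrow> 'v"
  where "hproj x x' v = v + s x' v *s x - s x v *s x'"

definition reduced :: "'v \<Rightarrow> 'v \<Rightarrow> ('v \<Rightarrow> 'v) set \<Rightarrow> ('v \<Rightarrow> 'v) set"
  where "reduced x x' S = (\<lambda>u. hproj x x' \<circ> u \<circ> hproj x x') ` {u\<in>S. u x = 0}"

lemma lin_hproj: "lin (hproj x x')"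
  by (auto simp: lin_iff hproj_def algebra_simps scale_right_diff_distrib scale_right_distrib
      scale_left_distrib)

lemma hproj_adj: "s (hproj x x' a) b = s a (hproj x x' b)"
  using s_skew[of a x] s_skew[of a x'] by (simp add: hproj_def)

lemma hproj_id: "s x v = 0 \<Longrightarrow> s x' v = 0 \<Longrightarrow> hproj x x' v = v"
  by (simp add: hproj_def)

lemma hproj_perp:
  assumes "s x x' = 1"
  shows "s x (hproj x x' v) = 0" "s x' (hproj x x' v) = 0" "hproj x x' x = 0"
  using assms s_skew[of x' x] by (simp_all add: hproj_def)

lemma hproj_mem: "subspace U \<Longrightarrow> x \<in> U \<Longrightarrow> x' \<in> U \<Longrightarrow> v \<in> U \<Longrightarrow> hproj x x' v \<in> U"
  unfolding hproj_def by (intro subspace_add subspace_diff subspace_scale)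

lemma hproj_decomp: "v = hproj x x' v - s x' v *s x + s x v *s x'"
  by (simp add: hproj_def)

lemma lin_compose3: "lin p \<Longrightarrow> lin u \<Longrightarrow> lin (p \<circ> u \<circ> p)"
  by (auto simp: lin_iff)

lemma linear_compress: "lin p \<Longrightarrow> Vector_Spaces.linear (fscale scale) (fscale scale) (\<lambda>u. p \<circ> u \<circ> p)"
  using fs.vector_space_axioms by (auto simp: fscale_apply Vector_Spaces.linear_iff[of "fscale scale"] fun_eq_iff lin_iff)

lemma subspace_annihilator: "fs.subspace S \<Longrightarrow> fs.subspace {u\<in>S. u x = 0}"
  by (rule fs.subspaceI) (auto simp: fscale_apply intro: fs.subspace_0 fs.subspace_add fs.subspace_scale)

lemma subspace_wedge_partners:
  assumes "trivial_space U S"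
  shows "subspace {y\<in>U. wedge x y \<in> S}"
  by (rule subspaceI)
    (auto simp: wedge_add wedge_scale intro: subspace_0 subspace_add subspace_scale ts_subspace[OF assms]
      ts_add[OF assms] ts_scale[OF assms] fs.subspace_0[OF ts_fs[OF assms]])

lemma dim_hyperbolic:
  assumes U: "regular U" and x: "x \<in> U" "x' \<in> U" "s x x' = 1" and X: "subspace X" "X \<subseteq> U" "X \<subseteq> perp {x}" "x \<notin> X"
  shows "dim (U \<inter> perp {x,x'} \<inter> perp X) + dim X + 2 = dim U"
proof -
  have "x \<notin> span X" using X(1,4) by (metis span_eq_iff)
  then have 1: "dim (insert x X) = Suc (dim X)" by (simp add: dim_insert)
  have "span (insert x X) \<subseteq> perp {x}" using X(3) by (intro span_minimal) (auto simp: perp_iff)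
  then have "x' \<notin> span (insert x X)" using x(3) by (auto simp: perp_iff)
  then have 2: "dim (insert x' (insert x X)) = dim X + 2" using 1 by (simp add: dim_insert)
  let ?N = "span (insert x' (insert x X))"
  have "?N \<subseteq> U" using x X U unfolding regular_def by (intro span_minimal) auto
  then have "dim (U \<inter> perp ?N) + dim ?N = dim U" by (intro dim_perp[OF U]) auto
  moreover have "U \<inter> perp ?N = U \<inter> perp {x,x'} \<inter> perp X" unfolding perp_span by (auto simp: perp_iff)
  ultimately show ?thesis using 2 by simp
qed

lemma regular_hyperbolic:
  assumes U: "regular U" and x: "x \<in> U" "x' \<in> U" "s x x' = 1"
  shows "regular (U \<inter> perp {x,x'})" "dim (U \<inter> perp {x,x'}) + 2 = dim U"
proof -
  have sU: "subspace U" using U unfolding regular_def by blast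
  have x0: "x \<noteq> 0" using x(3) by auto
  show "dim (U \<inter> perp {x,x'}) + 2 = dim U"
    using dim_hyperbolic[OF U x, of "{0}"] sU x0 by (simp add: perp_def subspace_0)
  have "v = 0" if v: "v \<in> U \<inter> perp {x,x'}" "v \<in> perp (U \<inter> perp {x,x'})" for v
  proof -
    have "s w v = 0" if w: "w \<in> U" for w
    proof -
      have "hproj x x' w \<in> U \<inter> perp {x,x'}"
        using hproj_mem[OF sU x(1,2) w] hproj_perp[OF x(3)] by (auto simp: perp_iff)
      then have "s (hproj x x' w) v = 0" using v by (auto simp: perp_iff)
      moreover have "s x v = 0" "s x' v = 0" using v by (auto simp: perp_iff)
      ultimately show ?thesis using s_skew0[of v x'] s_skew0[of v x]
        by (subst hproj_decomp[of w x x']) simp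
    qed
    then have "v \<in> U \<inter> perp U" using v by (auto simp: perp_iff)
    then show ?thesis using U unfolding regular_def by blast
  qed
  then show "regular (U \<inter> perp {x,x'})"
    unfolding regular_def using sU by (auto simp: subspace_inter subspace_0)
qed

context
  fixes U S x x' k
  assumes S: "trivial_space U S" and dimU: "dim U = 2 * k"
    and big: "infinite (UNIV :: 'f set) \<or> card (UNIV :: 'f set) > k"
    and x: "x \<in> U" and x': "x' \<in> U" and xx': "s x x' = 1"
begin

private abbreviation "p \<equiv> hproj x x'"
private abbreviation "U' \<equiv> U \<inter> perp {x,x'}"
private abbreviation "Sx \<equiv> {u\<in>S. u x = 0}"

private lemma sU: "subspace U" using ts_subspace[OF S] .

private lemma p_U': "v \<in> U \<Longrightarrow> p v \<in> U'"
  using hproj_mem[OF sU x x'] hproj_perp[OF xx'] by (auto simp: perp_iff)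

lemma trivial_space_reduced: "trivial_space U' (reduced x x' S)"
  unfolding trivial_space_def
proof (intro conjI)
  show "regular U'" using regular_hyperbolic(1)[OF ts_regular[OF S] x x' xx'] .
  interpret c: Vector_Spaces.linear "fscale scale" "fscale scale" "\<lambda>u. p \<circ> u \<circ> p"
    by (rule linear_compress[OF lin_hproj])
  show "fs.subspace (reduced x x' S)"
    unfolding reduced_def by (rule c.subspace_image) (rule subspace_annihilator[OF ts_fs[OF S]])
  show "reduced x x' S \<subseteq> alt_endo scale s"
    using ts_lin[OF S] ts_self[OF S]
    by (auto simp: reduced_def alt_endo_iff lin_compose3 lin_hproj hproj_adj[symmetric])
  show "\<forall>u\<in>reduced x x' S. range u \<subseteq> U'"
  proof
    fix w assume "w \<in> reduced x x' S"
    then obtain u where u: "u \<in> S" "w = p \<circ> u \<circ> p" unfolding reduced_def by blast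
    have "w z \<in> U'" for z using p_U'[OF ts_range[OF S u(1)], of "p z"] u(2) by simp
    then show "range w \<subseteq> U'" by blast
  qed
  show "\<forall>u\<in>reduced x x' S. \<forall>v. u v = v \<longrightarrow> v = 0"
  proof (intro ballI allI impI)
    fix w v assume "w \<in> reduced x x' S" and wv: "w v = v"
    then obtain u where u: "u \<in> S" "u x = 0" "w = p \<circ> u \<circ> p" unfolding reduced_def by blast
    have eq: "p (u (p v)) = v" using wv u by simp
    have v: "s x v = 0" "s x' v = 0" using hproj_perp(1,2)[OF xx', of "u (p v)"] eq by simp_all
    then have pv: "p v = v" by (rule hproj_id)
    have ux: "s x (u v) = 0" using ts_adj[OF S u(1), of x v] u(2) by simp
    \<comment> \<open>u v equals v up to a multiple of x. As u kills x, the vector v - c x is fixed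
      by u, hence zero; then v orthogonal to x' forces c = 0.\<close>
    define c where "c = s x' (u v)"
    have uv: "u v = v - c *s x"
      using hproj_decomp[of "u v" x x'] eq pv ux unfolding c_def by simp
    have "u (v - c *s x) = u v"
      using u(2) by (simp only: lin_simps[OF ts_lin[OF S u(1)]]) simp
    then have "v - c *s x = 0" using uv ts_fix[OF S u(1)] by (metis (no_types))
    then have vc: "v = c *s x" by simp
    then have "c * s x' x = 0" using v(2) by simp
    then have "c = 0" using xx' s_skew[of x' x] by simp
    then show "v = 0" using vc by simp
  qed
qed

lemma compress_kernel: "{u\<in>Sx. p \<circ> u \<circ> p = 0} = wedge x ` {y\<in>U'. wedge x y \<in> S}"
proof
  show "wedge x ` {y\<in>U'. wedge x y \<in> S} \<subseteq> {u\<in>Sx. p \<circ> u \<circ> p = 0}"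
  proof
    fix w assume "w \<in> wedge x ` {y\<in>U'. wedge x y \<in> S}"
    then obtain y where y: "y \<in> U'" "w \<in> S" "w = wedge x y" by blast
    have "s y x = 0" using y(1) s_skew0 by (auto simp: perp_iff)
    then have "w x = 0" unfolding y(3) by (simp add: wedge_def)
    moreover have "p (w (p z)) = 0" for z
      unfolding y(3) by (simp add: wedge_def hproj_perp[OF xx'] lin_simps[OF lin_hproj])
    ultimately show "w \<in> {u\<in>Sx. p \<circ> u \<circ> p = 0}" using y(2) by (auto simp: fun_eq_iff)
  qed
  show "{u\<in>Sx. p \<circ> u \<circ> p = 0} \<subseteq> wedge x ` {y\<in>U'. wedge x y \<in> S}"
  proof
    fix u assume "u \<in> {u\<in>Sx. p \<circ> u \<circ> p = 0}"
    then have u: "u \<in> S" "u x = 0" and pup: "p (u (p z)) = 0" for z by (auto simp: fun_eq_iff)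
    note ul = lin_simps[OF ts_lin[OF S u(1)]]
    have sx: "s x (u z) = 0" for z using ts_adj[OF S u(1), of x z] u(2) by simp
    \<comment> \<open>Evaluation at x' leaves no other choice: \<open>wedge x y x'\<close> is - y
      when y is orthogonal to x'.\<close>
    define y where "y = - u x'"
    have "s x' (u x') = 0" using ts_self[OF S u(1)] .
    then have yU: "y \<in> U'" unfolding y_def using ts_range[OF S u(1)] sx sU by (auto simp: perp_iff subspace_neg)
    have "u z = wedge x y z" for z
    proof -
      have "u z = u (p z) + s x z *s u x'"
        by (subst hproj_decomp[of z x x']) (simp add: ul u(2))
      moreover have "u (p z) = - s x' (u (p z)) *s x"
        using hproj_decomp[of "u (p z)" x x'] pup[of z] sx[of "p z"] by simp
      moreover have "s x' (u (p z)) = - s y z"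
        using ts_adj[OF S u(1), of x' "p z"] hproj_adj[of x x' y z] hproj_id[of x y x'] yU
        unfolding y_def by (simp add: perp_iff)
      ultimately show ?thesis by (simp add: wedge_def y_def)
    qed
    then have "u = wedge x y" by (simp add: fun_eq_iff)
    then show "u \<in> wedge x ` {y\<in>U'. wedge x y \<in> S}" using yU u(1) by blast
  qed
qed

lemma dim_reduction:
  "fs.dim S = dim ((\<lambda>u. u x) ` S) + dim {y\<in>U'. wedge x y \<in> S} + fs.dim (reduced x x' S)"
proof -
  have 1: "fs.dim S = dim ((\<lambda>u. u x) ` S) + fs.dim Sx"
    by (rule fsv.rank_nullity[OF linear_eval ts_fs[OF S] ts_finite[OF S]])
  have Sx: "fs.subspace Sx" "finitely_spanned (fscale scale) Sx"
    using subspace_annihilator[OF ts_fs[OF S]] fs.finitely_spanned_mono[OF ts_finite[OF S]] by auto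
  have 2: "fs.dim Sx = fs.dim (reduced x x' S) + fs.dim {u\<in>Sx. p \<circ> u \<circ> p = 0}"
    unfolding reduced_def by (rule fsfs.rank_nullity[OF linear_compress[OF lin_hproj] Sx])
  let ?K = "{y\<in>U'. wedge x y \<in> S}"
  have K: "subspace ?K"
  proof -
    have "?K = {y\<in>U. wedge x y \<in> S} \<inter> perp {x,x'}" by blast
    then show ?thesis using subspace_wedge_partners[OF S] subspace_perp by (metis subspace_inter)
  qed
  have inj: "{y\<in>?K. wedge x y = 0} = {0}"
  proof -
    have "y = 0" if "y \<in> U'" "wedge x y = 0" for y
    proof -
      have "wedge x y x' = 0" using that(2) by simp
      then show ?thesis using that(1) xx' s_skew0[of y x'] by (simp add: wedge_def perp_iff)
    qed
    moreover have "0 \<in> ?K" using subspace_0[OF K] .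
    ultimately show ?thesis by auto
  qed
  have "dim ?K = fs.dim (wedge x ` ?K) + dim {y\<in>?K. wedge x y = 0}"
    by (rule vfs.rank_nullity[OF linear_wedge K finitely_spanned_UNIV])
  then have "dim ?K = fs.dim {u\<in>Sx. p \<circ> u \<circ> p = 0}"
    unfolding inj compress_kernel by simp
  then show ?thesis using 1 2 by simp
qed

private lemma x_notin: "x \<notin> (\<lambda>u. u x) ` S"
proof
  assume "x \<in> (\<lambda>u. u x) ` S"
  then obtain u where "u \<in> S" "u x = x" by auto
  then have "x = 0" using ts_fix[OF S] by blast
  then show False using xx' by simp
qed

lemma dim_orth: "dim (U' \<inter> perp ((\<lambda>u. u x) ` S)) + dim ((\<lambda>u. u x) ` S) + 2 = 2 * k"
proof -
  have "(\<lambda>u. u x) ` S \<subseteq> U" "(\<lambda>u. u x) ` S \<subseteq> perp {x}"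
    using ts_range[OF S] ts_self[OF S] by (auto simp: perp_iff)
  from dim_hyperbolic[OF ts_regular[OF S] x x' xx' subspace_eval[OF ts_fs[OF S]] this x_notin]
  show ?thesis using dimU by simp
qed

lemma partners_subset: "{y\<in>U'. wedge x y \<in> S} \<subseteq> U' \<inter> perp ((\<lambda>u. u x) ` S)"
proof
  fix y assume y: "y \<in> {y\<in>U'. wedge x y \<in> S}"
  then have "s y (u x) = 0" if "u \<in> S" for u
    using wedge_pow_perp[OF S dimU big x, of y u 1] that by simp
  then show "y \<in> U' \<inter> perp ((\<lambda>u. u x) ` S)" using y s_skew0 by (auto simp: perp_iff)
qed

text \<open>The partners of x in {x, x'}^perp are orthogonal to S x, so their dimension and that of
  S x add up to at most 2 k - 2, however they are distributed.\<close>

lemma dim_step: "fs.dim S + 2 \<le> 2 * k + fs.dim (reduced x x' S)"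
  using dim_reduction dim_orth dim_subset[OF partners_subset] by simp

lemma dim_step_eq:
  assumes "fs.dim S + 2 = 2 * k + fs.dim (reduced x x' S)"
  shows "{y\<in>U'. wedge x y \<in> S} = U' \<inter> perp ((\<lambda>u. u x) ` S)"
proof (rule subspace_dim_equal)
  have "{y\<in>U'. wedge x y \<in> S} = {y\<in>U. wedge x y \<in> S} \<inter> perp {x,x'}" by blast
  then show "subspace {y\<in>U'. wedge x y \<in> S}"
    using subspace_wedge_partners[OF S] subspace_perp by (metis subspace_inter)
  show "subspace (U' \<inter> perp ((\<lambda>u. u x) ` S))" by (simp add: sU subspace_inter)
  show "dim (U' \<inter> perp ((\<lambda>u. u x) ` S)) \<le> dim {y\<in>U'. wedge x y \<in> S}"
    using dim_reduction dim_orth assms by simp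
qed (rule partners_subset)

end

section \<open>The dimension bound and the case of equality\<close>

theorem dim_trivial_space_le:
  assumes "trivial_space U S" "dim U = 2 * k"
    and "infinite (UNIV :: 'f set) \<or> card (UNIV :: 'f set) > k"
  shows "fs.dim S \<le> k * (k - 1)"
  using assms
proof (induction k arbitrary: U S)
  case 0
  then have "U = {0}" using ts_subspace subspace_0 by auto
  then have "u x = 0" if "u \<in> S" for u x using ts_range[OF 0(1) that] by blast
  then have "S \<subseteq> fs.span {}" unfolding fs.span_empty by (auto simp: fun_eq_iff)
  from fs.dim_le_card[OF this finite.emptyI] show ?case unfolding card.empty mult_0 .
next
  case (Suc k)
  have "\<not> U \<subseteq> {0}" using Suc.prems(2) dim_eq_0[of U] by auto
  then obtain x where x: "x \<in> U" "x \<noteq> 0" by blast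
  then obtain x' where x': "x' \<in> U" "s x x' = 1" using regularD[OF ts_regular[OF Suc.prems(1)]] by blast
  note c = Suc.prems x(1) x'
  have "fs.dim (reduced x x' S) \<le> k * (k - 1)"
  proof (rule Suc.IH)
    show "trivial_space (U \<inter> perp {x,x'}) (reduced x x' S)" by (rule trivial_space_reduced[OF c])
    show "dim (U \<inter> perp {x,x'}) = 2 * k"
      using regular_hyperbolic(2)[OF ts_regular[OF Suc.prems(1)] x(1) x'] Suc.prems(2) by simp
  qed (use Suc.prems(3) in auto)
  then show ?case using dim_step[OF c] by (cases k) auto
qed

text \<open>Optimality as equality in the bound rather than as maximality, so that it passes to
  reduced spaces by counting; the field condition is carried along because the bound depends on it.
  \<open>optimal_iff\<close> makes the connection with \<open>optimal\<close>.\<close>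

definition optimal_space :: "'v set \<Rightarrow> nat \<Rightarrow> ('v \<Rightarrow> 'v) set \<Rightarrow> bool"
  where "optimal_space U k S \<longleftrightarrow> trivial_space U S \<and> dim U = 2 * k \<and> fs.dim S = k * (k - 1) \<and>
    (infinite (UNIV :: 'f set) \<or> card (UNIV :: 'f set) > k)"

lemma
  assumes S: "optimal_space U k S" and x: "x \<in> U" "x' \<in> U" "s x x' = 1"
  shows optimal_reduced: "optimal_space (U \<inter> perp {x,x'}) (k - 1) (reduced x x' S)"
    and optimal_partners: "{y\<in>U \<inter> perp {x,x'}. wedge x y \<in> S} = U \<inter> perp {x,x'} \<inter> perp ((\<lambda>u. u x) ` S)"
proof -
  have S': "trivial_space U S" "dim U = 2 * k" "infinite (UNIV :: 'f set) \<or> card (UNIV :: 'f set) > k"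
    and dimS: "fs.dim S = k * (k - 1)" using S unfolding optimal_space_def by auto
  note c = S' x
  have "dim U \<noteq> 0" using x(1,3) by auto
  then obtain l where k: "k = Suc l" using S'(2) by (cases k) auto
  have t: "trivial_space (U \<inter> perp {x,x'}) (reduced x x' S)" by (rule trivial_space_reduced[OF c])
  have d: "dim (U \<inter> perp {x,x'}) = 2 * l"
    using regular_hyperbolic(2)[OF ts_regular[OF S'(1)] x] S'(2) k by simp
  have b: "infinite (UNIV :: 'f set) \<or> card (UNIV :: 'f set) > l" using S'(3) k by auto
  have "fs.dim (reduced x x' S) \<le> l * (l - 1)" by (rule dim_trivial_space_le[OF t d b])
  then have e: "fs.dim (reduced x x' S) = l * (l - 1)" using dim_step[OF c] dimS k by (cases l) auto
  then show "optimal_space (U \<inter> perp {x,x'}) (k - 1) (reduced x x' S)"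
    unfolding optimal_space_def using t d b k by simp
  have "fs.dim S + 2 = 2 * k + fs.dim (reduced x x' S)" using e dimS k by (cases l) auto
  then show "{y\<in>U \<inter> perp {x,x'}. wedge x y \<in> S} = U \<inter> perp {x,x'} \<inter> perp ((\<lambda>u. u x) ` S)"
    by (rule dim_step_eq[OF c])
qed

lemma optimal_trivial: "optimal_space U k S \<Longrightarrow> trivial_space U S"
  unfolding optimal_space_def by blast

lemma optimal_wedge_iff:
  assumes S: "optimal_space U k S" and x: "x \<in> U" and y: "y \<in> U"
  shows "wedge x y \<in> S \<longleftrightarrow> s y x = 0 \<and> (\<forall>u\<in>S. s y (u x) = 0)"
proof (cases "x = 0")
  case True
  have "wedge 0 y = 0" by (simp add: wedge_def fun_eq_iff)
  moreover have "s y (u 0) = 0" if "u \<in> S" for u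
    using lin_0[OF ts_lin[OF optimal_trivial[OF S] that]] by simp
  ultimately show ?thesis using True fs.subspace_0[OF ts_fs[OF optimal_trivial[OF S]]] by simp
next
  case False
  have T: "trivial_space U S" "dim U = 2 * k" "infinite (UNIV :: 'f set) \<or> card (UNIV :: 'f set) > k"
    using S unfolding optimal_space_def by auto
  show ?thesis
  proof
    assume w: "wedge x y \<in> S"
    have "s y ((u ^^ i) x) = 0" if "u \<in> S" for u i by (rule wedge_pow_perp[OF T x y w that])
    from this[OF w, of 0] this[of _ 1] show "s y x = 0 \<and> (\<forall>u\<in>S. s y (u x) = 0)" by simp
  next
    assume w: "s y x = 0 \<and> (\<forall>u\<in>S. s y (u x) = 0)"
    obtain x' where x': "x' \<in> U" "s x x' = 1" using regularD[OF ts_regular[OF T(1)] x False] by blast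
    have yx: "s x y = 0" using w s_skew0 by blast
    \<comment> \<open>The projection moves y into {x, x'}^perp by adding a multiple of x, which
      changes neither \<open>wedge x y\<close> nor the orthogonality assumptions.\<close>
    define z where "z = hproj x x' y"
    have z: "z = y + s x' y *s x" unfolding z_def hproj_def using yx by simp
    have "s z (u x) = 0" if "u \<in> S" for u
      unfolding z using w that ts_self[OF T(1)] by simp
    then have "z \<in> perp ((\<lambda>u. u x) ` S)" using s_skew0 by (auto simp: perp_iff)
    moreover have "z \<in> U \<inter> perp {x,x'}"
      unfolding z_def using hproj_mem[OF ts_subspace[OF T(1)] x x'(1) y] hproj_perp[OF x'(2)]
      by (auto simp: perp_iff)
    ultimately have "wedge x z \<in> S" using optimal_partners[OF S x x'] by blast
    then show "wedge x y \<in> S" unfolding z by (simp add: wedge_add wedge_scale)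
  qed
qed

section \<open>Spaces that attain the bound\<close>

lemma range_subset_kills:
  assumes "a \<in> alt_endo scale s" "\<And>z. s x (a z) = 0"
  shows "a x = 0"
  by (rule nondegenerate) (simp add: selfadjoint[OF assms(1)] assms(2))

text \<open>The new maps preserve the flag F x, x^perp in U: a + wedge x y acts as a on x^perp / F
  x, and as 0 on F x and on U / x^perp. So a nonzero fixed vector would have to come from a.\<close>

lemma trivial_space_extend:
  assumes U: "regular U" and x: "x \<in> U" "x' \<in> U" "s x x' = 1"
    and S: "trivial_space (U \<inter> perp {x,x'}) S"
  shows "trivial_space U {a + wedge x y |a y. a \<in> S \<and> y \<in> U \<inter> perp {x,x'}}"
    (is "trivial_space U ?S")
  unfolding trivial_space_def
proof (intro conjI)
  have sU: "subspace U" using U unfolding regular_def by blast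
  have sU': "subspace (U \<inter> perp {x,x'})" using sU by (simp add: subspace_inter)
  note Sr = ts_range[OF S]
  have mem: "a \<in> S \<Longrightarrow> y \<in> U \<inter> perp {x,x'} \<Longrightarrow> a + wedge x y \<in> ?S" for a y by blast
  show "regular U" by fact
  show "fs.subspace ?S"
  proof (rule fs.subspaceI)
    have "(0 :: 'v \<Rightarrow> 'v) + wedge x 0 \<in> ?S"
      by (rule mem) (rule fs.subspace_0[OF ts_fs[OF S]], rule subspace_0[OF sU'])
    then show "0 \<in> ?S" by simp
  next
    fix f g assume "f \<in> ?S" "g \<in> ?S"
    then obtain a y b z where *: "a \<in> S" "b \<in> S" "y \<in> U \<inter> perp {x,x'}" "z \<in> U \<inter> perp {x,x'}"
      "f = a + wedge x y" "g = b + wedge x z" by blast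
    have "(a + b) + wedge x (y + z) \<in> ?S"
      by (rule mem) (use * ts_add[OF S] subspace_add[OF sU'] in blast)+
    then show "f + g \<in> ?S" using * by (simp add: wedge_add algebra_simps)
  next
    fix c f assume "f \<in> ?S"
    then obtain a y where *: "a \<in> S" "y \<in> U \<inter> perp {x,x'}" "f = a + wedge x y" by blast
    have "fscale scale c a + wedge x (c *s y) \<in> ?S"
      by (rule mem) (use * ts_scale[OF S] subspace_scale[OF sU'] in blast)+
    then show "fscale scale c f \<in> ?S" using * by (simp add: wedge_scale fs.scale_right_distrib)
  qed
  show "?S \<subseteq> alt_endo scale s"
    using fs.subspace_add[OF subspace_alt_endo ts_alt[OF S] wedge_alt_endo] by blast
  show "\<forall>u\<in>?S. range u \<subseteq> U"
  proof (intro ballI image_subsetI)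
    fix u z assume "u \<in> ?S"
    then obtain a y where *: "a \<in> S" "y \<in> U" "u = a + wedge x y" by blast
    then show "u z \<in> U" using Sr[OF *(1), of z] x
      by (auto simp: wedge_def intro!: subspace_add subspace_diff subspace_scale sU)
  qed
  show "\<forall>u\<in>?S. \<forall>v. u v = v \<longrightarrow> v = 0"
  proof (intro ballI allI impI)
    fix u v assume "u \<in> ?S" and uv: "u v = v"
    then obtain a y where a: "a \<in> S" and y: "y \<in> U \<inter> perp {x,x'}" and u: "u = a + wedge x y" by blast
    have ay: "s x (a z) = 0" "s x' (a z) = 0" "s x y = 0" "s x' y = 0" for z
      using Sr[OF a, of z] y by (auto simp: perp_iff)
    have ax: "a x = 0" by (rule range_subset_kills[OF ts_alt[OF S a]]) (rule ay)
    have v: "v = a v + s y v *s x - s x v *s y" using uv unfolding u by (simp add: wedge_def add_diff_eq)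
    have sxv: "s x v = 0" by (subst v) (simp add: ay)
    have v2: "v = a v + s y v *s x" using v sxv by simp
    have "a v = a (a v)"
      by (subst v2) (simp add: lin_simps[OF ts_lin[OF S a]] ax)
    then have "a v = 0" using ts_fix[OF S a, of "a v"] by simp
    then have v3: "v = s y v *s x" using v2 by simp
    have "s y x = 0" using ay s_skew0 by blast
    then have "s y v = 0" by (subst v3) simp
    then show "v = 0" using v3 by simp
  qed
qed

theorem exists_trivial_space:
  assumes "regular U" "dim U = 2 * k" "infinite (UNIV :: 'f set) \<or> card (UNIV :: 'f set) > k"
  shows "\<exists>S. trivial_space U S \<and> k * (k - 1) \<le> fs.dim S"
  using assms
proof (induction k arbitrary: U)
  case 0
  have "trivial_space U {0}"
    unfolding trivial_space_def using 0 fs.subspace_0[OF subspace_alt_endo]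
    by (auto simp: regular_def intro: subspace_0 fs.subspace_single_0)
  then show ?case by auto
next
  case (Suc k)
  have "\<not> U \<subseteq> {0}" using Suc.prems(2) dim_eq_0[of U] by auto
  then obtain x where x: "x \<in> U" "x \<noteq> 0" by blast
  then obtain x' where x': "x' \<in> U" "s x x' = 1" using regularD[OF Suc.prems(1)] by blast
  let ?U' = "U \<inter> perp {x,x'}"
  have dim': "dim ?U' = 2 * k"
    using regular_hyperbolic(2)[OF Suc.prems(1) x(1) x'] Suc.prems(2) by simp
  obtain S' where S': "trivial_space ?U' S'" "k * (k - 1) \<le> fs.dim S'"
    using Suc.IH[OF regular_hyperbolic(1)[OF Suc.prems(1) x(1) x'] dim'] Suc.prems(3) by auto
  define S where "S = {a + wedge x y |a y. a \<in> S' \<and> y \<in> ?U'}"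
  have S: "trivial_space U S" unfolding S_def by (rule trivial_space_extend[OF Suc.prems(1) x(1) x' S'(1)])
  note c = S Suc.prems(2,3) x(1) x'
  have sU': "subspace ?U'" using ts_subspace[OF S'(1)] .
  have "wedge x y \<in> S" if "y \<in> ?U'" for y
  proof -
    have "0 + wedge x y \<in> S" unfolding S_def using fs.subspace_0[OF ts_fs[OF S'(1)]] that by blast
    then show ?thesis by simp
  qed
  then have "{y\<in>?U'. wedge x y \<in> S} = ?U'" by blast
  then have d1: "dim {y\<in>?U'. wedge x y \<in> S} = 2 * k" using dim' by simp
  have "S' \<subseteq> reduced x x' S"
  proof
    fix a assume a: "a \<in> S'"
    have ap: "s x (a z) = 0" "s x' (a z) = 0" for z
      using ts_range[OF S'(1) a, of z] by (auto simp: perp_iff)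
    have ax: "a x = 0" "a x' = 0"
      by (rule range_subset_kills[OF ts_alt[OF S'(1) a]], rule ap)+
    have "hproj x x' (a (hproj x x' z)) = a z" for z
    proof -
      have "a (hproj x x' z) = a z"
        by (simp add: hproj_def lin_simps[OF ts_lin[OF S'(1) a]] ax)
      then show ?thesis using hproj_id[OF ap] by simp
    qed
    then have "hproj x x' \<circ> a \<circ> hproj x x' = a" by (simp add: fun_eq_iff)
    moreover have "a \<in> S"
    proof -
      have "a + wedge x 0 \<in> S" unfolding S_def using a subspace_0[OF sU'] by blast
      then show ?thesis by simp
    qed
    ultimately show "a \<in> reduced x x' S" unfolding reduced_def using ax by (metis (mono_tags, lifting) image_eqI mem_Collect_eq)
  qed
  then have "fs.dim S' \<le> fs.dim (reduced x x' S)"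
    by (rule fs.finitely_spanned_dim_mono[OF ts_finite[OF trivial_space_reduced[OF c]]])
  then have "2 * k + k * (k - 1) \<le> fs.dim S" using dim_reduction[OF c] d1 S'(2) by simp
  then have "Suc k * (Suc k - 1) \<le> fs.dim S" by (cases k) auto
  then show ?case using S by blast
qed

lemma trivial_spectrum_subspace_iff: "trivial_spectrum_subspace scale s S \<longleftrightarrow> trivial_space UNIV S"
proof -
  have *: "bij (id - u) \<longleftrightarrow> (\<forall>x. u x = x \<longrightarrow> x = 0)" if "lin u" for u
  proof -
    have l: "lin (id - u)" using that by (auto simp: lin_iff algebra_simps scale_right_distrib)
    then interpret d: Vector_Spaces.linear scale scale "id - u" .
    have "inj (id - u) \<longleftrightarrow> (\<forall>x. u x = x \<longrightarrow> x = 0)" unfolding d.inj_iff_eq_0 by auto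
    then show ?thesis using linear_inj_imp_surj[OF l] unfolding bij_def by blast
  qed
  have "trivial_spectrum S \<longleftrightarrow> (\<forall>u\<in>S. \<forall>x. u x = x \<longrightarrow> x = 0)" if "S \<subseteq> alt_endo scale s"
    unfolding trivial_spectrum_def using that * by (auto simp: alt_endo_iff subset_iff)
  then show ?thesis
    unfolding trivial_spectrum_subspace_def trivial_space_def endo_subspace_def
    using alt_endo_Endo[of s] regular_UNIV by (auto simp del: fs.subspace_UNIV)
qed

lemma optimal_iff:
  assumes dim: "dim UNIV = 2 * n" and n: "n \<ge> 2"
    and big: "infinite (UNIV :: 'f set) \<or> card (UNIV :: 'f set) > 2 * n - 2"
    and S: "optimal scale s S"
  shows "optimal_space UNIV n S"
proof -
  have b: "infinite (UNIV :: 'f set) \<or> card (UNIV :: 'f set) > n" using big n by auto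
  obtain T where T: "trivial_space UNIV T" "n * (n - 1) \<le> fs.dim T"
    using exists_trivial_space[OF regular_UNIV dim b] by blast
  have tS: "trivial_space UNIV S" and "fs.dim T \<le> fs.dim S"
    using S T(1) unfolding optimal_def trivial_spectrum_subspace_iff by blast+
  moreover have "fs.dim S \<le> n * (n - 1)" by (rule dim_trivial_space_le[OF tS dim b])
  ultimately show ?thesis unfolding optimal_space_def using T(2) dim b by simp
qed

subsection \<open>Optimal spaces with elements of rank two\<close>

text \<open>For optimal S this is the orthogonal complement of S x + F x in U, by
  \<open>optimal_wedge_iff\<close>; many partners thus mean a small S x.\<close>

definition partners :: "'v set \<Rightarrow> ('v \<Rightarrow> 'v) set \<Rightarrow> 'v \<Rightarrow> 'v set"
  where "partners U S x = {y\<in>U. wedge x y \<in> S}"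

definition paired :: "'v set \<Rightarrow> ('v \<Rightarrow> 'v) set \<Rightarrow> 'v \<Rightarrow> bool"
  where "paired U S x \<longleftrightarrow> x \<in> U \<and> x \<noteq> 0 \<and> (\<exists>y\<in>partners U S x. y \<notin> span {x})"

text \<open>Maximality of x is contradicted through this count: if \<open>K w\<close> contains a
  part of \<open>K x\<close> of codimension at most one and two further independent vectors, then
  \<open>K w\<close> is larger than \<open>K x\<close>.\<close>

lemma dim_two_more:
  assumes "subspace H" "subspace L" "H \<subseteq> L" "a \<in> L" "b \<in> L" "a \<notin> H" "b \<notin> span (insert a H)"
  shows "dim H + 2 \<le> dim L"
proof -
  have "a \<notin> span H" using assms(1,6) by (metis span_eq_iff)
  then have "dim (insert b (insert a H)) = dim H + 2" using assms(7) by (simp add: dim_insert)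
  moreover have "dim (insert b (insert a H)) \<le> dim L" using assms by (intro dim_subset) auto
  ultimately show ?thesis by simp
qed

lemma dim_one_more:
  assumes "subspace H" "subspace L" "H \<subseteq> L" "a \<in> L" "a \<notin> H"
  shows "dim H < dim L"
  using assms by (intro dim_psubset) (auto simp: span_eq_iff[THEN iffD2])

lemma span_insert_subspace: "subspace H \<Longrightarrow> b \<in> span (insert a H) \<Longrightarrow> \<exists>c. b - c *s a \<in> H"
  by (metis span_breakdown_eq span_eq_iff)

context
  fixes U k S
  assumes S: "optimal_space U k S"
begin

private lemma tS: "trivial_space U S" using optimal_trivial[OF S] .
private lemma subU: "subspace U" using ts_subspace[OF tS] .

private abbreviation "K \<equiv> partners U S"

lemma partners_iff: "x \<in> U \<Longrightarrow> y \<in> K x \<longleftrightarrow> y \<in> U \<and> s y x = 0 \<and> (\<forall>u\<in>S. s y (u x) = 0)"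
  unfolding partners_def using optimal_wedge_iff[OF S] by auto

lemma partners_sym: "x \<in> U \<Longrightarrow> y \<in> K x \<Longrightarrow> x \<in> K y"
  unfolding partners_def using fs.subspace_neg[OF ts_fs[OF tS]] by (auto simp: wedge_skew[of y x])

lemma subspace_partners: "subspace (K x)"
  unfolding partners_def by (rule subspace_wedge_partners[OF tS])

lemma partners_self: "x \<in> U \<Longrightarrow> x \<in> K x"
  unfolding partners_def using fs.subspace_0[OF ts_fs[OF tS]] by simp

lemma partners_U: "y \<in> K x \<Longrightarrow> y \<in> U"
  unfolding partners_def by simp

lemma partners_perp: "x \<in> U \<Longrightarrow> y \<in> K x \<Longrightarrow> s x y = 0"
  using partners_iff s_skew0 by blast

lemma perp_partners:
  assumes x: "x \<in> U" and w: "w \<in> U" "\<And>y. y \<in> K x \<Longrightarrow> s y w = 0"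
  obtains u c where "u \<in> S" "w = u x + c *s x"
proof -
  let ?X = "{w. \<exists>u\<in>S. \<exists>c. w = u x + c *s x}"
  have X: "subspace ?X"
  proof (rule subspaceI)
    show "0 \<in> ?X" using fs.subspace_0[OF ts_fs[OF tS]] by (auto intro!: bexI[of _ 0] exI[of _ 0])
  next
    fix a b assume "a \<in> ?X" "b \<in> ?X"
    then obtain u c v d where "u \<in> S" "v \<in> S" "a = u x + c *s x" "b = v x + d *s x" by blast
    then show "a + b \<in> ?X" using ts_add[OF tS, of u v]
      by (auto intro!: bexI[of _ "u + v"] exI[of _ "c + d"] simp: scale_left_distrib algebra_simps)
  next
    fix a e assume "a \<in> ?X"
    then obtain u c where "u \<in> S" "a = u x + c *s x" by blast
    then show "e *s a \<in> ?X" using ts_scale[OF tS, of u e]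
      by (auto intro!: bexI[of _ "fscale scale e u"] exI[of _ "e * c"] simp: fscale_apply scale_right_distrib)
  qed
  have XU: "?X \<subseteq> U" using ts_range[OF tS] x subU by (auto intro: subspace_add subspace_scale)
  have "U \<inter> perp ?X \<subseteq> K x"
  proof
    fix y assume y: "y \<in> U \<inter> perp ?X"
    have *: "s (u x + c *s x) y = 0" if "u \<in> S" for u c using y that unfolding perp_def by blast
    have "s x y = 0" using *[OF fs.subspace_0[OF ts_fs[OF tS]], of 1] by simp
    moreover have "s (u x) y = 0" if "u \<in> S" for u using *[OF that, of 0] by simp
    ultimately show "y \<in> K x" using y s_skew0 by (simp add: partners_iff[OF x])
  qed
  then have "w \<in> U \<inter> perp (U \<inter> perp ?X)" using w by (auto simp: perp_iff)
  then have "w \<in> ?X" unfolding perp_perp_eq[OF ts_regular[OF tS] X XU] .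
  then show ?thesis using that by blast
qed

text \<open>The parts of s y (u^j x) = 0 that appear on replacing u by u + v. For j = 3 the two
  mixed parts stay together; wherever this identity is used, five of its six terms vanish
  separately.\<close>

lemma
  assumes x: "x \<in> U" and y: "y \<in> K x"
  shows partners_1: "u \<in> S \<Longrightarrow> s y (u x) = 0"
    and partners_2: "u \<in> S \<Longrightarrow> s y (u (u x)) = 0"
    and partners_2': "u \<in> S \<Longrightarrow> v \<in> S \<Longrightarrow> s y (u (v x)) + s y (v (u x)) = 0"
    and partners_3: "u \<in> S \<Longrightarrow> v \<in> S \<Longrightarrow>
      s y (u (u (v x))) + s y (u (v (u x))) + s y (v (u (u x))) +
      (s y (v (v (u x))) + s y (v (u (v x))) + s y (u (v (v x)))) = 0"
proof -
  have *: "s y ((u ^^ j) x) = 0" if "u \<in> S" for u j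
    using wedge_pow_perp[OF tS _ _ x _ _ that] S y unfolding optimal_space_def partners_def by blast
  show "u \<in> S \<Longrightarrow> s y (u x) = 0" using *[of u 1] by simp
  show 2: "s y (u (u x)) = 0" if "u \<in> S" for u using *[OF that, of 2] by (simp add: numeral_2_eq_2)
  have 3: "s y (u (u (u x))) = 0" if "u \<in> S" for u using *[OF that, of 3] by (simp add: numeral_3_eq_3)
  show "s y (u (v x)) + s y (v (u x)) = 0" if uv: "u \<in> S" "v \<in> S"
    using 2[OF ts_add[OF tS uv]] 2[OF uv(1)] 2[OF uv(2)]
    by (simp add: lin_simps[OF ts_lin[OF tS uv(1)]] lin_simps[OF ts_lin[OF tS uv(2)]] algebra_simps)
  show "s y (u (u (v x))) + s y (u (v (u x))) + s y (v (u (u x))) +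
      (s y (v (v (u x))) + s y (v (u (v x))) + s y (u (v (v x)))) = 0" if uv: "u \<in> S" "v \<in> S"
    using 3[OF ts_add[OF tS uv]] 3[OF uv(1)] 3[OF uv(2)]
    by (simp add: lin_simps[OF ts_lin[OF tS uv(1)]] lin_simps[OF ts_lin[OF tS uv(2)]] algebra_simps)
qed

section \<open>Vectors with the largest set of partners\<close>

context
  fixes x
  assumes x: "x \<in> U" and x0: "x \<noteq> 0"
    and max: "\<And>w. w \<in> U \<Longrightarrow> w \<noteq> 0 \<Longrightarrow> dim (K w) \<le> dim (K x)"
begin

text \<open>Suppose s x z is nonzero and let w be a partner of z with s x w = 0. The map
  \<open>wedge z w\<close> sends x to a nonzero multiple of w, so for y in \<open>K x\<close> with s
  z y = 0 the orthogonality to S x transfers to w and S w. With z and one of x, w as further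
  vectors, \<open>K w\<close> becomes too large.\<close>

lemma paired_perp_max:
  assumes z: "paired U S z"
  shows "s x z = 0"
proof (rule ccontr)
  assume xz: "s x z \<noteq> 0"
  then have zx: "s z x \<noteq> 0" using s_skew0 by blast
  obtain w1 where w1: "w1 \<in> K z" "w1 \<notin> span {z}" and zU: "z \<in> U" using z unfolding paired_def by blast
  define w where "w = w1 - (s x w1 / s x z) *s z"
  have wK: "w \<in> K z" unfolding w_def
    using w1 partners_self[OF zU] subspace_partners by (intro subspace_diff subspace_scale)
  have xw: "s x w = 0" unfolding w_def using xz by simp
  then have wx: "s w x = 0" using s_skew0 by blast
  have w0: "w \<noteq> 0" using w1(2) unfolding w_def span_singleton by auto
  have wU: "w \<in> U" using partners_U[OF wK] .
  define p where "p = wedge z w"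
  have pS: "p \<in> S" using wK unfolding p_def partners_def by blast
  have px: "p x = - s z x *s w" unfolding p_def wedge_def using wx by simp
  have "y \<in> K w" if y: "y \<in> K x" "s z y = 0" for y
  proof -
    have yw: "s y w = 0" using partners_1[OF x y(1) pS] zx unfolding px by simp
    have "s y (u w) = 0" if u: "u \<in> S" for u
    proof -
      have "p y = 0" unfolding p_def wedge_def using y(2) yw s_skew0 by simp
      then have "s y (p (u x)) = 0" using ts_adj[OF tS pS, of y "u x"] by simp
      then have "s y (u (p x)) = 0" using partners_2'[OF x y(1) u pS] by simp
      then show ?thesis using zx unfolding px by (simp add: lin_simps[OF ts_lin[OF tS u]])
    qed
    then show ?thesis using yw partners_U[OF y(1)] by (simp add: partners_iff[OF wU])
  qed
  then have HK: "K x \<inter> perp {z} \<subseteq> K w" by (auto simp: perp_iff)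
  let ?H = "K x \<inter> perp {z}"
  have sH: "subspace ?H" by (simp add: subspace_partners subspace_inter)
  have dH: "dim (K x) \<le> dim ?H + 1" using dim_cut[OF subspace_partners] .
  have zK: "z \<in> K w" using partners_sym[OF zU wK] .
  have zH: "z \<notin> ?H" using xz partners_perp[OF x] by blast
  have "dim ?H + 2 \<le> dim (K w)"
  proof (cases "w \<in> K x")
    case True
    then have xK: "x \<in> K w" by (rule partners_sym[OF x])
    have "x \<notin> ?H" using zx by (simp add: perp_iff)
    moreover have "z \<notin> span (insert x ?H)"
    proof
      assume "z \<in> span (insert x ?H)"
      moreover have "span (insert x ?H) \<subseteq> K x"
        using partners_self[OF x] by (intro span_minimal subspace_partners) auto
      ultimately show False using xz partners_perp[OF x] by blast
    qed
    ultimately show ?thesis using dim_two_more[OF sH subspace_partners HK xK zK] by blast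
  next
    case False
    have "w \<notin> span (insert z ?H)"
    proof
      assume "w \<in> span (insert z ?H)"
      then obtain c where c: "w - c *s z \<in> ?H" using span_insert_subspace[OF sH] by blast
      then have "s x (w - c *s z) = 0" using partners_perp[OF x] by blast
      then have "c = 0" using xw xz by simp
      then show False using c False by simp
    qed
    then show ?thesis using dim_two_more[OF sH subspace_partners HK zK partners_self[OF wU] zH] by blast
  qed
  then show False using max[OF wU w0] dH by simp
qed

lemma partners_paired:
  assumes z: "paired U S z" and w: "w \<in> K z" "w \<notin> span {z}"
  shows "paired U S w"
proof -
  have zU: "z \<in> U" "z \<noteq> 0" using z unfolding paired_def by auto
  have "w \<noteq> 0" using w(2) span_zero by auto
  moreover have "z \<notin> span {w}"
  proof
    assume "z \<in> span {w}"
    then obtain c where c: "z = c *s w" unfolding span_singleton by blast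
    then have "w = (1 / c) *s z" using zU(2) by auto
    then show False using w(2) unfolding span_singleton by blast
  qed
  ultimately show ?thesis using partners_sym[OF zU(1) w(1)] partners_U[OF w(1)] unfolding paired_def by blast
qed

lemma partners_perp_max:
  assumes z: "paired U S z" and w: "w \<in> K z"
  shows "s x w = 0"
proof (cases "w \<in> span {z}")
  case True
  then show ?thesis using paired_perp_max[OF z] unfolding span_singleton by auto
next
  case False
  then show ?thesis using paired_perp_max[OF partners_paired[OF z w]] by blast
qed

context
  fixes z w u
  assumes z: "paired U S z" and w: "w \<in> K z" and u: "u \<in> S" and uz: "s z (u x) = 1" and uw: "s w (u x) = 0"
begin

private lemma zU: "z \<in> U" using z unfolding paired_def by blast
private abbreviation "pw \<equiv> wedge z w"
private lemma pS: "pw \<in> S" using w unfolding partners_def by blast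
private lemma px: "pw x = 0"
  using paired_perp_max[OF z] partners_perp_max[OF z w] s_skew0 by (simp add: wedge_def)
private lemma wU: "w \<in> U" using partners_U[OF w] .
private lemmas ul = lin_simps[OF ts_lin[OF tS u]]

lemma partners_max_perp_partner: "y \<in> K x \<Longrightarrow> s y w = 0"
proof -
  assume y: "y \<in> K x"
  have "s y (u (pw x)) + s y (pw (u x)) = 0" using partners_2'[OF x y u pS] .
  moreover have "pw (u x) = - w" using uz uw by (simp add: wedge_def)
  ultimately show "s y w = 0" using px by (simp add: ul)
qed

text \<open>Since \<open>pw\<close> kills x and y, the cubic identity for v and \<open>pw\<close>
  reduces to s y (v (pw (v x))) = 0, and polarising with u gives the formula. Its use: the single
  linear condition s y (u z) = 0 makes y orthogonal to all of S w.\<close>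

lemma partners_max_formula:
  assumes y: "y \<in> K x" and zy: "s z y = 0" and v: "v \<in> S"
  shows "s y (v w) = s w (v x) * s y (u z)"
proof -
  have py: "pw y = 0"
    using partners_max_perp_partner[OF y] zy s_skew0 by (simp add: wedge_def)
  have py': "s y (pw a) = 0" for a using ts_adj[OF tS pS, of y a] py by simp
  have Q: "s y (v (pw (v x))) = 0" if v: "v \<in> S" for v
    using partners_3[OF x y v pS] py' px
    by (simp add: lin_simps[OF ts_lin[OF tS v]] lin_simps[OF ts_lin[OF tS pS]])
  note vl = lin_simps[OF ts_lin[OF tS v]] and pl = lin_simps[OF ts_lin[OF tS pS]]
  have 1: "s y (u (pw (v x))) + s y (v (pw (u x))) = 0"
    using Q[OF ts_add[OF tS u v]] Q[OF u] Q[OF v] by (simp add: ul vl pl algebra_simps)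
  have pu: "pw (u x) = - w" using uz uw by (simp add: wedge_def)
  have pv: "pw (v x) = s w (v x) *s z - s z (v x) *s w" by (simp add: wedge_def)
  have "s y (u w) = 0" using Q[OF u] unfolding pu by (simp add: ul)
  then show ?thesis using 1 unfolding pu pv by (simp add: ul vl)
qed

text \<open>If w were in \<open>K x\<close>, then s w (v x) = 0 for all v in S, and the formula puts
  the part of \<open>K x\<close> orthogonal to z into \<open>K w\<close>. Once all of
  \<open>K x\<close> is there, maximality is contradicted, because z lies in \<open>K w\<close> but
  not in \<open>K x\<close>.\<close>

lemma partners_max_notin:
  assumes wz: "w \<notin> span {z}" and zK: "z \<notin> K x"
  shows "w \<notin> K x"
proof
  assume wK: "w \<in> K x"
  have xK: "x \<in> K w" using partners_sym[OF x wK] .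
  have wx: "s w (v x) = 0" if "v \<in> S" for v using partners_1[OF x wK that] .
  have inK: "y \<in> K w" if y: "y \<in> K x" "s z y = 0" for y
    using partners_max_formula[OF y] wx partners_max_perp_partner[OF y(1)] partners_U[OF y(1)]
    by (simp add: partners_iff[OF wU])
  have "K x \<subseteq> K w"
  proof (cases "K x \<subseteq> perp {z}")
    case True
    then show ?thesis using inK by (auto simp: perp_iff)
  next
    case False
    then obtain y1 where y1: "y1 \<in> K x" "s z y1 \<noteq> 0" unfolding perp_def by blast
    define y0 where "y0 = (1 / s z y1) *s y1"
    have y0: "y0 \<in> K x" "s z y0 = 1"
      unfolding y0_def using y1 subspace_scale[OF subspace_partners] by auto
    define q where "q = wedge x y0"
    have qS: "q \<in> S" using y0 unfolding q_def partners_def by blast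
    have qw: "q w = 0" unfolding q_def wedge_def
      using partners_max_perp_partner[OF y0(1)] partners_perp[OF x wK] by simp
    have qz: "q z = - x" unfolding q_def wedge_def
      using y0(2) s_skew[of y0 z] paired_perp_max[OF z] by simp
    have qx: "q x = 0" unfolding q_def wedge_def using partners_perp[OF x y0(1)] s_skew0 by simp
    have zKw: "z \<in> K w" using partners_sym[OF zU w] .
    note ql = lin_simps[OF ts_lin[OF tS qS]]
    \<comment> \<open>Here q kills w and x and maps z to - x. The cubic identity for z as a partner
      of w keeps only s z (v (q (v w))), and q (v w) is the multiple s y0 (v w) of x.\<close>
    have prod: "s y0 (v w) * s z (v x) = 0" if v: "v \<in> S" for v
    proof -
      note vl = lin_simps[OF ts_lin[OF tS v]]
      have "s z (q (v (v w))) = 0"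
        using ts_adj[OF tS qS, of z "v (v w)"] qz partners_2[OF wU xK v] by simp
      moreover have "s z (q (q (v w))) = 0"
        using ts_adj[OF tS qS, of z "q (v w)"] ts_adj[OF tS qS, of x "v w"] qz qx by simp
      ultimately have "s z (v (q (v w))) = 0"
        using partners_3[OF wU zKw v qS] qw by (simp add: vl ql)
      moreover have "q (v w) = s y0 (v w) *s x"
        unfolding q_def wedge_def using partners_1[OF wU xK v] by simp
      ultimately show ?thesis by (simp add: vl)
    qed
    \<comment> \<open>A product of two linear forms vanishes on S; the second is nonzero at u, so
      the first is zero.\<close>
    have "s y0 (v w) = 0" if v: "v \<in> S" for v
    proof (rule ccontr)
      assume n: "s y0 (v w) \<noteq> 0"
      then have 1: "s z (v x) = 0" using prod[OF v] by simp
      have 2: "s y0 (u w) = 0" using prod[OF u] uz by simp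
      show False using prod[OF ts_add[OF tS u v]] 1 2 uz n by simp
    qed
    then have y0w: "y0 \<in> K w"
      using partners_max_perp_partner[OF y0(1)] partners_U[OF y0(1)] by (simp add: partners_iff[OF wU])
    show ?thesis
    proof
      fix y assume y: "y \<in> K x"
      have "y - s z y *s y0 \<in> K w"
        using y y0 by (intro inK subspace_diff subspace_scale subspace_partners) auto
      then have "(y - s z y *s y0) + s z y *s y0 \<in> K w"
        using y0w by (intro subspace_add subspace_scale subspace_partners)
      then show "y \<in> K w" by simp
    qed
  qed
  then have "dim (K x) < dim (K w)"
    using dim_one_more[OF subspace_partners subspace_partners _ partners_sym[OF zU w] zK] by blast
  moreover have "w \<noteq> 0" using wz span_zero by auto
  ultimately show False using max[OF wU] by simp
qed

end

lemma exists_dual: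
  assumes "paired U S z" "z \<notin> K x"
  obtains u where "u \<in> S" "s z (u x) = 1"
proof -
  have "z \<in> U" "s z x = 0" using assms(1) paired_perp_max[OF assms(1)] s_skew0 unfolding paired_def by auto
  then obtain u where u: "u \<in> S" "s z (u x) \<noteq> 0" using assms(2) partners_iff[OF x] by blast
  show ?thesis
    by (rule that[of "fscale scale (1 / s z (u x)) u"]) (use u ts_scale[OF tS] in \<open>auto simp: fscale_apply\<close>)
qed

lemma exists_adjusted_partner:
  assumes z: "paired U S z" "z \<notin> K x" and u: "u \<in> S" "s z (u x) = 1"
  obtains w where "w \<in> K z" "w \<notin> span {z}" "s w (u x) = 0" "w \<notin> K x" "\<forall>y\<in>K x. s y w = 0"
proof -
  obtain w1 where w1: "w1 \<in> K z" "w1 \<notin> span {z}" and zU: "z \<in> U" using z(1) unfolding paired_def by blast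
  define w where "w = w1 - s w1 (u x) *s z"
  have w: "w \<in> K z" unfolding w_def
    using w1 partners_self[OF zU] subspace_partners by (intro subspace_diff subspace_scale)
  have ws: "w \<notin> span {z}"
  proof
    assume "w \<in> span {z}"
    moreover have "s w1 (u x) *s z \<in> span {z}" by (intro span_scale span_base) simp
    ultimately have "w + s w1 (u x) *s z \<in> span {z}" by (rule span_add)
    then show False using w1(2) unfolding w_def by simp
  qed
  have uw: "s w (u x) = 0" unfolding w_def using u(2) by simp
  note c = z(1) w u uw
  have "\<forall>y\<in>K x. s y w = 0" using partners_max_perp_partner[OF c] by blast
  then show ?thesis by (rule that[OF w ws uw partners_max_notin[OF c ws z(2)]])
qed

theorem paired_partner_max:
  assumes z0: "paired U S z0"
  shows "z0 \<in> K x"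
proof (rule ccontr)
  assume n0: "z0 \<notin> K x"
  obtain u0 where u0: "u0 \<in> S" "s z0 (u0 x) = 1" by (rule exists_dual[OF z0 n0])
  \<comment> \<open>The adjustment is made twice: z is orthogonal to all of \<open>K x\<close>,
    unlike z0. Hence \<open>partners_max_formula\<close> for z and w applies on all of
    \<open>K x\<close>, and only the condition from u z cuts it down.\<close>
  obtain z where z': "z \<in> K z0" "z \<notin> span {z0}" and zn: "z \<notin> K x" and Kz: "\<forall>y\<in>K x. s y z = 0"
    using exists_adjusted_partner[OF z0 n0 u0] by blast
  have z: "paired U S z" by (rule partners_paired[OF z0 z'])
  then have zU: "z \<in> U" unfolding paired_def by blast
  obtain u where u: "u \<in> S" "s z (u x) = 1" by (rule exists_dual[OF z zn])
  obtain w where w: "w \<in> K z" "w \<notin> span {z}" and uw: "s w (u x) = 0" and wn: "w \<notin> K x"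
    and Kw: "\<forall>y\<in>K x. s y w = 0"
    using exists_adjusted_partner[OF z zn u] by blast
  have wU: "w \<in> U" using partners_U[OF w(1)] .
  let ?H = "K x \<inter> perp {u z}"
  have sH: "subspace ?H" by (simp add: subspace_partners subspace_inter)
  have dH: "dim (K x) \<le> dim ?H + 1" using dim_cut[OF subspace_partners] .
  have HK: "?H \<subseteq> K w"
  proof
    fix y assume y: "y \<in> ?H"
    then have yK: "y \<in> K x" and "s (u z) y = 0" by (auto simp: perp_iff)
    then have "s y (u z) = 0" using s_skew0 by blast
    moreover have "s z y = 0" using Kz yK s_skew0 by blast
    ultimately have "s y (v w) = 0" if "v \<in> S" for v
      using partners_max_formula[OF z w(1) u uw yK _ that] by simp
    then show "y \<in> K w" using Kw yK partners_U[OF yK] by (simp add: partners_iff[OF wU])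
  qed
  have zw: "z \<in> K w" using partners_sym[OF zU w(1)] .
  have "w \<notin> span (insert z ?H)"
  proof
    assume "w \<in> span (insert z ?H)"
    then obtain c where c: "w - c *s z \<in> ?H" using span_insert_subspace[OF sH] by blast
    then have "s (w - c *s z) (u x) = 0" using partners_1[OF x _ u(1)] by blast
    then have "c = 0" using uw u(2) by simp
    then show False using c wn by simp
  qed
  then have "dim ?H + 2 \<le> dim (K w)"
    using dim_two_more[OF sH subspace_partners HK zw partners_self[OF wU]] zn by blast
  moreover have "w \<noteq> 0" using w(2) span_zero by auto
  ultimately show False using max[OF wU] dH by simp
qed

end

end

section \<open>Alternating forms on subspaces invariant under an optimal space\<close>

definition alternating_on :: "'v set \<Rightarrow> ('v \<Rightarrow> 'v \<Rightarrow> 'f) \<Rightarrow> bool"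
  where "alternating_on Y B \<longleftrightarrow>
    (\<forall>a\<in>Y. \<forall>b\<in>Y. \<forall>c\<in>Y. B (a + b) c = B a c + B b c \<and> B a (b + c) = B a b + B a c) \<and>
    (\<forall>r. \<forall>a\<in>Y. \<forall>b\<in>Y. B (r *s a) b = r * B a b \<and> B a (r *s b) = r * B a b) \<and>
    (\<forall>a\<in>Y. B a a = 0)"

lemma
  assumes "alternating_on Y B"
  shows alt_on_add_left: "a \<in> Y \<Longrightarrow> b \<in> Y \<Longrightarrow> c \<in> Y \<Longrightarrow> B (a + b) c = B a c + B b c"
    and alt_on_add_right: "a \<in> Y \<Longrightarrow> b \<in> Y \<Longrightarrow> c \<in> Y \<Longrightarrow> B a (b + c) = B a b + B a c"
    and alt_on_scale_left: "a \<in> Y \<Longrightarrow> b \<in> Y \<Longrightarrow> B (r *s a) b = r * B a b"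
    and alt_on_scale_right: "a \<in> Y \<Longrightarrow> b \<in> Y \<Longrightarrow> B a (r *s b) = r * B a b"
    and alt_on_self: "a \<in> Y \<Longrightarrow> B a a = 0"
  using assms unfolding alternating_on_def by blast+

lemma alt_on_skew:
  assumes "alternating_on Y B" "subspace Y" "a \<in> Y" "b \<in> Y"
  shows "B b a = - B a b"
proof -
  note B = assms(1)
  have ab: "a + b \<in> Y" using assms by (simp add: subspace_add)
  have "B (a + b) (a + b) = B a a + B a b + (B b a + B b b)"
    using alt_on_add_left[OF B assms(3,4) ab] alt_on_add_right[OF B assms(3,3,4)]
      alt_on_add_right[OF B assms(4,3,4)] by simp
  then show ?thesis using alt_on_self[OF B] assms(3,4) ab by (simp add: add_eq_0_iff)
qed

lemma alt_on_mono: "alternating_on Y B \<Longrightarrow> X \<subseteq> Y \<Longrightarrow> alternating_on X B"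
  unfolding alternating_on_def by blast

text \<open>Passing from \<open>Y\<close> to \<open>Y \<inter> {x, x'}\<^sup>\<bottom>\<close>, a copy of \<open>Y / \<F> x\<close>, for \<open>x\<close> in the radical of a form
  \<open>B\<close> on \<open>Y \<subseteq> x\<^sup>\<bottom>\<close>.\<close>

context
  fixes U k S x x' Y B
  assumes S: "optimal_space U k S" and x: "x \<in> U" "x' \<in> U" "s x x' = 1"
    and Y: "subspace Y" "Y \<subseteq> U" "x \<in> Y" "Y \<subseteq> perp {x}"
    and B: "alternating_on Y B"
    and inv: "\<forall>u\<in>S. \<forall>z\<in>Y. u x = 0 \<longrightarrow> u z \<in> Y \<and> B (u z) z = 0"
    and rad: "\<forall>z\<in>Y. B x z = 0"
begin

private lemma xY: "a \<in> Y \<Longrightarrow> s x a = 0" using Y by (auto simp: perp_iff)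

lemma hproj_Y: "a \<in> Y \<Longrightarrow> hproj x x' a = a + s x' a *s x"
  unfolding hproj_def using xY by simp

lemma hproj_Y_mem: "a \<in> Y \<Longrightarrow> hproj x x' a \<in> Y \<inter> perp {x'}"
  using x(3) s_skew[of x' x] Y by (auto simp: perp_iff hproj_Y intro!: subspace_add subspace_scale)

lemma hproj_Y_s: "a \<in> Y \<Longrightarrow> b \<in> Y \<Longrightarrow> s (hproj x x' a) b = s a b" "a \<in> Y \<Longrightarrow> b \<in> Y \<Longrightarrow> s a (hproj x x' b) = s a b"
  using xY s_skew0 by (simp_all add: hproj_Y)

lemma hproj_Y_B: "a \<in> Y \<Longrightarrow> b \<in> Y \<Longrightarrow> B (hproj x x' a) b = B a b" "a \<in> Y \<Longrightarrow> b \<in> Y \<Longrightarrow> B a (hproj x x' b) = B a b"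
proof -
  have "B x b = 0 \<and> B b x = 0" if "b \<in> Y" for b
    using rad that alt_on_skew[OF B Y(1) Y(3) that] by simp
  then show "a \<in> Y \<Longrightarrow> b \<in> Y \<Longrightarrow> B (hproj x x' a) b = B a b" "a \<in> Y \<Longrightarrow> b \<in> Y \<Longrightarrow> B a (hproj x x' b) = B a b"
    using Y(1,3) by (simp_all add: hproj_Y alt_on_add_left[OF B] alt_on_add_right[OF B]
      alt_on_scale_left[OF B] alt_on_scale_right[OF B] subspace_scale)
qed

lemma subspace_Y': "subspace (Y \<inter> perp {x'})" "Y \<inter> perp {x'} \<subseteq> U \<inter> perp {x,x'}"
  using Y by (auto simp: subspace_inter perp_iff)

lemma reduced_Y:
  assumes h: "h \<in> reduced x x' S" and z: "z \<in> Y \<inter> perp {x'}"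
  shows "h z \<in> Y \<inter> perp {x'}" "B (h z) z = 0"
proof -
  obtain u where u: "u \<in> S" "u x = 0" "h = hproj x x' \<circ> u \<circ> hproj x x'" using h unfolding reduced_def by blast
  have "hproj x x' z = z" using z xY by (intro hproj_id) (auto simp: perp_iff)
  then have hz: "h z = hproj x x' (u z)" using u(3) by simp
  have uz: "u z \<in> Y" "B (u z) z = 0" using inv u z by blast+
  show "h z \<in> Y \<inter> perp {x'}" unfolding hz by (rule hproj_Y_mem[OF uz(1)])
  show "B (h z) z = 0" unfolding hz using hproj_Y_B(1)[OF uz(1), of z] uz(2) z by simp
qed

lemma alternating_on_Y': "alternating_on (Y \<inter> perp {x'}) B"
  by (rule alt_on_mono[OF B]) blast

end

lemma exists_max_partners:
  assumes "optimal_space U k S" "z \<in> U" "z \<noteq> 0"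
  obtains x where "x \<in> U" "x \<noteq> 0"
    "\<And>w. w \<in> U \<Longrightarrow> w \<noteq> 0 \<Longrightarrow> dim (partners U S w) \<le> dim (partners U S x)"
proof -
  have "\<forall>w. w \<in> U \<and> w \<noteq> 0 \<longrightarrow> dim (partners U S w) < Suc (dim (UNIV :: 'v set))"
    by (simp add: dim_subset less_Suc_eq_le del: dim_UNIV)
  then obtain x where "x \<in> U \<and> x \<noteq> 0" "\<forall>w. w \<in> U \<and> w \<noteq> 0 \<longrightarrow> dim (partners U S w) \<le> dim (partners U S x)"
    using ex_has_greatest_nat[of "\<lambda>w. w \<in> U \<and> w \<noteq> 0" z "\<lambda>w. dim (partners U S w)"] assms(2,3) by blast
  then show ?thesis using that by blast
qed

lemma partners_subset_max:
  assumes S: "optimal_space U k S" and x: "x \<in> U" "x \<noteq> 0"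
    "\<And>w. w \<in> U \<Longrightarrow> w \<noteq> 0 \<Longrightarrow> dim (partners U S w) \<le> dim (partners U S x)"
    and z: "paired U S z"
  shows "partners U S z \<subseteq> partners U S x"
proof
  fix y assume y: "y \<in> partners U S z"
  have zx: "z \<in> partners U S x" by (rule paired_partner_max[OF S x z])
  show "y \<in> partners U S x"
  proof (cases "y \<in> span {z}")
    case True
    then show ?thesis using zx subspace_partners[OF S] unfolding span_singleton by (auto intro: subspace_scale)
  next
    case False
    then show ?thesis using paired_partner_max[OF S x partners_paired[OF S x z y False]] by blast
  qed
qed

text \<open>If B is nonzero, Y has dimension at least 2; as Y is isotropic and invariant, all its
  nonzero vectors z are paired. A vector x with the most partners is then orthogonal to the partners
  of z, hence of the form u z + c z. So x lies in Y and in the radical of B, and induction applies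
  modulo x.\<close>

lemma isotropic_alternating_zero:
  assumes "optimal_space U k S" "subspace Y" "Y \<subseteq> U" "Y \<subseteq> perp Y"
    and "\<And>u z. u \<in> S \<Longrightarrow> z \<in> Y \<Longrightarrow> u z \<in> Y"
    and "alternating_on Y B" "\<And>u z. u \<in> S \<Longrightarrow> z \<in> Y \<Longrightarrow> B (u z) z = 0"
    and "a \<in> Y" "b \<in> Y"
  shows "B a b = 0"
  using assms
proof (induction k arbitrary: U S Y a b)
  case 0
  then have "U = {0}" using ts_subspace[OF optimal_trivial[OF 0(1)]] subspace_0
    unfolding optimal_space_def by auto
  then have "a = b" using 0 by blast
  then show ?case using alt_on_self[OF 0(6)] 0(9) by blast
next
  case (Suc k)
  note S = Suc.prems(1) and Y = Suc.prems(2,3,4) and inv = Suc.prems(5)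
    and B = Suc.prems(6,7) and ab = Suc.prems(8,9)
  have YU: "z \<in> U" if "z \<in> Y" for z using that Y(2) by blast
  have YY: "s a b = 0" if "a \<in> Y" "b \<in> Y" for a b using that Y(3) unfolding perp_def by blast
  show ?case
  proof (rule ccontr)
    assume nz: "B a b \<noteq> 0"
    have paired: "paired U S z" if z: "z \<in> Y" "z \<noteq> 0" for z
    proof -
      have "\<not> (a \<in> span {z} \<and> b \<in> span {z})"
        using nz z(1) alt_on_self[OF B(1) z(1)]
        by (auto simp: span_singleton alt_on_scale_left[OF B(1)] alt_on_scale_right[OF B(1)] subspace_scale[OF Y(1)])
      then obtain y where y: "y \<in> Y" "y \<notin> span {z}" using ab by blast
      have "y \<in> partners U S z" unfolding partners_iff[OF S YU[OF z(1)]]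
        using YU[OF y(1)] YY[OF y(1)] inv z(1) by blast
      then show ?thesis unfolding paired_def using z YU y by blast
    qed
    have "a \<noteq> 0" using nz alt_on_scale_left[OF B(1) ab(1,2), of 0] by auto
    obtain x where x: "x \<in> U" "x \<noteq> 0"
      "\<And>w. w \<in> U \<Longrightarrow> w \<noteq> 0 \<Longrightarrow> dim (partners U S w) \<le> dim (partners U S x)"
      using exists_max_partners[OF S YU[OF ab(1)] \<open>a \<noteq> 0\<close>] by blast
    have xz: "\<exists>u\<in>S. \<exists>c. x = u z + c *s z" if z: "z \<in> Y" "z \<noteq> 0" for z
    proof -
      have "s y x = 0" if "y \<in> partners U S z" for y
        using partners_subset_max[OF S x paired[OF z]] that partners_iff[OF S x(1)] by blast
      then show ?thesis using perp_partners[OF S YU[OF z(1)] x(1)] by blast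
    qed
    have xY: "x \<in> Y" using xz[OF ab(1) \<open>a \<noteq> 0\<close>] inv ab(1) Y(1) by (auto intro: subspace_add subspace_scale)
    have rad: "B x z = 0" if z: "z \<in> Y" for z
    proof (cases "z = 0")
      case True
      then show ?thesis using alt_on_scale_right[OF B(1) xY z, of 0] by simp
    next
      case False
      then obtain u c where u: "u \<in> S" "x = u z + c *s z" using xz[OF z] by blast
      then show ?thesis
        using alt_on_add_left[OF B(1) inv[OF u(1) z] subspace_scale[OF Y(1) z] z, of c]
          alt_on_scale_left[OF B(1) z z, of c] alt_on_self[OF B(1) z] B(2)[OF u(1) z] by simp
    qed
    obtain x' where x': "x' \<in> U" "s x x' = 1"
      using regularD[OF ts_regular[OF optimal_trivial[OF S]] x(1,2)] by blast
    have Yx: "Y \<subseteq> perp {x}" using YY[OF xY] by (auto simp: perp_iff)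
    have inv': "\<forall>u\<in>S. \<forall>z\<in>Y. u x = 0 \<longrightarrow> u z \<in> Y \<and> B (u z) z = 0" using inv B(2) by blast
    have rad': "\<forall>z\<in>Y. B x z = 0" using rad by blast
    note c = S x(1) x' Y(1,2) xY Yx B(1) inv' rad'
    let ?Y = "Y \<inter> perp {x'}"
    have "B (hproj x x' a) (hproj x x' b) = 0"
    proof (rule Suc.IH)
      show "optimal_space (U \<inter> perp {x,x'}) k (reduced x x' S)" using optimal_reduced[OF S x(1) x'] by simp
      show "?Y \<subseteq> perp ?Y" using YY by (auto simp: perp_iff)
      show "subspace ?Y" "?Y \<subseteq> U \<inter> perp {x,x'}" using subspace_Y'[OF c] by blast+
      show "alternating_on ?Y B" by (rule alternating_on_Y'[OF c])
      show "hproj x x' a \<in> ?Y" "hproj x x' b \<in> ?Y" using hproj_Y_mem[OF c] ab by blast+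
      show "h z \<in> ?Y" "B (h z) z = 0" if "h \<in> reduced x x' S" "z \<in> ?Y" for h z
        using reduced_Y[OF c] that by blast+
    qed
    moreover have "hproj x x' b \<in> Y" using hproj_Y_mem[OF c] ab by blast
    ultimately show False
      using nz hproj_Y_B[OF c] ab by simp
  qed
qed

text \<open>A nonzero q in U orthogonal to Y lies in the radical of B and can be divided out, until
  Y = U. Then some z with B z = 0 on z^perp is wanted: a paired z will do, thanks to
  \<open>wedge z w\<close>; if nothing is paired, z0^perp = S z0 + F z0 and z0 itself will
  do.\<close>

lemma coisotropic_alternating_proportional:
  assumes "optimal_space U k S" "subspace Y" "Y \<subseteq> U" "U \<inter> perp Y \<subseteq> Y" "z0 \<in> Y" "z0 \<notin> perp Y"
    and "\<And>u z. u \<in> S \<Longrightarrow> z \<in> Y \<Longrightarrow> u z \<in> Y"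
    and "alternating_on Y B" "\<And>u z. u \<in> S \<Longrightarrow> z \<in> Y \<Longrightarrow> B (u z) z = 0"
  shows "\<exists>z\<in>Y. z \<notin> perp Y \<and> (\<exists>c. \<forall>a\<in>Y. B z a = c * s z a)"
  using assms
proof (induction k arbitrary: U S Y z0)
  case 0
  then have "U = {0}" using ts_subspace[OF optimal_trivial[OF 0(1)]] subspace_0
    unfolding optimal_space_def by auto
  then have "z0 = 0" using 0 by blast
  then show ?case using 0(6) subspace_0[OF subspace_perp] by blast
next
  case (Suc k)
  note S = Suc.prems(1) and Y = Suc.prems(2,3,4) and z0 = Suc.prems(5,6) and inv = Suc.prems(7)
    and B = Suc.prems(8,9)
  have tS: "trivial_space U S" by (rule optimal_trivial[OF S])
  have rU: "regular U" and sU: "subspace U" using ts_regular[OF tS] ts_subspace[OF tS] by auto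
  show ?case
  proof (cases "Y = U")
    case True
    have "\<exists>z\<in>U. z \<noteq> 0 \<and> (\<forall>a\<in>U. s z a = 0 \<longrightarrow> B z a = 0)"
    proof (cases "\<exists>z. paired U S z")
      case True
      then obtain z w where z: "z \<in> U" "z \<noteq> 0" and w: "w \<in> partners U S z" "w \<notin> span {z}"
        unfolding paired_def by blast
      have wU: "w \<in> U" and wS: "wedge z w \<in> S" using w(1) unfolding partners_def by auto
      have *: "s w a * B z a = 0" if a: "a \<in> U" "s z a = 0" for a
      proof -
        have "wedge z w a = s w a *s z" using a(2) by (simp add: wedge_def)
        then show ?thesis using B(2)[OF wS, of a] alt_on_scale_left[OF B(1), of z a "s w a"] a z \<open>Y = U\<close> by simp
      qed
      \<comment> \<open>A product of two linear forms vanishes on z^perp. Since w is not a multiple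
        of z, the form s w is not zero there, so B z must be.\<close>
      have "\<exists>t\<in>U. s z t = 0 \<and> s w t \<noteq> 0"
      proof (rule ccontr)
        assume n: "\<not> ?thesis"
        have "w \<in> U \<inter> perp (U \<inter> perp (span {z}))"
          using wU n s_skew0 by (auto simp: perp_iff)
        moreover have "span {z} \<subseteq> U" using z(1) sU by (simp add: span_minimal)
        ultimately have "w \<in> span {z}" using perp_perp_eq[OF rU subspace_span] by blast
        then show False using w(2) by blast
      qed
      then obtain t where t: "t \<in> U" "s z t = 0" "s w t \<noteq> 0" by blast
      have Bt: "B z t = 0" using *[OF t(1,2)] t(3) by simp
      have "B z a = 0" if a: "a \<in> U" "s z a = 0" for a
      proof (cases "s w a = 0")
        case True
        have at: "a + t \<in> U" using a t sU by (simp add: subspace_add)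
        have "B z (a + t) = 0" using *[OF at] a t True by simp
        then show ?thesis using alt_on_add_right[OF B(1), of z a t] Bt z a t \<open>Y = U\<close> by simp
      next
        case False
        then show ?thesis using *[OF a] by simp
      qed
      then show ?thesis using z by blast
    next
      case False
      have z0U: "z0 \<in> U" "z0 \<noteq> 0" using z0 \<open>Y = U\<close> subspace_0[OF subspace_perp] by auto
      have "B z0 a = 0" if a: "a \<in> U" "s z0 a = 0" for a
      proof -
        have "s y a = 0" if y: "y \<in> partners U S z0" for y
        proof -
          have "y \<in> span {z0}" using False y z0U unfolding paired_def by blast
          then show ?thesis using a(2) unfolding span_singleton by auto
        qed
        then obtain u c where u: "u \<in> S" "a = u z0 + c *s z0" by (rule perp_partners[OF S z0U(1) a(1)])
        have "B a z0 = 0"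
          using alt_on_add_left[OF B(1) inv[OF u(1) z0(1)] subspace_scale[OF Y(1) z0(1)] z0(1), of c]
            alt_on_scale_left[OF B(1) z0(1,1), of c] alt_on_self[OF B(1) z0(1)] B(2)[OF u(1) z0(1)] u(2) by simp
        then show ?thesis using alt_on_skew[OF B(1) Y(1), of a z0] a(1) z0(1) \<open>Y = U\<close> by simp
      qed
      then show ?thesis using z0U by blast
    qed
    then obtain z where z: "z \<in> U" "z \<noteq> 0" "\<And>a. a \<in> U \<Longrightarrow> s z a = 0 \<Longrightarrow> B z a = 0" by blast
    obtain t where t: "t \<in> U" "s z t = 1" using regularD[OF rU z(1,2)] by blast
    have "B z a = B z t * s z a" if a: "a \<in> U" for a
    proof -
      have aU: "a - s z a *s t \<in> U" using a t sU by (simp add: subspace_diff subspace_scale)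
      have "B z (a - s z a *s t) = 0" using z(3)[OF aU] t by simp
      then have "B z ((a - s z a *s t) + s z a *s t) = s z a * B z t"
        using alt_on_add_right[OF B(1), of z "a - s z a *s t" "s z a *s t"] aU z(1) t(1) \<open>Y = U\<close>
          alt_on_scale_right[OF B(1), of z t "s z a"] sU by (simp add: subspace_scale del: diff_add_cancel)
      then show ?thesis by (simp add: mult.commute)
    qed
    moreover have "z \<notin> perp U" using z(1,2) rU unfolding regular_def by blast
    ultimately show ?thesis using z(1) \<open>Y = U\<close> by blast
  next
    case False
    have "U \<inter> perp Y \<noteq> {0}"
    proof
      assume "U \<inter> perp Y = {0}"
      then have "dim Y = dim U" using dim_perp[OF rU Y(1,2)] by simp
      then show False using subspace_dim_equal[OF Y(1) sU Y(2)] False by simp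
    qed
    then obtain q where q: "q \<in> U" "q \<in> perp Y" "q \<noteq> 0" using sU subspace_0 subspace_perp by blast
    have qY: "q \<in> Y" using q Y(3) by blast
    have qs: "s q a = 0" if "a \<in> Y" for a using q(2) that s_skew0 by (auto simp: perp_iff)
    obtain z1 where z1: "z1 \<in> Y" "s z1 z0 \<noteq> 0" using z0(2) unfolding perp_def by blast
    \<comment> \<open>The vector q is a partner of every z in Y, and \<open>wedge z q\<close> sends
      a in Y to the multiple - s z a of q, so s z a times B q a is 0.\<close>
    have *: "B q a = 0" if "a \<in> Y" "z \<in> Y" "s z a \<noteq> 0" for a z
    proof -
      have zU: "z \<in> U" using that Y(2) by blast
      have "q \<in> partners U S z" unfolding partners_iff[OF S zU] using q(1) qs that inv by blast
      then have w: "wedge z q \<in> S" unfolding partners_def by blast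
      have "wedge z q a = (- s z a) *s q" using qs[OF that(1)] by (simp add: wedge_def)
      then have "s z a * B q a = 0"
        using B(2)[OF w that(1)] alt_on_scale_left[OF B(1) qY that(1), of "- s z a"] by simp
      then show ?thesis using that(3) by simp
    qed
    have rad: "B q a = 0" if a: "a \<in> Y" for a
    proof (cases "s z1 a = 0")
      case True
      have "a + z0 \<in> Y" using a z0(1) Y(1) by (simp add: subspace_add)
      then have "B q (a + z0) = 0" by (rule *[OF _ z1(1)]) (use True z1 in simp)
      moreover have "B q z0 = 0" by (rule *[OF z0(1) z1])
      ultimately show ?thesis using alt_on_add_right[OF B(1) qY a z0(1)] by simp
    next
      case False
      then show ?thesis using *[OF a z1(1)] by blast
    qed
    obtain q' where q': "q' \<in> U" "s q q' = 1" using regularD[OF rU q(1,3)] by blast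
    have Yq: "Y \<subseteq> perp {q}" using qs by (auto simp: perp_iff)
    have inv': "\<forall>u\<in>S. \<forall>z\<in>Y. u q = 0 \<longrightarrow> u z \<in> Y \<and> B (u z) z = 0" using inv B(2) by blast
    have rad': "\<forall>z\<in>Y. B q z = 0" using rad by blast
    note c = S q(1) q' Y(1,2) qY Yq B(1) inv' rad'
    let ?Y = "Y \<inter> perp {q'}"
    let ?p = "hproj q q'"
    have p: "?p a \<in> ?Y" "s (?p a) b = s a b" "s b (?p a) = s b a" "B b (?p a) = B b a" if "a \<in> Y" "b \<in> Y" for a b
      using hproj_Y_mem[OF c] hproj_Y_s[OF c] hproj_Y_B[OF c] that by blast+
    have "\<exists>z\<in>?Y. z \<notin> perp ?Y \<and> (\<exists>c. \<forall>a\<in>?Y. B z a = c * s z a)"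
    proof (rule Suc.IH)
      show "optimal_space (U \<inter> perp {q,q'}) k (reduced q q' S)" using optimal_reduced[OF S q(1) q'] by simp
      show "subspace ?Y" "?Y \<subseteq> U \<inter> perp {q,q'}" using subspace_Y'[OF c] by blast+
      show "alternating_on ?Y B" by (rule alternating_on_Y'[OF c])
      show "h z \<in> ?Y" "B (h z) z = 0" if "h \<in> reduced q q' S" "z \<in> ?Y" for h z
        using reduced_Y[OF c] that by blast+
      show "U \<inter> perp {q,q'} \<inter> perp ?Y \<subseteq> ?Y"
      proof
        fix w assume w: "w \<in> U \<inter> perp {q,q'} \<inter> perp ?Y"
        have "s a w = 0" if a: "a \<in> Y" for a
        proof -
          have "s (?p a) w = 0" using w p(1)[OF a a] by (auto simp: perp_iff)
          moreover have "s q w = 0" using w by (simp add: perp_iff)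
          ultimately show ?thesis unfolding hproj_Y[OF c a] by simp
        qed
        then have "w \<in> Y" using w Y(3) by (auto simp: perp_iff)
        then show "w \<in> ?Y" using w by (auto simp: perp_iff)
      qed
      show "?p z0 \<in> ?Y" using p(1) z0(1) by blast
      show "?p z0 \<notin> perp ?Y"
      proof
        assume "?p z0 \<in> perp ?Y"
        then have "s (?p z1) (?p z0) = 0" using p(1)[OF z1(1) z1(1)] by (auto simp: perp_iff)
        moreover have "?p z0 \<in> Y" using p(1)[OF z0(1) z0(1)] by blast
        ultimately show False using p(2)[OF z1(1), of "?p z0"] p(3)[OF z0(1) z1(1)] z1(2) by simp
      qed
    qed
    then obtain z d where z: "z \<in> ?Y" "z \<notin> perp ?Y" "\<And>a. a \<in> ?Y \<Longrightarrow> B z a = d * s z a" by blast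
    have "B z a = d * s z a" if a: "a \<in> Y" for a
      using z(3)[OF p(1)[OF a a]] p(3)[OF a] p(4)[OF a] z(1) by simp
    moreover have "z \<notin> perp Y" using z(2) by (auto simp: perp_iff)
    ultimately show ?thesis using z(1) by blast
  qed
qed

text \<open>The invariant subspace is the orthogonal complement \<open>Q = S x + \<F> x\<close> of the set of partners of
  a vector \<open>x\<close> with as many partners as possible. For every partner \<open>y\<close> of \<open>x\<close>, the formula
  \<open>B y z (v x) = s y (v z)\<close> defines an alternating form on \<open>Q\<close>, and \<open>Q\<close> is invariant when
  all of these forms vanish.\<close>

theorem optimal_reducible:
  assumes S: "optimal_space U k S" and z0: "paired U S z0"
  obtains Q where "subspace Q" "Q \<subseteq> U" "Q \<noteq> {0}" "Q \<noteq> U" "\<And>u z. u \<in> S \<Longrightarrow> z \<in> Q \<Longrightarrow> u z \<in> Q"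
proof -
  have tS: "trivial_space U S" by (rule optimal_trivial[OF S])
  have rU: "regular U" and sU: "subspace U" using ts_regular[OF tS] ts_subspace[OF tS] by auto
  have z0U: "z0 \<in> U" "z0 \<noteq> 0" using z0 unfolding paired_def by auto
  obtain x where x: "x \<in> U" "x \<noteq> 0"
      "\<And>w. w \<in> U \<Longrightarrow> w \<noteq> 0 \<Longrightarrow> dim (partners U S w) \<le> dim (partners U S x)"
    using exists_max_partners[OF S z0U] by blast
  define W where "W = partners U S x"
  define Q where "Q = U \<inter> perp W"
  have pW: "z \<in> W" if "paired U S z" for z
    unfolding W_def by (rule paired_partner_max[OF S x that])
  have sW: "subspace W" unfolding W_def by (rule subspace_partners[OF S])
  have WU: "W \<subseteq> U" unfolding W_def using partners_U[OF S] by blast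
  have W_iff: "y \<in> W \<longleftrightarrow> y \<in> U \<and> s y x = 0 \<and> (\<forall>u\<in>S. s y (u x) = 0)" for y
    unfolding W_def by (rule partners_iff[OF S x(1)])
  have Ws: "s y x = 0" "s x y = 0" "u \<in> S \<Longrightarrow> s y (u x) = 0" if "y \<in> W" for y u
    using that W_iff s_skew0 by blast+
  have xW: "x \<in> W" unfolding W_def by (rule partners_self[OF S x(1)])
  have sQ: "subspace Q" unfolding Q_def using sU by (simp add: subspace_inter)
  have QU: "Q \<subseteq> U" unfolding Q_def by blast
  have WQ: "s y z = 0" "s z y = 0" if "y \<in> W" "z \<in> Q" for y z
    using that s_skew0 unfolding Q_def perp_def by blast+
  have Qmem: "z \<in> Q" if "z \<in> U" "\<And>y. y \<in> W \<Longrightarrow> s y z = 0" for z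
    using that unfolding Q_def by (auto simp: perp_iff)
  have xQ: "x \<in> Q" using x(1) Ws by (auto intro: Qmem)
  have vxQ: "v x \<in> Q" if "v \<in> S" for v using ts_range[OF tS that] Ws(3)[OF _ that] by (auto intro: Qmem)
  have vvxQ: "v (v x) \<in> Q" if "v \<in> S" for v
    using ts_range[OF tS that] partners_2[OF S x(1) _ that] unfolding W_def[symmetric] by (auto intro: Qmem)
  have Qrep: "\<exists>v\<in>S. \<exists>c. z = v x + c *s x" if "z \<in> Q" for z
  proof (rule perp_partners[OF S x(1)])
    show "z \<in> U" using that QU by blast
    show "s y z = 0" if "y \<in> partners U S x" for y using WQ(1) that \<open>z \<in> Q\<close> unfolding W_def by blast
  qed blast
  have hQ: "h z \<in> Q" if h: "h \<in> S" "h x = 0" and z: "z \<in> Q" for h z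
  proof -
    obtain v c where v: "v \<in> S" "z = v x + c *s x" using Qrep[OF z] by blast
    have hz: "h z = h (v x)" using v(2) h(2) by (simp add: lin_simps[OF ts_lin[OF tS h(1)]])
    have "s y (h z) = 0" if y: "y \<in> W" for y
      using partners_2'[OF S x(1) _ h(1) v(1), of y] y h(2) unfolding W_def hz
      by (simp add: lin_simps[OF ts_lin[OF tS v(1)]])
    then show ?thesis using ts_range[OF tS h(1)] by (auto intro: Qmem)
  qed
  define B where "B y a b = s y ((SOME v. v \<in> S \<and> (\<exists>c. v x = b + c *s x)) a)" for y a b
  \<comment> \<open>Two choices of v differ by an element of S with eigenvector x. The eigenvalue
    must be 0, so the difference annihilates x, preserves Q and takes values orthogonal to y
    there.\<close>
  have B_eq: "B y a b = s y (v a)" if y: "y \<in> W" and a: "a \<in> Q" and v: "v \<in> S" "v x = b + c *s x" for y a b v c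
  proof -
    let ?P = "\<lambda>v. v \<in> S \<and> (\<exists>c. v x = b + c *s x)"
    define v0 where "v0 = (SOME v. ?P v)"
    have "?P v0" unfolding v0_def by (rule someI[of ?P v]) (use v in blast)
    then obtain c0 where v0: "v0 \<in> S" "v0 x = b + c0 *s x" by blast
    have d: "v0 - v \<in> S" by (rule ts_diff[OF tS v0(1) v(1)])
    have dx: "(v0 - v) x = (c0 - c) *s x" using v0(2) v(2) by (simp add: scale_left_diff_distrib)
    have "c0 - c = 0" using ts_eigen[OF tS d dx] x(2) by blast
    then have "(v0 - v) a \<in> Q" using hQ[OF d _ a] dx by simp
    then have "s y ((v0 - v) a) = 0" using WQ(1)[OF y] by blast
    then show ?thesis unfolding B_def v0_def[symmetric] by simp
  qed
  have Brep: "\<exists>v\<in>S. \<exists>c. v x = z + c *s x" if z: "z \<in> Q" for z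
  proof -
    obtain v c where v: "v \<in> S" "z = v x + c *s x" using Qrep[OF z] by blast
    then have "v x = z + (- c) *s x" by simp
    then show ?thesis using v(1) by blast
  qed
  have altB: "alternating_on Q (B y)" if y: "y \<in> W" for y
    unfolding alternating_on_def
  proof (intro conjI ballI allI)
    fix a b c assume abc: "a \<in> Q" "b \<in> Q" "c \<in> Q"
    obtain v d where v: "v \<in> S" "v x = c + d *s x" using Brep[OF abc(3)] by blast
    obtain w e where w: "w \<in> S" "w x = b + e *s x" using Brep[OF abc(2)] by blast
    have "a + b \<in> Q" using abc sQ by (simp add: subspace_add)
    then show "B y (a + b) c = B y a c + B y b c"
      using B_eq[OF y _ v] abc by (simp add: lin_simps[OF ts_lin[OF tS v(1)]])
    have "(w + v) x = (b + c) + (e + d) *s x" using v w by (simp add: scale_left_distrib)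
    from B_eq[OF y abc(1) ts_add[OF tS w(1) v(1)] this]
    show "B y a (b + c) = B y a b + B y a c" using B_eq[OF y abc(1) v] B_eq[OF y abc(1) w] by simp
  next
    fix r a b assume ab: "a \<in> Q" "b \<in> Q"
    obtain v d where v: "v \<in> S" "v x = b + d *s x" using Brep[OF ab(2)] by blast
    have "r *s a \<in> Q" using ab sQ by (simp add: subspace_scale)
    then show "B y (r *s a) b = r * B y a b"
      using B_eq[OF y _ v] ab by (simp add: lin_simps[OF ts_lin[OF tS v(1)]])
    have "fscale scale r v x = r *s b + (r * d) *s x" using v by (simp add: fscale_apply scale_right_distrib)
    from B_eq[OF y ab(1) ts_scale[OF tS v(1)] this]
    show "B y a (r *s b) = r * B y a b" using B_eq[OF y ab(1) v] by (simp add: fscale_apply)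
  next
    fix a assume a: "a \<in> Q"
    obtain v d where v: "v \<in> S" "v x = a + d *s x" using Brep[OF a] by blast
    have "a = v x - d *s x" using v(2) by simp
    then have "v a = v (v x) - d *s v x" by (simp add: lin_simps[OF ts_lin[OF tS v(1)]])
    then show "B y a a = 0"
      using B_eq[OF y a v] WQ(1)[OF y vvxQ[OF v(1)]] WQ(1)[OF y vxQ[OF v(1)]] by simp
  qed
  have radB: "\<forall>z\<in>Q. B y x z = 0" if y: "y \<in> W" for y
  proof
    fix z assume "z \<in> Q"
    then obtain v d where v: "v \<in> S" "v x = z + d *s x" using Brep by blast
    show "B y x z = 0" using B_eq[OF y xQ v] Ws(3)[OF y v(1)] by simp
  qed
  have invB: "\<forall>h\<in>S. \<forall>z\<in>Q. h x = 0 \<longrightarrow> h z \<in> Q \<and> B y (h z) z = 0" if y: "y \<in> W" for y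
  proof (intro ballI impI conjI)
    fix h z assume h: "h \<in> S" "h x = 0" and z: "z \<in> Q"
    show hz: "h z \<in> Q" using hQ[OF h z] .
    obtain v d where v: "v \<in> S" "v x = z + d *s x" using Brep[OF z] by blast
    note hl = lin_simps[OF ts_lin[OF tS h(1)]] and vl = lin_simps[OF ts_lin[OF tS v(1)]]
    have "z = v x - d *s x" using v(2) by simp
    then have hz': "h z = h (v x)" using h(2) by (simp add: hl)
    have "s y (h (h (v x))) = 0" "s y (h (v (v x))) = 0"
      using WQ(1)[OF y] hQ[OF h] vxQ[OF v(1)] vvxQ[OF v(1)] by blast+
    then have "s y (v (h (v x))) = 0"
      using partners_3[OF S x(1) _ h(1) v(1), of y] y h(2) unfolding W_def by (simp add: hl vl)
    then show "B y (h z) z = 0" using B_eq[OF y hz v] unfolding hz' by simp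
  qed
  obtain x' where x': "x' \<in> U" "s x x' = 1" using regularD[OF rU x(1,2)] by blast
  have Qx: "Q \<subseteq> perp {x}" using WQ(1)[OF xW] by (auto simp: perp_iff)
  note c = S x(1) x' sQ QU xQ Qx
  let ?p = "hproj x x'"
  let ?Y = "Q \<inter> perp {x'}"
  let ?U = "U \<inter> perp {x,x'}"
  let ?S = "reduced x x' S"
  have opt': "optimal_space ?U (k - 1) ?S" by (rule optimal_reduced[OF S x(1) x'])
  have p: "?p a \<in> ?Y" "s (?p a) b = s a b" "s b (?p a) = s b a"  if "a \<in> Q" "b \<in> Q" for a b
    using hproj_Y_mem[OF c altB[OF xW] invB[OF xW] radB[OF xW]] hproj_Y_s[OF c altB[OF xW] invB[OF xW] radB[OF xW]] that by blast+
  have pB: "B y (?p a) b = B y a b" "B y b (?p a) = B y b a" if "y \<in> W" "a \<in> Q" "b \<in> Q" for y a b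
    using hproj_Y_B[OF c altB[OF that(1)] invB[OF that(1)] radB[OF that(1)]] that by blast+
  have Y: "subspace ?Y" "?Y \<subseteq> ?U" using subspace_Y'[OF c altB[OF xW] invB[OF xW] radB[OF xW]] by blast+
  have hY: "h z \<in> ?Y" if "h \<in> ?S" "z \<in> ?Y" for h z
    using reduced_Y(1)[OF c altB[OF xW] invB[OF xW] radB[OF xW] that] .
  have hYB: "B y (h z) z = 0" if "y \<in> W" "h \<in> ?S" "z \<in> ?Y" for h z y
    using reduced_Y(2)[OF c altB[OF that(1)] invB[OF that(1)] radB[OF that(1)] that(2,3)] .
  have altY: "alternating_on ?Y (B y)" if "y \<in> W" for y by (rule alternating_on_Y'[OF c altB[OF that] invB[OF that] radB[OF that]])
  obtain y0 where y0: "y0 \<in> W" "y0 \<notin> span {x}"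
  proof (cases "z0 \<in> span {x}")
    case False
    then show ?thesis using that pW[OF z0] by blast
  next
    case True
    obtain w where w: "w \<in> partners U S z0" "w \<notin> span {z0}" using z0 unfolding paired_def by blast
    obtain c where c: "z0 = c *s x" using True unfolding span_singleton by blast
    then have "x = (1 / c) *s z0" using z0U(2) by auto
    then have "x \<in> span {z0}" unfolding span_singleton by blast
    then have "span {x} \<subseteq> span {z0}" by (intro span_minimal subspace_span) blast
    then show ?thesis using that[of w] w(2) pW[OF partners_paired[OF S x z0 w]] by blast
  qed
  show ?thesis
  proof (cases "Q \<subseteq> perp Q")
    case True
    have B0: "B y a b = 0" if y: "y \<in> W" and ab: "a \<in> Q" "b \<in> Q" for y a b
    proof -
      have "B y (?p a) (?p b) = 0"
      proof (rule isotropic_alternating_zero[OF opt' Y _ _ altY[OF y]])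
        show "?Y \<subseteq> perp ?Y" using True by (auto simp: perp_iff)
      qed (use hY hYB[OF y] p ab in blast)+
      then show ?thesis using pB[OF y] p(1) ab by auto
    qed
    show ?thesis
    proof (rule that[OF sQ QU])
      show "Q \<noteq> {0}" using xQ x(2) by blast
      show "Q \<noteq> U"
      proof
        assume "Q = U"
        then have "y0 \<in> U \<inter> perp U" using y0(1) WU WQ by (auto simp: perp_iff)
        then have "y0 = 0" using rU unfolding regular_def by blast
        then show False using y0(2) span_zero by blast
      qed
      fix v z assume v: "v \<in> S" and z: "z \<in> Q"
      have "s y (v z) = 0" if y: "y \<in> W" for y
        using B_eq[OF y z v, of "v x" 0] B0[OF y z vxQ[OF v]] by simp
      then show "v z \<in> Q" using ts_range[OF tS v] by (auto intro: Qmem)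
    qed
  next
    case False
    \<comment> \<open>This case is contradictory: Q turns out to be coisotropic, and the
      proportional form yields a paired vector z outside W, which contains all paired
      vectors.\<close>
    then obtain z1 q1 where z1: "z1 \<in> Q" "q1 \<in> Q" "s q1 z1 \<noteq> 0" unfolding perp_def by blast
    have z1W: "z1 \<notin> W" using WQ(2)[of z1 q1] z1 by blast
    \<comment> \<open>The wedge of the projections of z1 and y lies in the reduced space, so it is
      induced by some u in S with u x = 0, and such u preserve Q. At v x with s z1 (v x) nonzero it
      takes a nonzero multiple of the projection of y as its value.\<close>
    have WsubQ: "W \<subseteq> Q"
    proof
      fix y assume y: "y \<in> W"
      have py: "?p y = y + s x' y *s x" unfolding hproj_def using Ws(2)[OF y] by simp
      have pyW: "?p y \<in> W" unfolding py using y xW sW by (simp add: subspace_add subspace_scale)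
      have pyU: "?p y \<in> ?U" using pyW WU hproj_perp[OF x'(2)] by (auto simp: perp_iff)
      have pz: "?p z1 \<in> ?Y" using p(1) z1 by blast
      then have pzU: "?p z1 \<in> ?U" and pzQ: "?p z1 \<in> Q" using Y(2) by blast+
      have "wedge (?p z1) (?p y) \<in> ?S"
        unfolding optimal_wedge_iff[OF opt' pzU pyU]
        using WQ(1)[OF pyW] pzQ hY[OF _ pz] by blast
      then obtain u where u: "u \<in> S" "u x = 0" "wedge (?p z1) (?p y) = ?p \<circ> u \<circ> ?p"
        unfolding reduced_def by blast
      have "s z1 x = 0" using WQ(2)[OF xW z1(1)] .
      then obtain v where v: "v \<in> S" "s z1 (v x) \<noteq> 0" using z1W W_iff QU z1(1) by blast
      let ?a = "v x"
      have aQ: "?a \<in> Q" by (rule vxQ[OF v(1)])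
      have paQ: "?p ?a \<in> Q" using p(1) aQ by blast
      have "?p (u (?p ?a)) \<in> Q" using p(1) hQ[OF u(1,2) paQ] by blast
      moreover have "?p (u (?p ?a)) = wedge (?p z1) (?p y) ?a" using u(3) by simp
      moreover have "wedge (?p z1) (?p y) ?a = - s z1 ?a *s ?p y"
        using WQ(1)[OF pyW aQ] p(2)[OF z1(1) aQ] by (simp add: wedge_def)
      ultimately have "- s z1 ?a *s ?p y \<in> Q" by simp
      then have "(- 1 / s z1 ?a) *s (- s z1 ?a *s ?p y) \<in> Q" by (rule subspace_scale[OF sQ])
      then have "?p y \<in> Q" using v(2) by simp
      then have "?p y - s x' y *s x \<in> Q" using xQ sQ by (simp add: subspace_diff subspace_scale)
      then show "y \<in> Q" unfolding py by simp
    qed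
    have "\<exists>z\<in>?Y. z \<notin> perp ?Y \<and> (\<exists>c. \<forall>a\<in>?Y. B y0 z a = c * s z a)"
    proof (rule coisotropic_alternating_proportional[OF opt' Y _ _ _ _ altY[OF y0(1)]])
      show "?U \<inter> perp ?Y \<subseteq> ?Y"
      proof
        fix w assume w: "w \<in> ?U \<inter> perp ?Y"
        have "s a w = 0" if a: "a \<in> Q" for a
        proof -
          have "s (?p a) w = 0" using w p(1)[OF a a] unfolding perp_def by blast
          moreover have "s x w = 0" using w by (simp add: perp_iff)
          ultimately show ?thesis unfolding hproj_Y[OF c altB[OF xW] invB[OF xW] radB[OF xW] a] by simp
        qed
        then have "w \<in> U \<inter> perp (U \<inter> perp W)" using w unfolding Q_def[symmetric] by (auto simp: perp_iff)
        then have "w \<in> W" unfolding perp_perp_eq[OF rU sW WU] .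
        then show "w \<in> ?Y" using w WsubQ by (auto simp: perp_iff)
      qed
      show "?p z1 \<in> ?Y" using p(1) z1 by blast
      show "?p z1 \<notin> perp ?Y"
      proof
        assume "?p z1 \<in> perp ?Y"
        then have "s (?p q1) (?p z1) = 0" using p(1)[OF z1(2,2)] by (auto simp: perp_iff)
        moreover have "?p z1 \<in> Q" using p(1)[OF z1(1,1)] by blast
        ultimately show False using p(2)[OF z1(2), of "?p z1"] p(3)[OF z1(1,2)] z1(3) by simp
      qed
    qed (use hY hYB[OF y0(1)] in blast)+
    then obtain z d where z: "z \<in> ?Y" "z \<notin> perp ?Y" and zd: "\<And>a. a \<in> ?Y \<Longrightarrow> B y0 z a = d * s z a" by blast
    have zQ: "z \<in> Q" and zU: "z \<in> U" using z(1) QU by blast+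
    have zx: "s z x = 0" by (rule WQ(2)[OF xW zQ])
    \<comment> \<open>The summand d x compensates the proportionality: s y0 (v z) = d s z (v x) = -
      d s x (v z).\<close>
    let ?y = "y0 + d *s x"
    have yW: "?y \<in> W" using y0(1) xW sW by (simp add: subspace_add subspace_scale)
    have "s ?y (v z) = 0" if v: "v \<in> S" for v
    proof -
      have a: "v x \<in> Q" by (rule vxQ[OF v])
      have "s y0 (v z) = B y0 z (v x)" using B_eq[OF y0(1) zQ v, of "v x" 0] by simp
      also have "\<dots> = B y0 z (?p (v x))" using pB(2)[OF y0(1) a zQ] by simp
      also have "\<dots> = d * s z (?p (v x))" using zd p(1)[OF a a] by blast
      also have "\<dots> = d * s z (v x)" using p(3)[OF a zQ] by simp
      also have "\<dots> = - (d * s x (v z))" using ts_adj[OF tS v, of z x] s_skew[of x "v z"] by simp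
      finally show ?thesis by simp
    qed
    then have yK: "?y \<in> partners U S z"
      unfolding partners_iff[OF S zU] using yW WU WQ(1)[OF yW zQ] by blast
    have znW: "z \<notin> W"
    proof
      assume "z \<in> W"
      then have "z \<in> perp ?Y" using WQ by (auto simp: perp_iff)
      then show False using z(2) by blast
    qed
    have "?y \<notin> span {z}"
    proof
      assume "?y \<in> span {z}"
      then obtain r where r: "?y = r *s z" unfolding span_singleton by blast
      show False
      proof (cases "r = 0")
        case True
        then have "y0 = (- d) *s x" using r by (simp add: add_eq_0_iff)
        then show False using y0(2) unfolding span_singleton by blast
      next
        case False
        have "(1 / r) *s ?y \<in> W" using yW sW by (rule subspace_scale[rotated])
        then show False using r False znW by simp
      qed
    qed
    moreover have "z \<noteq> 0" using z(2) subspace_0[OF subspace_perp] by blast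
    ultimately have "paired U S z" unfolding paired_def using zU yK by blast
    then show ?thesis using pW znW by blast
  qed
qed

subsection \<open>Optimal spaces without elements of rank two\<close>

definition polar :: "('v \<Rightarrow> 'v) set \<Rightarrow> 'v \<Rightarrow> 'v set"
  where "polar S x = {z. \<forall>u\<in>S. s z (u x) = 0}"

lemma subspace_polar [simp]: "subspace (polar S x)"
  unfolding polar_def by (rule subspaceI) auto

lemma polarD: "z \<in> polar S x \<Longrightarrow> u \<in> S \<Longrightarrow> s z (u x) = 0"
  unfolding polar_def by blast

lemma polar_perp: "polar S x = perp ((\<lambda>u. u x) ` S)"
  unfolding polar_def perp_def using s_skew0 by auto

text \<open>The l with S contained in \<open>alt_endo scale (twist s l)\<close>. Every extension
  that corresponds to S lies in this set, which is the source of uniqueness.\<close>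

definition multipliers :: "('v \<Rightarrow> 'v) set \<Rightarrow> ('v \<Rightarrow> 'v) set"
  where "multipliers S = {l \<in> Endo scale. \<forall>u\<in>S. \<forall>x. s x (l (u x)) = 0}"

definition lincomb :: "('v \<Rightarrow> 'v) \<Rightarrow> 'f \<Rightarrow> 'f \<Rightarrow> 'v \<Rightarrow> 'v"
  where "lincomb b \<alpha> \<beta> = (\<lambda>x. \<alpha> *s x + \<beta> *s b x)"

lemma exists_adjoint:
  assumes "lin a"
  obtains b where "lin b" "\<And>x y. s (a x) y = s x (b y)"
proof -
  have "\<exists>w. \<forall>x. s (a x) y = s x w" for y
  proof -
    have "Vector_Spaces.linear scale (*) (\<lambda>x. s (a x) y)"
      using s_lin_left[of y] lin_simps[OF assms] by (auto simp: Vector_Spaces.linear_iff)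
    then show ?thesis by (rule riesz) blast
  qed
  then obtain b where b: "\<And>x y. s (a x) y = s x (b y)" by metis
  have "lin b" unfolding lin_iff
  proof (intro conjI allI)
    show "b (y + z) = b y + b z" for y z by (rule s_right_eqI) (simp add: b[symmetric])
    show "b (c *s y) = c *s b y" for c y by (rule s_right_eqI) (simp add: b[symmetric])
  qed
  then show ?thesis using b by (rule that)
qed

context
  fixes S n
  assumes S: "optimal_space UNIV n S" and n2: "n \<ge> 2"
    and big: "infinite (UNIV :: 'f set) \<or> card (UNIV :: 'f set) > 2 * n - 2"
    and nopair: "\<And>x. \<not> paired UNIV S x"
begin

private lemma triv: "trivial_space UNIV S" using optimal_trivial[OF S] .
private lemma dimV: "dim (UNIV :: 'v set) = 2 * n" using S unfolding optimal_space_def by blast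
private lemma dimS: "fs.dim S = n * (n - 1)" using S unfolding optimal_space_def by blast

private abbreviation "P \<equiv> polar S"

lemma exists_nonzero: obtains x :: 'v where "x \<noteq> 0"
proof -
  have "\<not> (UNIV :: 'v set) \<subseteq> {0}" using dimV n2 dim_eq_0[of UNIV] by (auto simp del: dim_UNIV)
  then show ?thesis using that by blast
qed

lemma polar_self: "x \<in> P x"
  unfolding polar_def using ts_self[OF triv] by blast

lemma polar_sym: "z \<in> P x \<Longrightarrow> x \<in> P z"
  unfolding polar_def using ts_adj[OF triv] s_skew0 by force

lemma wedge_notin:
  assumes "wedge x y \<in> S" "x \<noteq> 0"
  shows "y \<in> span {x}"
  using nopair[of x] assms unfolding paired_def partners_def by auto

lemma polar_isotropic:
  assumes "z \<in> P x" "s z x = 0" "x \<noteq> 0"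
  shows "z \<in> span {x}"
  by (rule wedge_notin[OF _ assms(3)]) (use optimal_wedge_iff[OF S] assms in \<open>auto simp: polar_def\<close>)

lemma exists_polar_dual:
  assumes "x \<noteq> 0"
  obtains z where "z \<in> P x" "s x z = 1"
proof -
  let ?X = "(\<lambda>u. u x) ` S"
  have X: "subspace ?X" by (rule subspace_eval[OF ts_fs[OF triv]])
  have "x \<notin> ?X" using ts_fix[OF triv] assms by (metis imageE)
  then have "x \<notin> perp (perp ?X)" using perp_perp_eq[OF regular_UNIV X] by simp
  then obtain z where z: "z \<in> P x" "s z x \<noteq> 0" unfolding polar_perp by (auto simp: perp_iff)
  have "(1 / s x z) *s z \<in> P x" using z(1) by (intro subspace_scale) auto
  moreover have "s x ((1 / s x z) *s z) = 1" using z(2) s_skew0 by simp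
  ultimately show ?thesis by (rule that)
qed

lemma polar_rep:
  assumes x: "x \<noteq> 0" and z: "z \<in> P x" "z \<notin> span {x}" and w: "w \<in> P x"
  obtains a b where "w = a *s x + b *s z"
proof -
  have zx: "s x z \<noteq> 0" using polar_isotropic[OF z(1) _ x] z(2) s_skew0 by blast
  let ?b = "s x w / s x z"
  have "w - ?b *s z \<in> P x" using z w by (intro subspace_diff subspace_scale) auto
  moreover have "s (w - ?b *s z) x = 0" using zx s_skew0[of "w - ?b *s z" x] by simp
  ultimately have "w - ?b *s z \<in> span {x}" using polar_isotropic x by blast
  then obtain a where "w - ?b *s z = a *s x" unfolding span_singleton by blast
  then have "w = a *s x + ?b *s z" by (simp add: algebra_simps)
  then show ?thesis by (rule that)
qed

lemma dual_notin_span: "s x z = 1 \<Longrightarrow> z \<notin> span {x}"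
  unfolding span_singleton by auto

lemma polar_eq_span:
  assumes "x \<noteq> 0" "z \<in> P x" "z \<notin> span {x}"
  shows "P x = span {x,z}"
proof
  show "span {x,z} \<subseteq> P x" using assms polar_self by (intro span_minimal) auto
  show "P x \<subseteq> span {x,z}"
  proof
    fix w assume "w \<in> P x"
    then obtain a b where "w = a *s x + b *s z" by (rule polar_rep[OF assms])
    then show "w \<in> span {x,z}" by (simp add: span_add span_scale span_base)
  qed
qed

lemma dim_polar:
  assumes "x \<noteq> 0"
  shows "dim (P x) = 2"
proof -
  obtain z where z: "z \<in> P x" "s x z = 1" by (rule exists_polar_dual[OF assms])
  have "P x = span {x,z}" by (rule polar_eq_span[OF assms z(1) dual_notin_span[OF z(2)]])
  then have "dim (P x) = dim {z,x}" by (simp add: insert_commute)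
  also have "\<dots> = 2" using dual_notin_span[OF z(2)] assms by (simp add: dim_insert)
  finally show ?thesis .
qed

lemma dim_eval:
  assumes "x \<noteq> 0"
  shows "dim ((\<lambda>u. u x) ` S) = 2 * n - 2"
  using dim_perp[OF regular_UNIV subspace_eval[OF ts_fs[OF triv]], of x] dim_polar[OF assms] dimV
  unfolding polar_perp by (simp del: dim_UNIV)

lemma dim_annihilator:
  assumes "x \<noteq> 0"
  shows "fs.dim {u\<in>S. u x = 0} = (n - 1) * (n - 2)"
proof -
  have "fs.dim S = dim ((\<lambda>u. u x) ` S) + fs.dim {u\<in>S. u x = 0}"
    by (rule fsv.rank_nullity[OF linear_eval ts_fs[OF triv] ts_finite[OF triv]])
  moreover obtain m where "n = Suc (Suc m)" using n2 by (metis add_2_eq_Suc le_Suc_ex)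
  ultimately show ?thesis using dim_eval[OF assms] dimS by simp
qed

text \<open>If \<open>u z \<noteq> 0\<close>, pick \<open>\<eta>\<close> with \<open>s z (u \<eta>) \<noteq> 0\<close>. Since \<open>S (\<eta> - l x)\<close> has dimension \<open>2 n - 2\<close> for all
  scalars \<open>l\<close>, on a suitable subspace \<open>C\<close> of \<open>S\<close> of the same dimension every \<open>l\<close> is a
  generalized eigenvalue of the pencil of evaluations at \<open>\<eta>\<close> and at \<open>x\<close>.\<close>

lemma annihilator_polar:
  assumes x: "x \<noteq> 0" and u: "u \<in> S" "u x = 0" and z: "z \<in> P x"
  shows "u z = 0"
proof (rule ccontr)
  assume "u z \<noteq> 0"
  then obtain \<eta> where "s (u z) \<eta> \<noteq> 0" using nondegenerate by blast
  then have \<eta>: "s z (u \<eta>) \<noteq> 0" using ts_adj[OF triv u(1)] by simp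
  \<comment> \<open>The linear form s z (v \<eta>) in v is nonzero at u. Since u x = 0, subtracting
    multiples of u shows that its kernel S1 still evaluates onto S x.\<close>
  define S1 where "S1 = {v\<in>S. s z (v \<eta>) = 0}"
  have S1: "fs.subspace S1"
    unfolding S1_def by (rule fs.subspaceI)
      (auto simp: fscale_apply intro: fs.subspace_0[OF ts_fs[OF triv]] ts_add[OF triv] ts_scale[OF triv])
  have S1S: "S1 \<subseteq> S" unfolding S1_def by blast
  have fS1: "finitely_spanned (fscale scale) S1" by (rule fs.finitely_spanned_mono[OF ts_finite[OF triv] S1S])
  have S1x: "(\<lambda>v. v x) ` S1 = (\<lambda>v. v x) ` S"
  proof
    show "(\<lambda>v. v x) ` S1 \<subseteq> (\<lambda>v. v x) ` S" using S1S by blast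
    show "(\<lambda>v. v x) ` S \<subseteq> (\<lambda>v. v x) ` S1"
    proof
      fix y assume "y \<in> (\<lambda>v. v x) ` S"
      then obtain v where v: "v \<in> S" "y = v x" by blast
      let ?w = "v - fscale scale (s z (v \<eta>) / s z (u \<eta>)) u"
      have "?w \<in> S1" unfolding S1_def using v u \<eta> ts_diff[OF triv] ts_scale[OF triv] by (auto simp: fscale_apply)
      moreover have "y = ?w x" using v(2) u(2) by (simp add: fscale_apply)
      ultimately show "y \<in> (\<lambda>v. v x) ` S1" by blast
    qed
  qed
  obtain C where C: "fs.subspace C" "C \<subseteq> S1" "\<And>c. c \<in> C \<Longrightarrow> c x = 0 \<Longrightarrow> c = 0"
      "fs.dim C = dim ((\<lambda>v. v x) ` S1)"
    by (rule fsv.rank_nullity_complement[OF linear_eval[of x] S1 fS1]) blast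
  have dC: "fs.dim C = 2 * n - 2" using C(4) dim_eval[OF x] S1x by simp
  have CS: "C \<subseteq> S" using C(2) S1S by blast
  have fC: "finitely_spanned (fscale scale) C" by (rule fs.finitely_spanned_mono[OF ts_finite[OF triv] CS])
  \<comment> \<open>Otherwise C evaluates injectively at \<eta> - l x, which gives 2 n - 2
    dimensions of values orthogonal to z, as z is in P x. But u (\<eta> - l x) is not orthogonal to
    z, so S (\<eta> - l x) would be too large.\<close>
  have eig: "\<exists>v. v \<in> C \<and> v \<noteq> 0 \<and> v \<eta> = l *s v x" for l
  proof (rule ccontr)
    assume no: "\<not> ?thesis"
    let ?\<xi> = "\<eta> - l *s x"
    have ev: "v ?\<xi> = v \<eta> - l *s v x" if "v \<in> S" for v by (simp add: lin_simps[OF ts_lin[OF triv that]])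
    have "?\<xi> \<noteq> 0"
    proof
      assume "?\<xi> = 0"
      then have "u ?\<xi> = 0" using lin_0[OF ts_lin[OF triv u(1)]] by simp
      then show False using ev[OF u(1)] u(2) \<eta> by auto
    qed
    have "{v\<in>C. v ?\<xi> = 0} = {0}"
    proof -
      have "0 \<in> C" using fs.subspace_0[OF C(1)] .
      moreover have "v = 0" if "v \<in> C" "v ?\<xi> = 0" for v using no that ev CS by (metis eq_iff_diff_eq_0 subsetD)
      ultimately show ?thesis by auto
    qed
    moreover have "fs.dim {0 :: 'v \<Rightarrow> 'v} = 0" by (metis fs.dim_span fs.span_empty fs.dim_le_card card.empty finite.emptyI le_zero_eq order_refl)
    ultimately have "dim ((\<lambda>v. v ?\<xi>) ` C) = 2 * n - 2"
      using fsv.rank_nullity[OF linear_eval[of ?\<xi>] C(1) fC] dC by simp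
    moreover have "subspace ((\<lambda>v. v ?\<xi>) ` C)" by (rule subspace_eval[OF C(1)])
    moreover have "u ?\<xi> \<notin> (\<lambda>v. v ?\<xi>) ` C"
    proof
      assume "u ?\<xi> \<in> (\<lambda>v. v ?\<xi>) ` C"
      then obtain v where v: "v \<in> C" "u ?\<xi> = v ?\<xi>" by blast
      have "s z (v ?\<xi>) = 0" using C(2) v(1) ev[of v] CS polarD[OF z, of v] unfolding S1_def by auto
      moreover have "s z (u ?\<xi>) = s z (u \<eta>)" using ev[OF u(1)] u(2) by simp
      ultimately show False using v(2) \<eta> by simp
    qed
    moreover have "(\<lambda>v. v ?\<xi>) ` C \<subseteq> (\<lambda>v. v ?\<xi>) ` S" using CS by blast
    ultimately have "2 * n - 2 < dim ((\<lambda>v. v ?\<xi>) ` S)"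
      using dim_one_more[OF _ subspace_eval[OF ts_fs[OF triv]]] u(1) by (metis image_eqI)
    then show False using dim_eval[OF \<open>?\<xi> \<noteq> 0\<close>] by simp
  qed
  obtain v where v: "\<And>l. v l \<in> C \<and> v l \<noteq> 0 \<and> v l \<eta> = l *s v l x" using eig by metis
  \<comment> \<open>Together with 0 these are 2 n - 1 eigenvalues, while dim C = 2 n - 2; the bound
    on the field is used here in full.\<close>
  obtain I :: "'f set" where I: "finite I" "card I = 2 * n - 2" "0 \<notin> I"
    using exists_finite_subset_avoiding[OF big] by blast
  let ?I = "insert 0 I"
  have "fs.independent (v ` ?I) \<and> inj_on v ?I"
    by (rule fsv.pencil_eigenvectors_independent[OF linear_eval[of x] linear_eval[of \<eta>] C(1,3)]) (use v I in auto)
  then have "card ?I \<le> fs.dim C"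
    using fs.finitely_spanned_independent(2)[OF fC] v by (metis card_image image_subsetI)
  then show False using I dC by simp
qed

section \<open>The planes P x and the transports between them, for n at least 3\<close>

context
  assumes n3: "n \<ge> 3"
begin

private abbreviation "Ann x \<equiv> {u\<in>S. u x = 0}"

private lemma annih: "x \<noteq> 0 \<Longrightarrow> u \<in> Ann x \<Longrightarrow> z \<in> P x \<Longrightarrow> u z = 0"
  using annihilator_polar by blast

lemma annihilator_eq:
  assumes x: "x \<noteq> 0" and z: "z \<in> P x" "z \<noteq> 0"
  shows "Ann x = Ann z"
proof (rule fs.finitely_spanned_dim_eq)
  show "finitely_spanned (fscale scale) (Ann z)"
    by (rule fs.finitely_spanned_mono[OF ts_finite[OF triv]]) blast
  show "Ann x \<subseteq> Ann z" using annih[OF x _ z(1)] by blast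
  show "fs.dim (Ann z) \<le> fs.dim (Ann x)" using dim_annihilator x z(2) by simp
  show "fs.subspace (Ann x)" by (rule subspace_annihilator[OF ts_fs[OF triv]])
qed

context
  fixes x t
  assumes x: "x \<noteq> 0" and t: "t \<in> P x" and xt: "s x t = 1"
begin

private abbreviation "h \<equiv> hproj x t"

private lemma tA: "u \<in> Ann x \<Longrightarrow> u t = 0" using annih[OF x _ t] .

lemma annihilator_hproj: "u \<in> Ann x \<Longrightarrow> u (h y) = u y"
  using tA[of u] by (auto simp: hproj_def lin_simps[OF ts_lin[OF triv]])

lemma annihilator_range: "u \<in> Ann x \<Longrightarrow> u y \<in> perp {x,t}"
  using tA[of u] ts_adj[OF triv, of u, symmetric] by (simp add: perp_iff)

lemma annihilator_s_hproj: "u \<in> Ann x \<Longrightarrow> s (h z) (u y) = s z (u y)"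
  using annihilator_range[of u y] hproj_id[of x "u y" t] by (simp add: hproj_adj perp_iff)

lemma hproj_in: "h y \<in> perp {x,t}"
  using hproj_perp[OF xt] by (simp add: perp_iff)

lemma hproj_0: "h y = 0 \<Longrightarrow> y \<in> P x"
proof -
  assume "h y = 0"
  then have "y = s x y *s t - s t y *s x" using hproj_decomp[of y x t] by simp
  also have "\<dots> \<in> P x" using t polar_self by (intro subspace_diff subspace_scale) auto
  finally show "y \<in> P x" .
qed

text \<open>By \<open>annihilator_polar\<close> the annihilator of x also kills t, so it acts on {x,
  t}^perp without any compression, and its dimension (n - 1)(n - 2) is extremal there.\<close>

lemma annihilator_optimal: "optimal_space (perp {x,t}) (n - 1) (Ann x)"
proof -
  have r: "regular (perp {x,t})" "dim (perp {x,t}) = 2 * (n - 1)"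
    using regular_hyperbolic[OF regular_UNIV _ _ xt] dimV n2 by simp_all
  have "trivial_space (perp {x,t}) (Ann x)"
    unfolding trivial_space_def
    using r subspace_annihilator[OF ts_fs[OF triv]] ts_alt[OF triv] annihilator_range ts_fix[OF triv] by blast
  moreover have "infinite (UNIV :: 'f set) \<or> card (UNIV :: 'f set) > n - 1" using big n2 by auto
  moreover have "fs.dim (Ann x) = (n - 1) * (n - 1 - 1)" using dim_annihilator[OF x] n2
    by (simp add: numeral_2_eq_2)
  ultimately show ?thesis unfolding optimal_space_def using r by blast
qed

text \<open>Rank two elements of \<open>Ann x\<close> would be rank two elements of S, so in {x,
  t}^perp only multiples of y are partners of y.\<close>

lemma annihilator_closure:
  assumes y: "y \<in> perp {x,t}" "y \<noteq> 0" and z: "z \<in> perp {x,t}" "s z y = 0" "\<And>u. u \<in> Ann x \<Longrightarrow> s z (u y) = 0"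
  shows "z \<in> span {y}"
proof -
  have "wedge y z \<in> Ann x" unfolding optimal_wedge_iff[OF annihilator_optimal y(1) z(1)] using z by blast
  then show ?thesis using wedge_notin[OF _ y(2)] by blast
qed

text \<open>If h y were nonzero, all vectors of {x, t}^perp orthogonal to h y would be its partners
  for \<open>Ann x\<close>, hence multiples of it. They form a space of dimension at least 2 (n - 1)
  - 1, which exceeds 1 for n at least 3.\<close>

lemma annihilator_common_kernel:
  assumes "\<And>u. u \<in> Ann x \<Longrightarrow> u y = 0"
  shows "y \<in> P x"
proof (rule hproj_0, rule ccontr)
  assume n: "h y \<noteq> 0"
  have k: "s z (u (h y)) = 0" if "u \<in> Ann x" for u z using annihilator_hproj[OF that] assms[OF that] by simp
  have "z \<in> span {h y}" if z: "z \<in> perp {x,t} \<inter> perp {h y}" for z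
  proof (rule annihilator_closure[OF hproj_in n])
    show "z \<in> perp {x,t}" using z by blast
    show "s z (h y) = 0" using z s_skew0[of z] by (simp add: perp_iff)
    show "s z (u (h y)) = 0" if "u \<in> Ann x" for u by (rule k[OF that])
  qed
  then have "perp {x,t} \<inter> perp {h y} \<subseteq> span {h y}" by blast
  then have "dim (perp {x,t} \<inter> perp {h y}) \<le> dim {h y}" by (rule dim_mono)
  also have "\<dots> \<le> 1" by simp
  finally have "dim (perp {x,t} \<inter> perp {h y}) \<le> 1" .
  then show False
    using dim_cut[OF subspace_perp, of "{x,t}" "h y"] annihilator_optimal n3 unfolding optimal_space_def by simp
qed

end

lemma polar_subset:
  assumes "x \<noteq> 0" "z \<in> P x" "z \<noteq> 0"
  shows "P z \<subseteq> P x"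
proof
  fix w assume w: "w \<in> P z"
  obtain t where t: "t \<in> P x" "s x t = 1" by (rule exists_polar_dual[OF assms(1)])
  show "w \<in> P x"
    by (rule annihilator_common_kernel[OF assms(1) t]) (use annihilator_eq[OF assms] annih[OF assms(3) _ w] in blast)
qed

lemma polar_eq_3:
  assumes "x \<noteq> 0" "z \<in> P x" "z \<noteq> 0"
  shows "P z = P x"
  using polar_subset[OF assms] polar_subset[OF assms(3) polar_sym[OF assms(2)] assms(1)] by blast

lemma polar_disjoint_3:
  assumes "x \<noteq> 0" "y \<notin> P x" "w \<in> P x" "w \<in> P y"
  shows "w = 0"
proof (rule ccontr)
  assume w: "w \<noteq> 0"
  have "y \<noteq> 0" using assms(2) subspace_0[OF subspace_polar] by auto
  then have "P x = P y" using polar_eq_3[OF assms(1,3) w] polar_eq_3[OF _ assms(4) w] by simp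
  then show False using assms(2) polar_self by blast
qed

text \<open>Work modulo P x. Maps in \<open>Ann x\<close> do not distinguish x + y from y, so the
  projections of z and of w, a dual of y in P y, satisfy the same orthogonality relations at the
  projection of y. By \<open>annihilator_closure\<close> these define at most a plane, so z is a
  combination of w and y modulo P x.\<close>

lemma polar_sum_generic:
  assumes x: "x \<noteq> 0" and y: "y \<notin> P x" and z: "z \<in> P (x + y)"
  obtains a b where "a \<in> P x" "b \<in> P y" "z = a + b"
proof -
  obtain t where t: "t \<in> P x" "s x t = 1" by (rule exists_polar_dual[OF x])
  note xt = x t
  let ?h = "hproj x t"
  note pl = lin_simps[OF lin_hproj[of x t]]
  have y0: "y \<noteq> 0" using y subspace_0[OF subspace_polar] by auto
  obtain w where w: "w \<in> P y" "s y w = 1" by (rule exists_polar_dual[OF y0])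
  have py: "?h y \<noteq> 0" using hproj_0[OF xt] y by blast
  have orth: "s (?h a) (u (?h y)) = s a (u y)" if "u \<in> Ann x" for a u
    using annihilator_s_hproj[OF xt that] annihilator_hproj[OF xt that] by simp
  have wy: "s (?h w) (u (?h y)) = 0" if u: "u \<in> Ann x" for u
    using orth[OF u] polarD[OF w(1)] u by simp
  have zy: "s (?h z) (u (?h y)) = 0" if u: "u \<in> Ann x" for u
  proof -
    have "u (x + y) = u y" using u by (simp add: lin_simps[OF ts_lin[OF triv]])
    then show ?thesis using orth[OF u] polarD[OF z, of u] u by simp
  qed
  have nz: "s (?h w) (?h y) \<noteq> 0"
  proof
    assume "s (?h w) (?h y) = 0"
    then have "?h w \<in> span {?h y}" using annihilator_closure[OF xt hproj_in[OF xt] py hproj_in[OF xt]] wy by blast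
    then obtain e where "?h w = e *s ?h y" unfolding span_singleton by blast
    then have "?h (w - e *s y) = 0" by (simp add: pl)
    then have "w - e *s y \<in> P x" using hproj_0[OF xt] by blast
    moreover have "w - e *s y \<in> P y" using w polar_self by (intro subspace_diff subspace_scale) auto
    ultimately have "w - e *s y = 0" using polar_disjoint_3[OF x y] by blast
    then have "s y w = 0" by simp
    then show False using w(2) by simp
  qed
  define d where "d = s (?h z) (?h y) / s (?h w) (?h y)"
  have "?h z - d *s ?h w \<in> span {?h y}"
  proof (rule annihilator_closure[OF xt hproj_in[OF xt] py])
    show "?h z - d *s ?h w \<in> perp {x,t}"
      using hproj_in[OF xt] by (intro subspace_diff subspace_scale) auto
    show "s (?h z - d *s ?h w) (?h y) = 0" unfolding d_def using nz by simp
    show "s (?h z - d *s ?h w) (u (?h y)) = 0" if "u \<in> Ann x" for u using zy[OF that] wy[OF that] by simp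
  qed
  then obtain e where "?h z - d *s ?h w = e *s ?h y" unfolding span_singleton by blast
  then have "?h (z - (d *s w + e *s y)) = 0" by (simp add: pl diff_eq_eq algebra_simps)
  then have "z - (d *s w + e *s y) \<in> P x" using hproj_0[OF xt] by blast
  moreover have "d *s w + e *s y \<in> P y" using w polar_self by (intro subspace_add subspace_scale) auto
  ultimately show ?thesis using that[of "z - (d *s w + e *s y)" "d *s w + e *s y"] by simp
qed

lemma polar_sum:
  assumes x: "x \<noteq> 0" and y: "y \<notin> P x" and ab: "a \<in> P x" "b \<in> P y" "a + b \<noteq> 0" and z: "z \<in> P (a + b)"
  obtains a' b' where "a' \<in> P x" "b' \<in> P y" "z = a' + b'"
proof -
  have y0: "y \<noteq> 0" using y subspace_0[OF subspace_polar] by auto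
  consider "a = 0" | "b = 0" | "a \<noteq> 0" "b \<noteq> 0" by blast
  then show ?thesis
  proof cases
    case 1
    then have "z \<in> P y" using z polar_eq_3[OF y0 ab(2)] ab(3) by simp
    then show ?thesis using that[of 0 z] subspace_0[OF subspace_polar] by simp
  next
    case 2
    then have "z \<in> P x" using z polar_eq_3[OF x ab(1)] ab(3) by simp
    then show ?thesis using that[of z 0] subspace_0[OF subspace_polar] by simp
  next
    case 3
    have Pa: "P a = P x" "P b = P y" using polar_eq_3 x y0 ab 3 by blast+
    have "b \<notin> P a" using polar_disjoint_3[OF x y] ab 3 Pa by blast
    then show ?thesis using polar_sum_generic[OF 3(1) _ z] that Pa by metis
  qed
qed

text \<open>P (x + y) lies in P x + P y and meets P y only in 0, so it projects onto P x: it is the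
  graph of a map from P x to P y, the transport.\<close>

lemma polar_transport:
  assumes x: "x \<noteq> 0" and y: "y \<notin> P x" and t: "t \<in> P x"
  obtains b where "b \<in> P y" "t + b \<in> P (x + y)"
proof -
  have xy: "x + y \<noteq> 0"
  proof
    assume "x + y = 0"
    then have "y = - x" by (simp add: add_eq_0_iff)
    then show False using y subspace_neg[OF subspace_polar polar_self] by blast
  qed
  obtain z where z: "z \<in> P (x + y)" "s (x + y) z = 1" by (rule exists_polar_dual[OF xy])
  obtain a b where ab: "a \<in> P x" "b \<in> P y" "z = a + b" by (rule polar_sum_generic[OF x y z(1)])
  have y': "x \<notin> P y" using polar_sym y by blast
  have y0: "y \<noteq> 0" using y subspace_0[OF subspace_polar] by auto
  have "x + y \<notin> P y" using y' subspace_diff[OF subspace_polar _ polar_self, of "x + y" y] by auto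
  have "a \<notin> span {x}"
  proof
    assume "a \<in> span {x}"
    then obtain \<alpha> where "a = \<alpha> *s x" unfolding span_singleton by blast
    then have e: "z - \<alpha> *s (x + y) = b - \<alpha> *s y" using ab(3) by (simp add: scale_right_distrib)
    have "z - \<alpha> *s (x + y) \<in> P (x + y)" using z polar_self by (intro subspace_diff subspace_scale) auto
    moreover have "z - \<alpha> *s (x + y) \<in> P y" unfolding e using ab polar_self by (intro subspace_diff subspace_scale) auto
    ultimately have "z - \<alpha> *s (x + y) = 0" using polar_disjoint_3[OF y0 \<open>x + y \<notin> P y\<close>] by blast
    then have "z = \<alpha> *s (x + y)" by simp
    then show False using z(2) by simp
  qed
  then obtain \<beta> \<gamma> where bg: "t = \<beta> *s x + \<gamma> *s a" by (rule polar_rep[OF x ab(1) _ t])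
  show ?thesis
  proof (rule that)
    show "\<beta> *s y + \<gamma> *s b \<in> P y" using ab polar_self by (intro subspace_add subspace_scale) auto
    have "t + (\<beta> *s y + \<gamma> *s b) = \<beta> *s (x + y) + \<gamma> *s z"
      unfolding bg ab(3) by (simp add: scale_right_distrib algebra_simps)
    also have "\<dots> \<in> P (x + y)"
      by (rule subspace_add[OF subspace_polar subspace_scale[OF subspace_polar polar_self]
        subspace_scale[OF subspace_polar z(1)]])
    finally show "t + (\<beta> *s y + \<gamma> *s b) \<in> P (x + y)" .
  qed
qed

lemma transport_bilinear:
  assumes "t \<in> P x" "b \<in> P y" "t + b \<in> P (x + y)" "u \<in> S"
  shows "s b (u x) = - s t (u y)"
  using polarD[OF assms(1,4)] polarD[OF assms(2,4)] polarD[OF assms(3,4)]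
  by (simp add: lin_simps[OF ts_lin[OF triv assms(4)]] add_eq_0_iff)

text \<open>Desargues-type compatibility of the transports \<open>P x1 \<rightarrow> P x2 \<rightarrow> P y\<close> and \<open>P x1 \<rightarrow> P y\<close>.\<close>

lemma transport_compatible:
  assumes x1: "x1 \<noteq> 0" and x2: "x2 \<notin> P x1"
    and y: "\<And>a b. a \<in> P x1 \<Longrightarrow> b \<in> P x2 \<Longrightarrow> y \<noteq> a + b"
    and t: "t1 \<in> P x1" "t2 \<in> P x2" "t1 + t2 \<in> P (x1 + x2)"
    and w: "w \<in> P y" "t1 + t2 + w \<in> P (x1 + x2 + y)"
  shows "t2 + w \<in> P (x2 + y)"
proof -
  have x20: "x2 \<noteq> 0" using x2 subspace_0[OF subspace_polar] by auto
  have x12: "x1 \<notin> P x2" using x2 polar_sym by blast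
  have y1: "y \<notin> P x1" using y[of y 0] subspace_0[OF subspace_polar] by auto
  have y2: "y \<notin> P x2" using y[of 0 y] subspace_0[OF subspace_polar] by auto
  have y0: "y \<noteq> 0" using y2 subspace_0[OF subspace_polar] by auto
  have x2y: "x2 + y \<notin> P x1"
    using y[of "x2 + y" "- x2"] subspace_neg[OF subspace_polar polar_self, of x2] by auto
  obtain d where d: "d \<in> P (x2 + y)" "t1 + d \<in> P (x1 + (x2 + y))" by (rule polar_transport[OF x1 x2y t(1)])
  obtain b2 b3 where b: "b2 \<in> P x2" "b3 \<in> P y" "d = b2 + b3" by (rule polar_sum_generic[OF x20 y2 d(1)])
  \<comment> \<open>Transporting t1 directly to x2 + y gives b2 + b3, the other route gives t2 + w.
    The difference q lies in P (x1 + x2 + y) and in P x2 + P y.\<close>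
  define q where "q = (t2 - b2) + (w - b3)"
  have q: "q = (t1 + t2 + w) - (t1 + d)" unfolding q_def b(3) by simp
  have qP: "q \<in> P (x1 + x2 + y)"
    unfolding q using w(2) d(2)[folded add.assoc] by (rule subspace_diff[OF subspace_polar])
  have qm: "t2 - b2 \<in> P x2" "w - b3 \<in> P y" using t b w by (simp_all add: subspace_diff)
  \<comment> \<open>A nonzero q would put x1 + x2 + y, hence x1, into P x2 + P y. Then x1 minus an
    element of P x2 is a nonzero vector of P y, so y lies in P x1 + P x2, which is excluded.\<close>
  have "q = 0"
  proof (rule ccontr)
    assume q0: "q \<noteq> 0"
    have "x1 + x2 + y \<noteq> 0"
    proof
      assume "x1 + x2 + y = 0"
      then have "y = (- x1) + (- x2)" by (simp add: add_eq_0_iff)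
      then show False using y subspace_neg[OF subspace_polar polar_self] by blast
    qed
    then have "x1 + x2 + y \<in> P q" using polar_eq_3[OF _ qP q0] polar_self by simp
    then obtain a' b' where ab': "a' \<in> P x2" "b' \<in> P y" "x1 + x2 + y = a' + b'"
      using polar_sum[OF x20 y2 qm] q0 unfolding q_def by metis
    define p2 where "p2 = a' - x2"
    define p3 where "p3 = b' - y"
    have h: "p2 \<in> P x2" "p3 \<in> P y" "x1 = p2 + p3"
      unfolding p2_def p3_def using ab' polar_self by (auto simp: algebra_simps subspace_diff)
    have p30: "p3 \<noteq> 0" using h x12 by auto
    have "x1 + (- p2) = p3" using h(3) by simp
    then have "y \<in> P (x1 + (- p2))" using polar_eq_3[OF y0 h(2) p30] polar_self by simp
    moreover have "x1 + (- p2) \<noteq> 0" using h(3) p30 by simp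
    moreover have "- p2 \<in> P x2" using h by (simp add: subspace_neg)
    ultimately obtain a b where "a \<in> P x1" "b \<in> P x2" "y = a + b"
      using polar_sum[OF x1 x2 polar_self] by metis
    then show False using y by blast
  qed
  then have e: "t2 - b2 = b3 - w" unfolding q_def by (simp add: algebra_simps)
  then have "t2 - b2 \<in> P y" using b w by (simp add: subspace_diff)
  then have "t2 - b2 = 0" using polar_disjoint_3[OF x20 y2 qm(1)] by blast
  then have "d = t2 + w" using e b(3) by simp
  then show ?thesis using d(1) by simp
qed

end

section \<open>Construction of a non-scalar linear map with a x in P x\<close>

theorem exists_polar_endo_3:
  assumes n3: "n \<ge> 3"
  obtains a where "lin a" "\<And>x. a x \<in> polar S x" "\<And>r. \<exists>x. a x \<noteq> r *s x"
proof -
  let ?L = "polar S"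
  obtain x1 :: 'v where x1: "x1 \<noteq> 0" by (rule exists_nonzero)
  obtain t1 where t1: "t1 \<in> ?L x1" "s x1 t1 = 1" by (rule exists_polar_dual[OF x1])
  have "?L x1 \<noteq> UNIV" using dim_polar[OF x1] dimV n2 by auto
  then obtain x2 where x2: "x2 \<notin> ?L x1" by blast
  then have x20: "x2 \<noteq> 0" using subspace_0[OF subspace_polar] by auto
  have x12: "x1 \<notin> ?L x2" using x2 polar_sym by blast
  obtain t2 where t2: "t2 \<in> ?L x2" "t1 + t2 \<in> ?L (x1 + x2)" by (rule polar_transport[OF n3 x1 x2 t1(1)])
  obtain r2 where r2: "r2 \<in> ?L x2" "s x2 r2 = 1" by (rule exists_polar_dual[OF x20])
  define W where "W = {a + b |a b. a \<in> ?L x1 \<and> b \<in> ?L x2}"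
  have sW: "subspace W" unfolding W_def by (rule subspace_sums) simp_all
  have "W \<subseteq> span {x1,t1,x2,r2}"
  proof -
    have "?L x1 = span {x1,t1}" "?L x2 = span {x2,r2}"
      using polar_eq_span[OF x1 t1(1) dual_notin_span[OF t1(2)]]
        polar_eq_span[OF x20 r2(1) dual_notin_span[OF r2(2)]] by simp_all
    then have "?L x1 \<subseteq> span {x1,t1,x2,r2}" "?L x2 \<subseteq> span {x1,t1,x2,r2}"
      using span_mono[of "{x1,t1}" "{x1,t1,x2,r2}"] span_mono[of "{x2,r2}" "{x1,t1,x2,r2}"] by auto
    then show ?thesis unfolding W_def by (auto intro: span_add)
  qed
  then have "dim W \<le> card {x1,t1,x2,r2}" by (rule dim_le_card) simp
  also have "\<dots> \<le> 4" by (simp add: card_insert_if)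
  finally have "W \<noteq> UNIV" using dimV n3 by auto
  then obtain y' where y': "y' \<notin> W" by blast
  \<comment> \<open>By \<open>transport_bilinear\<close> these equations hold when w is the
    transport of both t1 and t2 to y. They are linear in the pair (y, w), and two base vectors make
    w unique because P x1 and P x2 meet in 0.\<close>
  define R where "R y w \<longleftrightarrow> (\<forall>u\<in>S. s w (u x1) = - s t1 (u y) \<and> s w (u x2) = - s t2 (u y))" for y w
  have Runique: "w = w'" if "R y w" "R y w'" for y w w'
  proof -
    have "w - w' \<in> ?L x1" "w - w' \<in> ?L x2" using that unfolding R_def polar_def by auto
    then have "w - w' = 0" using polar_disjoint_3[OF n3 x1 x2] by blast
    then show ?thesis by simp
  qed
  have Radd: "R (y + z) (w + v)" if "R y w" "R z v" for y z w v
    using that unfolding R_def by (simp add: lin_simps[OF ts_lin[OF triv]])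
  have Rdiff: "R (y - z) (w - v)" if "R y w" "R z v" for y z w v
    using that unfolding R_def by (simp add: lin_simps[OF ts_lin[OF triv]])
  have Rscale: "R (r *s y) (r *s w)" if "R y w" for r y w
    using that unfolding R_def by (simp add: lin_simps[OF ts_lin[OF triv]])
  have x12s: "x1 + x2 \<noteq> 0"
  proof
    assume "x1 + x2 = 0"
    then have "x2 = - x1" by (simp add: add_eq_0_iff)
    then show False using x2 subspace_neg[OF subspace_polar polar_self] by blast
  qed
  \<comment> \<open>w is the transport of t1 + t2 from the third base point x1 + x2;
    \<open>transport_compatible\<close> shows that it is the transport from x1 and from x2 as
    well.\<close>
  have gen: "\<exists>w\<in>?L y. R y w" if y: "y \<notin> W" for y
  proof -
    have y1: "y \<noteq> a + b" if "a \<in> ?L x1" "b \<in> ?L x2" for a b using y that unfolding W_def by blast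
    have y2: "y \<noteq> a + b" if "a \<in> ?L x2" "b \<in> ?L x1" for a b using y1[OF that(2,1)] by (simp add: add.commute)
    have "y \<notin> ?L (x1 + x2)"
    proof
      assume "y \<in> ?L (x1 + x2)"
      then obtain a b where "a \<in> ?L x1" "b \<in> ?L x2" "y = a + b" by (rule polar_sum_generic[OF n3 x1 x2])
      then show False using y1 by blast
    qed
    then obtain w where w: "w \<in> ?L y" "t1 + t2 + w \<in> ?L (x1 + x2 + y)"
      by (rule polar_transport[OF n3 x12s _ t2(2)])
    have 2: "t2 + w \<in> ?L (x2 + y)"
      by (rule transport_compatible[OF n3 x1 x2 y1 t1(1) t2 w])
    have 1: "t1 + w \<in> ?L (x1 + y)"
    proof (rule transport_compatible[OF n3 x20 x12 y2 t2(1) t1(1) _ w(1)])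
      show "t2 + t1 \<in> ?L (x2 + x1)" using t2(2) by (simp add: add.commute)
      show "t2 + t1 + w \<in> ?L (x2 + x1 + y)" using w(2) by (simp add: add.commute)
    qed
    have "R y w" unfolding R_def
      using transport_bilinear[OF n3 t1(1) w(1) 1] transport_bilinear[OF n3 t2(1) w(1) 2] by blast
    then show ?thesis using w(1) by blast
  qed
  have shift: "y' + r *s y \<notin> W" if "y \<in> W" for y r
  proof
    assume "y' + r *s y \<in> W"
    then have "(y' + r *s y) - r *s y \<in> W" using that sW by (intro subspace_diff subspace_scale)
    then show False using y' by simp
  qed
  \<comment> \<open>A vector of W is a difference of two vectors outside W, so linearity of R covers
    it.\<close>
  have Rex: "\<exists>w. R y w" for y
  proof (cases "y \<in> W")
    case True
    then obtain w v where "R (y' + 1 *s y) w" "R y' v" using gen[OF shift] gen[OF y'] by blast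
    then have "R ((y' + 1 *s y) - y') (w - v)" by (rule Rdiff)
    then show ?thesis by auto
  qed (use gen in blast)
  then obtain a where a: "\<And>y. R y (a y)" by metis
  have la: "lin a"
    unfolding lin_iff using Runique[OF a Radd[OF a a]] Runique[OF a Rscale[OF a]] by blast
  have aL: "a y \<in> ?L y" if "y \<notin> W" for y using gen[OF that] Runique[OF a] by blast
  note al = lin_simps[OF la]
  \<comment> \<open>The line y' + r y avoids W, so a quadratic polynomial in r vanishes along it.
    Its constant term is 0, and two distinct nonzero r force the leading coefficient s (a y) (u y)
    to be 0.\<close>
  have aW: "s (a y) (u y) = 0" if y: "y \<in> W" and u: "u \<in> S" for y u
  proof -
    note ul = lin_simps[OF ts_lin[OF triv u]]
    let ?q = "s (a y) (u y)" and ?l = "s (a y') (u y) + s (a y) (u y')"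
    have "s (a (y' + r *s y)) (u (y' + r *s y)) = s (a y') (u y') + r * (?l + r * ?q)" for r
      by (simp add: al ul algebra_simps)
    moreover have "s (a (y' + r *s y)) (u (y' + r *s y)) = 0" for r by (rule polarD[OF aL[OF shift[OF y]] u])
    moreover have "s (a y') (u y') = 0" by (rule polarD[OF aL[OF y'] u])
    ultimately have e: "r * (?l + r * ?q) = 0" for r by simp
    have "infinite (UNIV :: 'f set) \<or> card (UNIV :: 'f set) > 2" using big n3 by auto
    from exists_finite_subset_avoiding[OF this, of 0]
    obtain I :: "'f set" where I: "card I = 2" "0 \<notin> I" by blast
    then obtain r r' where "I = {r,r'}" "r \<noteq> r'" unfolding card_2_iff by blast
    then have r: "r \<noteq> r'" "r \<noteq> 0" "r' \<noteq> 0" using I(2) by auto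
    have z: "?l + r * ?q = 0" "?l + r' * ?q = 0" using e[of r] e[of r'] r by simp_all
    have "(r - r') * ?q = (?l + r * ?q) - (?l + r' * ?q)" by (simp add: left_diff_distrib)
    then have "(r - r') * ?q = 0" unfolding z by simp
    then show ?thesis using r(1) by simp
  qed
  have "R x1 t1" unfolding R_def
    using polarD[OF t1(1)] transport_bilinear[OF n3 t1(1) t2] by (auto simp: minus_equation_iff)
  then have ax1: "a x1 = t1" using Runique[OF a] by blast
  show ?thesis
  proof (rule that[OF la])
    show "a y \<in> ?L y" for y using aL[of y] aW[of y] unfolding polar_def by blast
    show "\<exists>x. a x \<noteq> r *s x" for r
      using ax1 t1(2) by (intro exI[of _ x1]) auto
  qed
qed

text \<open>Annihilators have dimension (n - 1)(n - 2) = 0, so S is a plane whose nonzero elements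
  are invertible. For a basis u1, u2 the relation u1 (a x) = u2 x turns both orthogonality
  conditions into alternation of u1 or u2. The planes P x = span {x, a x} are stable under a, whence
  the spread property.\<close>

theorem exists_polar_endo_2:
  assumes n: "n = 2"
  obtains a where "lin a" "\<And>x. a x \<in> polar S x" "\<And>r. \<exists>x. a x \<noteq> r *s x"
    and "\<And>x z. x \<noteq> 0 \<Longrightarrow> z \<in> polar S x \<Longrightarrow> z \<noteq> 0 \<Longrightarrow> polar S z = polar S x"
proof -
  let ?L = "polar S"
  have "fs.dim S = 2" using S n unfolding optimal_space_def by simp
  then obtain B where B: "B \<subseteq> S" "fs.independent B" "S \<subseteq> fs.span B" "card B = 2"
    by (metis fs.basis_exists)
  obtain u1 u2 where u: "B = {u1,u2}" "u1 \<noteq> u2" using B(4) by (metis card_2_iff)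
  have uS: "u1 \<in> S" "u2 \<in> S" using u B by auto
  have inj: "x = 0" if "u \<in> S" "u \<noteq> 0" "u x = 0" for u x
  proof (rule ccontr)
    assume x: "x \<noteq> 0"
    have "{u\<in>S. u x = 0} = {0}"
    proof (rule fs.finitely_spanned_dim_0)
      show "finitely_spanned (fscale scale) {u\<in>S. u x = 0}"
        by (rule fs.finitely_spanned_mono[OF ts_finite[OF triv]]) blast
      show "fs.subspace {u\<in>S. u x = 0}" by (rule subspace_annihilator[OF ts_fs[OF triv]])
      show "fs.dim {u\<in>S. u x = 0} = 0" using dim_annihilator[OF x] n by simp
    qed
    then show False using that by blast
  qed
  have u10: "u1 \<noteq> 0" using B(2) fs.dependent_zero u(1) by blast
  have ind: "u2 - fscale scale r u1 \<noteq> 0" for r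
  proof
    assume "u2 - fscale scale r u1 = 0"
    then have "u2 = fscale scale r u1" by simp
    then have "u2 \<in> fs.span {u1}" using fs.span_base[of u1 "{u1}"] fs.span_scale by blast
    moreover have "B - {u2} = {u1}" using u by blast
    ultimately show False using B(2) u(1) fs.dependent_def by (metis insertCI)
  qed
  interpret u1: Vector_Spaces.linear scale scale u1 by (rule ts_lin[OF triv uS(1)])
  have "inj u1" unfolding u1.inj_iff_eq_0 using inj[OF uS(1) u10] by blast
  then have "surj u1" by (rule linear_inj_imp_surj[OF ts_lin[OF triv uS(1)]])
  then have "\<exists>y. u1 y = u2 x" for x unfolding surj_def by metis
  then obtain a where a: "\<And>x. u1 (a x) = u2 x" by metis
  note u2l = lin_simps[OF ts_lin[OF triv uS(2)]]
  have la: "lin a"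
    unfolding lin_iff using injD[OF \<open>inj u1\<close>] by (metis a u1.add u1.scale u2l(1,2))
  have rep: "\<exists>r q. v = fscale scale r u1 + fscale scale q u2" if "v \<in> S" for v
  proof -
    have "v \<in> fs.span {u1,u2}" using that B(3) u(1) by blast
    then obtain r where "v - fscale scale r u1 \<in> fs.span {u2}" using fs.span_breakdown_eq by blast
    then obtain q where "v - fscale scale r u1 = fscale scale q u2" unfolding fs.span_singleton by blast
    then have "v = fscale scale r u1 + fscale scale q u2" by (simp add: algebra_simps)
    then show ?thesis by blast
  qed
  have Lmem: "z \<in> ?L x" if "s z (u1 x) = 0" "s z (u2 x) = 0" for z x
    unfolding polar_def using rep that by (force simp: fscale_apply)
  have ax: "a x \<in> ?L x" for x
  proof (rule Lmem)
    show "s (a x) (u1 x) = 0"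
      using ts_adj[OF triv uS(1), of "a x" x] ts_self[OF triv uS(2), of x] s_skew0 a by metis
    show "s (a x) (u2 x) = 0" using ts_self[OF triv uS(1), of "a x"] a by simp
  qed
  have nscalar: "a x \<notin> span {x}" if "x \<noteq> 0" for x
  proof
    assume "a x \<in> span {x}"
    then obtain r where "a x = r *s x" unfolding span_singleton by blast
    then have "(u2 - fscale scale r u1) x = 0" using a[of x] u1.scale by (simp add: fscale_apply)
    moreover have "u2 - fscale scale r u1 \<in> S" using uS ts_diff[OF triv] ts_scale[OF triv] by blast
    ultimately show False using inj ind that by blast
  qed
  have aa: "a (a x) \<in> ?L x" for x
  proof (rule Lmem)
    have "s (a (a x)) (u1 x) = s (u2 (a x)) x" using ts_adj[OF triv uS(1), of "a (a x)" x] a by simp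
    also have "\<dots> = 0" using ts_adj[OF triv uS(2), of "a x" x] polarD[OF ax uS(2)] by simp
    finally show "s (a (a x)) (u1 x) = 0" .
    have "s (a (a x)) (u2 x) = s (a (a x)) (u1 (a x))" using a by simp
    also have "\<dots> = 0" by (rule polarD[OF ax uS(1)])
    finally show "s (a (a x)) (u2 x) = 0" .
  qed
  have sub: "?L z \<subseteq> ?L x" if x: "x \<noteq> 0" and z: "z \<in> ?L x" "z \<noteq> 0" for x z
  proof -
    obtain r q where "z = r *s x + q *s a x" by (rule polar_rep[OF x ax nscalar[OF x] z(1)])
    then have "a z = r *s a x + q *s a (a x)" by (simp add: lin_simps[OF la])
    then have "a z \<in> ?L x" using ax aa by (simp add: subspace_add subspace_scale)
    then show ?thesis
      unfolding polar_eq_span[OF z(2) ax nscalar[OF z(2)]] using z(1) by (intro span_minimal) auto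
  qed
  obtain x1 :: 'v where x1: "x1 \<noteq> 0" by (rule exists_nonzero)
  show ?thesis
  proof (rule that[OF la ax])
    show "\<exists>x. a x \<noteq> r *s x" for r
      using nscalar[OF x1] unfolding span_singleton by (intro exI[of _ x1]) blast
    show "?L z = ?L x" if "x \<noteq> 0" "z \<in> ?L x" "z \<noteq> 0" for x z
      using sub[OF that] sub[OF that(3) polar_sym[OF that(2)] that(1)] by blast
  qed
qed

theorem exists_polar_endo:
  obtains a where "lin a" "\<And>x. a x \<in> polar S x" "\<And>r. \<exists>x. a x \<noteq> r *s x"
  using exists_polar_endo_2 exists_polar_endo_3 n2 by (metis One_nat_def Suc_1 le_eq_less_or_eq Suc_leI numeral_3_eq_3)

theorem polar_eq:
  assumes "x \<noteq> 0" "z \<in> polar S x" "z \<noteq> 0"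
  shows "polar S z = polar S x"
proof (cases "n = 2")
  case True
  show ?thesis by (rule exists_polar_endo_2[OF True]) (use assms in blast)
next
  case False
  then have "n \<ge> 3" using n2 by simp
  then show ?thesis using polar_eq_3[OF _ assms] by blast
qed

subsection \<open>The quadratic extension\<close>

lemma polar_disjoint:
  assumes "x \<noteq> 0" "y \<notin> polar S x" "w \<in> polar S x" "w \<in> polar S y"
  shows "w = 0"
proof (rule ccontr)
  assume w: "w \<noteq> 0"
  have "y \<noteq> 0" using assms(2) subspace_0[OF subspace_polar] by auto
  then have "polar S x = polar S y" using polar_eq[OF assms(1,3) w] polar_eq[OF _ assms(4) w] by simp
  then show False using assms(2) polar_self by blast
qed

text \<open>Polarising s (a w) (u w) = 0 with y puts a w into P y, and it lies in P w as well. These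
  planes meet in 0 for w outside P y, and such w span V. Hence maps of this kind are determined by
  their value at one nonzero vector.\<close>

lemma polar_endo_zero:
  assumes a: "lin a" "\<And>x. a x \<in> polar S x" and y: "a y = 0" "y \<noteq> 0"
  shows "a w = 0"
proof -
  have inP: "a w \<in> polar S y" for w
    unfolding polar_def
  proof (intro CollectI ballI)
    fix u assume u: "u \<in> S"
    have "s (a (w + y)) (u (w + y)) = 0" "s (a w) (u w) = 0" using polarD[OF a(2) u] by blast+
    then show "s (a w) (u y) = 0" using y(1) by (simp add: lin_simps[OF a(1)] lin_simps[OF ts_lin[OF triv u]])
  qed
  have z: "a w = 0" if "w \<notin> polar S y" for w
    using polar_disjoint[OF y(2) that inP a(2)] .
  show ?thesis
  proof (cases "w \<in> polar S y")
    case True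
    have "polar S y \<noteq> UNIV" using dim_polar[OF y(2)] dimV n2 by auto
    then obtain v where v: "v \<notin> polar S y" by blast
    have "w + v \<notin> polar S y" using subspace_diff[OF subspace_polar _ True, of "w + v"] v by auto
    then have "a (w + v) - a v = 0" using z v by simp
    then show ?thesis by (simp add: lin_simps[OF a(1)])
  qed (rule z)
qed

text \<open>The maps d with d x in P x are combinations of the identity and a, as can be read off at
  x0; the square of a is among them because P (a w) = P w when a w is nonzero. Taking adjoints turns
  s (d x) (u x) = 0 into the condition that defines \<open>multipliers\<close>.\<close>

lemma multipliers_structure:
  obtains b e f where "lin b" "\<And>y. b (b y) = e *s y + f *s b y"
    "multipliers S = {lincomb b p q |p q. True}" "nonisotropic (twist s b)"
proof -
  obtain a where a: "lin a" "\<And>x. a x \<in> polar S x" "\<And>r. \<exists>x. a x \<noteq> r *s x"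
    using exists_polar_endo by blast
  note al = lin_simps[OF a(1)]
  have nsp: "a x \<notin> span {x}" if x: "x \<noteq> 0" for x
  proof
    assume "a x \<in> span {x}"
    then obtain r where r: "a x = r *s x" unfolding span_singleton by blast
    let ?d = "\<lambda>w. a w - r *s w"
    have "?d w = 0" for w
    proof (rule polar_endo_zero[of ?d x])
      show "lin ?d" by (auto simp: lin_iff al algebra_simps scale_right_distrib scale_right_diff_distrib)
      show "?d w \<in> polar S w" for w using a(2) polar_self by (intro subspace_diff subspace_scale) auto
    qed (use r x in auto)
    then show False using a(3)[of r] by auto
  qed
  obtain x0 :: 'v where x0: "x0 \<noteq> 0" by (rule exists_nonzero)
  have rep: "\<exists>p q. \<forall>w. d w = p *s w + q *s a w" if d: "lin d" "\<And>x. d x \<in> polar S x" for d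
  proof -
    obtain p q where ab: "d x0 = p *s x0 + q *s a x0" by (rule polar_rep[OF x0 a(2) nsp[OF x0] d(2)])
    let ?d = "\<lambda>w. d w - (p *s w + q *s a w)"
    have "?d w = 0" for w
    proof (rule polar_endo_zero[of ?d x0])
      show "lin ?d" by (auto simp: lin_iff al lin_simps[OF d(1)] algebra_simps scale_right_distrib
          scale_right_diff_distrib)
      show "?d w \<in> polar S w" for w
        by (intro subspace_diff[OF subspace_polar d(2)] subspace_add[OF subspace_polar]
            subspace_scale[OF subspace_polar] polar_self a(2))
    qed (use ab x0 in auto)
    then have "\<forall>w. d w = p *s w + q *s a w" by simp
    then show ?thesis by blast
  qed
  have aa: "a (a w) \<in> polar S w" for w
  proof (cases "a w = 0")
    case True
    then show ?thesis using subspace_0[OF subspace_polar] by (simp add: al)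
  next
    case False
    then have "w \<noteq> 0" using al(3) by auto
    then show ?thesis using polar_eq[OF _ a(2) False] a(2)[of "a w"] by simp
  qed
  have "lin (\<lambda>w. a (a w))" by (auto simp: lin_iff al)
  from rep[OF this aa] obtain e f where ef: "\<And>w. a (a w) = e *s w + f *s a w" by blast
  obtain b where b: "lin b" "\<And>x y. s (a x) y = s x (b y)" using exists_adjoint[OF a(1)] by blast
  show ?thesis
  proof (rule that[OF b(1)])
    show "b (b y) = e *s y + f *s b y" for y
      by (rule s_right_eqI) (simp add: b(2)[symmetric] ef)
    show "nonisotropic (twist s b)"
      unfolding nonisotropic_def twist_def
    proof (intro allI impI)
      fix x :: 'v assume x: "x \<noteq> 0"
      have "s (a x) x \<noteq> 0" using polar_isotropic[OF a(2) _ x] nsp[OF x] by blast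
      then show "s x (b x) \<noteq> 0" using b(2) by simp
    qed
    show "multipliers S = {lincomb b p q |p q. True}"
    proof
      show "{lincomb b p q |p q. True} \<subseteq> multipliers S"
      proof
        fix l assume "l \<in> {lincomb b p q |p q. True}"
        then obtain p q where l: "l = lincomb b p q" by blast
        have "s x (l (u x)) = 0" if "u \<in> S" for u x
          unfolding l lincomb_def using ts_self[OF triv that] polarD[OF a(2) that] by (simp add: b(2)[symmetric])
        moreover have "lin l" unfolding l lincomb_def
          by (auto simp: lin_iff lin_simps[OF b(1)] algebra_simps scale_right_distrib)
        ultimately show "l \<in> multipliers S" unfolding multipliers_def Endo_def by blast
      qed
      show "multipliers S \<subseteq> {lincomb b p q |p q. True}"
      proof
        fix l assume "l \<in> multipliers S"
        then have l: "lin l" "\<And>u x. u \<in> S \<Longrightarrow> s x (l (u x)) = 0" unfolding multipliers_def Endo_def by auto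
        obtain d where d: "lin d" "\<And>x y. s (l x) y = s x (d y)" using exists_adjoint[OF l(1)] by blast
        have ds: "s (d x) y = s x (l y)" for x y using d(2)[of y x] s_skew[of y "d x"] s_skew[of "l y" x] by simp
        have "d x \<in> polar S x" for x unfolding polar_def using l(2) ds by simp
        from rep[OF d(1) this] obtain p q where ab: "\<And>w. d w = p *s w + q *s a w" by blast
        have "l y = lincomb b p q y" for y unfolding lincomb_def
          by (rule s_right_eqI) (simp add: ds[symmetric] ab b(2))
        then have "l = lincomb b p q" by (simp add: fun_eq_iff)
        then show "l \<in> {lincomb b p q |p q. True}" by blast
      qed
    qed
  qed
qed

theorem corresponding_multipliers: "corresponding_extension scale s S (multipliers S)"
proof -
  obtain b e f where b: "lin b" "\<And>y. b (b y) = e *s y + f *s b y"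
    and M: "multipliers S = {lincomb b p q |p q. True}" and aniso: "nonisotropic (twist s b)"
    using multipliers_structure by blast
  note bl = lin_simps[OF b(1)]
  have bx: "s x (b x) \<noteq> 0" if "x \<noteq> 0" for x using aniso that unfolding nonisotropic_def twist_def by blast
  have mem: "lincomb b p q \<in> multipliers S" for p q unfolding M by blast
  have idM: "id = lincomb b 1 0" and bM: "b = lincomb b 0 1" by (simp_all add: lincomb_def fun_eq_iff)
  have comp: "lincomb b p q \<circ> lincomb b p' q' = lincomb b (p * p' + q * q' * e) (p * q' + q * p' + q * q' * f)"
    for p q p' q'
    by (simp add: lincomb_def fun_eq_iff bl b(2) scale_right_distrib scale_left_distrib algebra_simps)
  obtain x0 :: 'v where x0: "x0 \<noteq> 0" by (rule exists_nonzero)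
  have inj: "x = 0" if "lincomb b p q x = 0" "p \<noteq> 0 \<or> q \<noteq> 0" for p q x
  proof (rule ccontr)
    assume x: "x \<noteq> 0"
    have "s x (lincomb b p q x) = q * s x (b x)" by (simp add: lincomb_def)
    then have "q = 0" using that(1) bx[OF x] by simp
    then show False using that x by (simp add: lincomb_def)
  qed
  have sub: "fs.subspace (multipliers S)"
  proof (rule fs.subspaceI)
    have "0 = lincomb b 0 0" by (simp add: lincomb_def fun_eq_iff)
    then show "0 \<in> multipliers S" using mem by metis
  next
    fix l m assume "l \<in> multipliers S" "m \<in> multipliers S"
    then obtain p q p' q' where "l = lincomb b p q" "m = lincomb b p' q'" unfolding M by blast
    then have "l + m = lincomb b (p + p') (q + q')"
      by (simp add: lincomb_def fun_eq_iff scale_left_distrib algebra_simps)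
    then show "l + m \<in> multipliers S" using mem by metis
  next
    fix r l assume "l \<in> multipliers S"
    then obtain p q where "l = lincomb b p q" unfolding M by blast
    then have "fscale scale r l = lincomb b (r * p) (r * q)"
      by (simp add: lincomb_def fun_eq_iff fscale_apply scale_right_distrib)
    then show "fscale scale r l \<in> multipliers S" using mem by metis
  qed
  have ME: "multipliers S \<subseteq> Endo scale" unfolding multipliers_def by blast
  have unital: "unital_subalgebra scale (multipliers S)"
    unfolding unital_subalgebra_def endo_subspace_def
  proof (intro conjI ballI)
    show "id \<in> multipliers S" using idM mem by metis
    fix l m assume "l \<in> multipliers S" "m \<in> multipliers S"
    then obtain p q p' q' where "l = lincomb b p q" "m = lincomb b p' q'" unfolding M by blast
    then show "l \<circ> m \<in> multipliers S" using comp mem by metis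
  qed (rule ME sub)+
  have span: "multipliers S = fs.span {id, b}"
  proof
    show "fs.span {id, b} \<subseteq> multipliers S"
      by (rule fs.span_minimal[OF _ sub]) (use idM bM mem in \<open>metis empty_subsetI insert_subset\<close>)
    show "multipliers S \<subseteq> fs.span {id, b}"
    proof
      fix l assume "l \<in> multipliers S"
      then obtain p q where "l = lincomb b p q" unfolding M by blast
      then have "l = fscale scale p id + fscale scale q b" by (simp add: lincomb_def fun_eq_iff fscale_apply)
      moreover have "fscale scale p id \<in> fs.span {id, b}" "fscale scale q b \<in> fs.span {id, b}"
        by (intro fs.span_scale fs.span_base; blast)+
      ultimately show "l \<in> fs.span {id, b}" using fs.span_add by blast
    qed
  qed
  have dim2: "fs.dim (multipliers S) = 2"
  proof -
    have id0: "(id :: 'v \<Rightarrow> 'v) \<noteq> 0" using x0 by (auto simp: fun_eq_iff)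
    have bid: "b \<notin> fs.span {id}"
    proof
      assume "b \<in> fs.span {id}"
      then obtain r where "b = fscale scale r id" unfolding fs.span_singleton by blast
      then have "s x0 (b x0) = 0" by (simp add: fscale_apply)
      then show False using bx[OF x0] by blast
    qed
    have "fs.independent {id}" using id0 unfolding fs.dependent_single .
    then have "fs.independent {b, id}" by (rule fs.independent_insertI[OF bid])
    moreover have "b \<noteq> id" using bid fs.span_base[of id "{id}"] by blast
    ultimately show ?thesis unfolding span using fs.dim_span_eq_card_independent[of "{id, b}"]
      by (simp add: insert_commute)
  qed
  have quad: "quadratic_extension scale (multipliers S)"
    unfolding quadratic_extension_def
  proof (intro conjI ballI impI)
    show "unital_subalgebra scale (multipliers S)" by (rule unital)
    show "fs.dim (multipliers S) = 2" by (rule dim2)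
    show "(id :: 'v \<Rightarrow> 'v) \<noteq> 0" using x0 by (auto simp: fun_eq_iff)
  next
    fix l m assume "l \<in> multipliers S" "m \<in> multipliers S"
    then obtain p q p' q' where "l = lincomb b p q" "m = lincomb b p' q'" unfolding M by blast
    then show "l \<circ> m = m \<circ> l" by (simp add: comp algebra_simps)
  next
    fix l assume "l \<in> multipliers S" and l0: "l \<noteq> 0"
    then obtain p q where l: "l = lincomb b p q" unfolding M by blast
    have nz: "p \<noteq> 0 \<or> q \<noteq> 0" using l0 l by (auto simp: lincomb_def fun_eq_iff)
    \<comment> \<open>Since b^2 = e + f b, the conjugate of b is f - b; so N is the norm of l = p +
      q b, the product of l and p + q f - q b.\<close>
    define N where "N = p * (p + q * f) - q * q * e"
    have lm: "l \<circ> lincomb b (r * (p + q * f)) (- (r * q)) = lincomb b (r * N) 0" for r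
      unfolding l comp N_def by (simp add: algebra_simps)
    have "N \<noteq> 0"
    proof
      assume "N = 0"
      then have "l \<circ> lincomb b (p + q * f) (- q) = lincomb b 0 0" using lm[of 1] by simp
      then have "l (lincomb b (p + q * f) (- q) x0) = lincomb b 0 0 x0" by (simp add: fun_eq_iff)
      then have "l (lincomb b (p + q * f) (- q) x0) = 0" by (simp add: lincomb_def)
      then have "lincomb b (p + q * f) (- q) x0 = 0" unfolding l using inj nz by blast
      then have "q = 0 \<and> p + q * f = 0" using inj x0 by (metis neg_equal_0_iff_equal)
      then show False using nz by auto
    qed
    then have "l \<circ> lincomb b (1 / N * (p + q * f)) (- (1 / N * q)) = id" using lm[of "1 / N"] idM by simp
    then show "\<exists>m\<in>multipliers S. l \<circ> m = id" using mem by blast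
  qed
  have gen: "multipliers S = gen_subalgebra scale b"
  proof
    have bin: "b \<in> multipliers S" using bM mem by metis
    show "gen_subalgebra scale b \<subseteq> multipliers S"
      unfolding gen_subalgebra_def by (rule hull_minimal) (use bin unital in auto)
    show "multipliers S \<subseteq> gen_subalgebra scale b"
      unfolding gen_subalgebra_def hull_def
    proof (rule Inter_greatest)
      fix t assume "t \<in> {t. unital_subalgebra scale t \<and> {b} \<subseteq> t}"
      then have "{id, b} \<subseteq> t" "fs.subspace t" unfolding unital_subalgebra_def endo_subspace_def by auto
      then show "multipliers S \<subseteq> t" unfolding span by (rule fs.span_minimal)
    qed
  qed
  have Sm: "S \<subseteq> alt_endo scale (twist s l)" if "l \<in> multipliers S" for l
    using that ts_lin[OF triv] unfolding multipliers_def alt_endo_def twist_def Endo_def by auto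
  let ?T = "alt_endo scale s \<inter> alt_endo scale (twist s b)"
  \<comment> \<open>The right-hand side has trivial spectrum, because u x = x would give s x (b x) =
    0. It contains S, so the dimension bound forces equality.\<close>
  have ST: "S = ?T"
  proof (rule fs.finitely_spanned_dim_eq)
    show "finitely_spanned (fscale scale) ?T" by (rule finitely_spanned_Endo) (use alt_endo_Endo in blast)
    have "b \<in> multipliers S" using bM mem by metis
    then show "S \<subseteq> ?T" using Sm ts_alt[OF triv] by blast
    show "fs.subspace S" by (rule ts_fs[OF triv])
    have sT: "fs.subspace ?T"
    proof (rule fs.subspace_inter[OF subspace_alt_endo], rule fs.subspaceI)
      show "0 \<in> alt_endo scale (twist s b)"
        by (auto simp: alt_endo_def Endo_def lin_iff twist_def bl)
      show "u + v \<in> alt_endo scale (twist s b)"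
        if "u \<in> alt_endo scale (twist s b)" "v \<in> alt_endo scale (twist s b)" for u v
        using that by (auto simp: alt_endo_def Endo_def lin_iff twist_def bl algebra_simps scale_right_distrib)
      show "fscale scale r u \<in> alt_endo scale (twist s b)" if "u \<in> alt_endo scale (twist s b)" for u r
        using that by (auto simp: alt_endo_def Endo_def lin_iff twist_def bl fscale_apply scale_right_distrib
            algebra_simps)
    qed
    have "x = 0" if "u \<in> ?T" "u x = x" for u x
    proof (rule ccontr)
      assume "x \<noteq> 0"
      moreover have "s x (b (u x)) = 0" using that(1) by (simp add: alt_endo_def twist_def)
      ultimately show False using bx that(2) by simp
    qed
    then have tT: "trivial_space UNIV ?T" unfolding trivial_space_def using sT regular_UNIV by blast
    have "infinite (UNIV :: 'f set) \<or> card (UNIV :: 'f set) > n" using S unfolding optimal_space_def by blast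
    then have "fs.dim ?T \<le> n * (n - 1)" by (rule dim_trivial_space_le[OF tT dimV])
    then show "fs.dim ?T \<le> fs.dim S" using S unfolding optimal_space_def by simp
  qed
  have "twist s id = s" by (simp add: twist_def fun_eq_iff)
  then have "(\<Inter>l\<in>multipliers S. alt_endo scale (twist s l)) \<subseteq> ?T"
    using idM bM mem by (metis (no_types, lifting) INT_lower Int_subset_iff)
  then have inter: "S = (\<Inter>l\<in>multipliers S. alt_endo scale (twist s l))" using Sm ST by blast
  show ?thesis
    unfolding corresponding_extension_def
    using quad gen ST inter aniso bM mem by metis
qed

end

lemma irreducible_optimal_multipliers:
  assumes dim: "dim UNIV = 2 * n" and n: "n \<ge> 2"
    and big: "infinite (UNIV :: 'f set) \<or> card (UNIV :: 'f set) > 2 * n - 2"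
    and irr: "irreducible_space scale S" and opt: "optimal scale s S"
  shows "corresponding_extension scale s S (multipliers S)"
proof -
  have S: "optimal_space UNIV n S" by (rule optimal_iff[OF dim n big opt])
  have "\<not> paired UNIV S x" for x
  proof
    assume p: "paired UNIV S x"
    show False
    proof (rule optimal_reducible[OF S p])
      fix Q assume Q: "subspace Q" "Q \<noteq> {0}" "Q \<noteq> UNIV" and inv: "\<And>u z. u \<in> S \<Longrightarrow> z \<in> Q \<Longrightarrow> u z \<in> Q"
      have "\<forall>u\<in>S. u ` Q \<subseteq> Q" using inv by blast
      then show False using irr[unfolded irreducible_space_def, THEN spec, of Q] Q by simp
    qed
  qed
  then show ?thesis by (rule corresponding_multipliers[OF S n big])
qed

lemma corresponding_extensionD:
  assumes "corresponding_extension scale s S L"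
  shows "L \<subseteq> Endo scale" "fs.subspace L" "fs.dim L = 2" "S = (\<Inter>l\<in>L. alt_endo scale (twist s l))"
proof -
  have q: "quadratic_extension scale L"
    using assms unfolding corresponding_extension_def by (rule conjunct1)
  then show "fs.dim L = 2" unfolding quadratic_extension_def by (elim conjE)
  have "endo_subspace scale L" using q unfolding quadratic_extension_def unital_subalgebra_def by (elim conjE)
  then have e: "L \<subseteq> Endo scale \<and> fs.subspace L" unfolding endo_subspace_def .
  show "L \<subseteq> Endo scale" using e by (rule conjunct1)
  show "fs.subspace L" using e by (rule conjunct2)
  show "S = (\<Inter>l\<in>L. alt_endo scale (twist s l))"
    using assms unfolding corresponding_extension_def by (elim conjE bexE)
qed

text \<open>The description of S as an intersection over L puts L into \<open>multipliers S\<close>,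
  and both have dimension 2.\<close>

lemma corresponding_extension_unique:
  assumes M: "corresponding_extension scale s S (multipliers S)" and L: "corresponding_extension scale s S L"
  shows "L = multipliers S"
proof (rule fs.finitely_spanned_dim_eq)
  note LD = corresponding_extensionD[OF L]
  show "finitely_spanned (fscale scale) (multipliers S)"
    by (rule finitely_spanned_Endo) (auto simp: multipliers_def)
  show "L \<subseteq> multipliers S"
  proof
    fix l assume l: "l \<in> L"
    have "S \<subseteq> alt_endo scale (twist s l)" unfolding LD(4) by (rule INT_lower[OF l])
    then have "\<forall>u\<in>S. \<forall>x. s x (l (u x)) = 0" unfolding alt_endo_def twist_def by blast
    then show "l \<in> multipliers S" using l LD(1) unfolding multipliers_def by blast
  qed
  show "fs.dim (multipliers S) \<le> fs.dim L" using corresponding_extensionD(3)[OF M] LD(3) by simp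
  show "fs.subspace L" by (rule LD(2))
qed

subsection \<open>Conjugation by symplectic maps\<close>

lemma Sp_iff: "g \<in> Sp scale s \<longleftrightarrow> lin g \<and> bij g \<and> (\<forall>x y. s (g x) (g y) = s x y)"
  unfolding Sp_def Endo_def by simp

lemma Sp_inv:
  assumes "g \<in> Sp scale s"
  shows "inv g \<in> Sp scale s" "g (inv g x) = x" "inv g (g x) = x" "inv (inv g) = g"
proof -
  have p: "lin g" "bij g" "\<And>x y. s (g x) (g y) = s x y" using assms unfolding Sp_iff by auto
  show *: "g (inv g x) = x" "inv g (g x) = x" for x
    using p(2) by (simp_all add: bij_is_surj surj_f_inv_f bij_is_inj)
  show "inv (inv g) = g" using p(2) by (rule inv_inv_eq)
  have "inv g (x + y) = inv g x + inv g y" "inv g (r *s x) = r *s inv g x" for x y r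
    using *(2) by (metis *(1) lin_add[OF p(1)] , metis * lin_scale[OF p(1)])
  then have "lin (inv g)" unfolding lin_iff by blast
  moreover have "s (inv g x) (inv g y) = s x y" for x y using p(3)[of "inv g x" "inv g y"] * by simp
  ultimately show "inv g \<in> Sp scale s" unfolding Sp_iff using p(2) bij_imp_bij_inv by blast
qed

lemma Sp_move:
  assumes "g \<in> Sp scale s"
  shows "s x (g y) = s (inv g x) y"
  using assms Sp_inv(2)[OF assms, of x] unfolding Sp_iff by metis

lemma conj_set_inv:
  assumes "g \<in> Sp scale s"
  shows "conj_set g (conj_set (inv g) X) = X" "conj_set (inv g) (conj_set g X) = X"
proof -
  have "g \<circ> (inv g \<circ> u \<circ> inv (inv g)) \<circ> inv g = u" "inv g \<circ> (g \<circ> u \<circ> inv g) \<circ> inv (inv g) = u" for u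
    by (simp_all add: fun_eq_iff Sp_inv[OF assms])
  then show "conj_set g (conj_set (inv g) X) = X" "conj_set (inv g) (conj_set g X) = X"
    unfolding conj_set_def image_image by simp_all
qed

lemma conj_set_mono: "X \<subseteq> Y \<Longrightarrow> conj_set g X \<subseteq> conj_set g Y"
  unfolding conj_set_def by blast

lemma lin_conj:
  assumes "g \<in> Sp scale s" "lin u"
  shows "lin (g \<circ> u \<circ> inv g)"
  using assms(1) Sp_inv(1)[OF assms(1)] assms(2) unfolding Sp_iff by (simp add: lin_iff)

lemma conj_multipliers_subset:
  assumes "g \<in> Sp scale s"
  shows "conj_set g (multipliers S) \<subseteq> multipliers (conj_set g S)"
  unfolding conj_set_def multipliers_def Endo_def
  by (auto simp: lin_conj[OF assms] Sp_move[OF assms] Sp_inv[OF assms])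

lemma conj_multipliers:
  assumes "g \<in> Sp scale s"
  shows "multipliers (conj_set g S) = conj_set g (multipliers S)"
proof
  have "conj_set (inv g) (multipliers (conj_set g S)) \<subseteq> multipliers S"
    using conj_multipliers_subset[OF Sp_inv(1)[OF assms], of "conj_set g S"] conj_set_inv(2)[OF assms] by simp
  from conj_set_mono[OF this, of g]
  show "multipliers (conj_set g S) \<subseteq> conj_set g (multipliers S)" unfolding conj_set_inv(1)[OF assms] .
qed (rule conj_multipliers_subset[OF assms])

text \<open>Recovers S from its extension, as \<open>multipliers\<close> recovers the extension from
  S. Both assignments commute with symplectic conjugation, which gives the two directions of the
  conjugacy criterion.\<close>

definition common_alt :: "('v \<Rightarrow> 'v) set \<Rightarrow> ('v \<Rightarrow> 'v) set"
  where "common_alt L = (\<Inter>l\<in>L. alt_endo scale (twist s l))"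

lemma conj_common_alt_subset:
  assumes "g \<in> Sp scale s"
  shows "conj_set g (common_alt L) \<subseteq> common_alt (conj_set g L)"
  unfolding conj_set_def common_alt_def alt_endo_def twist_def Endo_def
  by (auto simp: lin_conj[OF assms] Sp_move[OF assms] Sp_inv[OF assms])

lemma conj_common_alt:
  assumes "g \<in> Sp scale s"
  shows "common_alt (conj_set g L) = conj_set g (common_alt L)"
proof
  have "conj_set (inv g) (common_alt (conj_set g L)) \<subseteq> common_alt L"
    using conj_common_alt_subset[OF Sp_inv(1)[OF assms], of "conj_set g L"] conj_set_inv(2)[OF assms] by simp
  from conj_set_mono[OF this, of g]
  show "common_alt (conj_set g L) \<subseteq> conj_set g (common_alt L)" unfolding conj_set_inv(1)[OF assms] .
qed (rule conj_common_alt_subset[OF assms])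

end

theorem theorem1p14:
  fixes scale :: "'f::field \<Rightarrow> 'v::ab_group_add \<Rightarrow> 'v"
    and s :: "'v \<Rightarrow> 'v \<Rightarrow> 'f"
    and n :: nat
  assumes "symplectic_space scale s"
    and "vector_space.dim scale (UNIV :: 'v set) = 2 * n"
    and "n \<ge> 2"
    and "infinite (UNIV :: 'f set) \<or> card (UNIV :: 'f set) > 2 * n - 2"
  shows "(\<forall>S. irreducible_space scale S \<and> optimal scale s S \<longrightarrow>
            (\<exists>!L. corresponding_extension scale s S L)) \<and>
         (\<forall>S S' L L'.
            irreducible_space scale S \<and> optimal scale s S \<and> corresponding_extension scale s S L \<and>
            irreducible_space scale S' \<and> optimal scale s S' \<and> corresponding_extension scale s S' L' \<longrightarrow>
            ((\<exists>\<phi>\<in>Sp scale s. S' = conj_set \<phi> S) \<longleftrightarrow> (\<exists>\<phi>\<in>Sp scale s. L' = conj_set \<phi> L)))"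
proof -
  obtain B where B: "finite_dimensional_vector_space scale B"
    using assms(1) unfolding symplectic_space_def by blast
  interpret finite_dimensional_vector_space scale B by (rule B)
  interpret symplectic_form scale B s
    using assms(1) unfolding symplectic_space_def by unfold_locales auto
  have M: "corresponding_extension scale s S (multipliers S)"
    if "irreducible_space scale S" "optimal scale s S" for S
    by (rule irreducible_optimal_multipliers[OF assms(2-4) that])
  have LM: "L = multipliers S"
    if "irreducible_space scale S" "optimal scale s S" "corresponding_extension scale s S L" for S L
    by (rule corresponding_extension_unique[OF M[OF that(1,2)] that(3)])
  have SL: "S = common_alt L" if "corresponding_extension scale s S L" for S L
    unfolding common_alt_def by (rule corresponding_extensionD(4)[OF that])
  show ?thesis
  proof (intro conjI allI impI)
    fix S assume S: "irreducible_space scale S \<and> optimal scale s S"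
    show "\<exists>!L. corresponding_extension scale s S L"
      using M LM S by blast
  next
    fix S S' L L'
    assume *: "irreducible_space scale S \<and> optimal scale s S \<and> corresponding_extension scale s S L \<and>
      irreducible_space scale S' \<and> optimal scale s S' \<and> corresponding_extension scale s S' L'"
    have L: "L = multipliers S" "L' = multipliers S'" using LM * by blast+
    have S: "S = common_alt L" "S' = common_alt L'" using SL * by blast+
    show "(\<exists>\<phi>\<in>Sp scale s. S' = conj_set \<phi> S) \<longleftrightarrow> (\<exists>\<phi>\<in>Sp scale s. L' = conj_set \<phi> L)"
    proof
      assume "\<exists>\<phi>\<in>Sp scale s. S' = conj_set \<phi> S"
      then show "\<exists>\<phi>\<in>Sp scale s. L' = conj_set \<phi> L" unfolding L using conj_multipliers by blast
    next
      assume "\<exists>\<phi>\<in>Sp scale s. L' = conj_set \<phi> L"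
      then obtain \<phi> where "\<phi> \<in> Sp scale s" "L' = conj_set \<phi> L" by blast
      then have "S' = conj_set \<phi> S" using S conj_common_alt by simp
      then show "\<exists>\<phi>\<in>Sp scale s. S' = conj_set \<phi> S" using \<open>\<phi> \<in> Sp scale s\<close> by blast
    qed
  qed
qed

end
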